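(* Let $n\geqslant4$ and $2\leqslant k\leqslant n-2$, and let $M$ be a Griffiths positive Hermitian $k\times k$ matrix of constant $(1,1)$-forms on $\mathbb{C}^n$ satisfying the simultaneous diagonalizability (SD) condition. Then the Lefschetz map $L_{\det M}^{1,n-k-1}$ is an isomorphism. Moreover, for every pair of nonnegative integers $p,q$ with $p+q=n-k$ and $\min(p,q)\leqslant1$, the form $\det M$ is Hodge--Riemann for $(p,q)$ with respect to any positive (i.e. Kähler) reference $(1,1)$-form $\omega$.
   Context: Let $V=\mathbb{C}^n$, and let $V^{p,q}=\Lambda^pV^*\otimes\Lambda^q\overline{V^*}$ be the space of constant-coefficient $(p,q)$-forms. For $\Omega\in V^{k,k}$ and nonnegative integers $p,q$ with $p+q=n-k$, the Lefschetz map is $L_\Omega^{p,q}\colon V^{p,q}\to V^{n-q,n-p}$, $\alpha\mapsto\alpha\wedge\Omega$. A Hermitian $k\times k$ matrix of constant $(1,1)$-forms is $M=(\alpha_{ab})_{a,b=1}^k$ with $\alpha_{ba}=\overline{\alpha_{ab}}$. Since $(1,1)$-forms commute under the wedge product, $\det M$ is defined by the usual permutation formula; it is a real $(k,k)$-form. A real constant $(1,1)$-form is Kähler (positive) if its associated Hermitian form is positive definite, i.e. it equals $\frac{\sqrt{-1}}{2}\sum_j dw_j\wedge d\bar w_j$ in some complex linear coordinates. $M$ is Griffiths positive if $\sum_{a,b}\theta_a\overline{\theta_b}\,\alpha_{ab}$ is Kähler for every $0\ne\theta\in\mathbb{C}^k$. $M$ satisfies the SD condition if there are complex linear coordinates $z_1,\dots,z_n$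 on $\mathbb{C}^n$ such that $M=\sum_{j=1}^nB_jV_j$, where $V_j=\frac{\sqrt{-1}}{2}dz_j\wedge d\bar z_j$ and each $B_j=B_j^*$ is a constant Hermitian $k\times k$ matrix (the $B_j$ need not commute). Fix a Kähler reference form $\omega$. A real $(k,k)$-form $\Omega$ is Lefschetz for $(p,q)$ (where $p+q=n-k$) if $L_\Omega^{p,q}$ is an isomorphism. It is Hodge--Riemann for $(p,q)$ (with respect to $\omega$) if there is a continuous path of real $(k,k)$-forms $\Omega_t$, $0\leqslant t\leqslant1$, with $\Omega_0=\Omega$, $\Omega_1=\omega^k$, such that $\Omega_t\wedge\omega^{2r}$ is Lefschetz for $(p-r,q-r)$ for every integer $0\leqslant r\leqslant\min\{p,q\}$ and every $t\in[0,1]$. *)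

theory Defs
  imports
    "HOL-Analysis.Function_Topology"
    "HOL-Combinatorics.Permutations"
    "Jordan_Normal_Form.Schur_Decomposition"
begin

text \<open>
  A constant-coefficient form on \<open>C^n\<close> is given by its coefficients: \<open>\<alpha> I J\<close> is the
  coefficient of \<open>dx_I \<and> d(cnj x)_J\<close>, where \<open>x_0, \<dots>, x_{n-1}\<close> are the standard coordinates,
  and \<open>dx_I\<close> is the wedge product of the \<open>dx_i\<close>, \<open>i \<in> I\<close>, in increasing order
  (likewise \<open>d(cnj x)_J\<close>).
\<close>

type_synonym form = "nat set \<Rightarrow> nat set \<Rightarrow> complex"

definition forms :: "nat \<Rightarrow> nat \<Rightarrow> nat \<Rightarrow> form set" where
  "forms n p q = {\<alpha>. \<forall>I J. \<alpha> I J \<noteq> 0 \<longrightarrow>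
     I \<subseteq> {..<n} \<and> card I = p \<and> J \<subseteq> {..<n} \<and> card J = q}"

text \<open>For disjoint \<open>I\<close>, \<open>J\<close>: \<open>dx_I \<and> dx_J = shuffle_sign I J \<cdot> dx_{I \<union> J}\<close>.\<close>

definition shuffle_sign :: "nat set \<Rightarrow> nat set \<Rightarrow> complex" where
  "shuffle_sign I J = (-1) ^ card {(i, j). i \<in> I \<and> j \<in> J \<and> j < i}"

text \<open>
  The factor \<open>(-1) ^ (card J\<^sub>1 * card (I - I\<^sub>1))\<close> comes from moving \<open>dx_{I - I\<^sub>1}\<close> to the
  left of \<open>d(cnj x)_{J\<^sub>1}\<close>.
\<close>

definition wedge :: "form \<Rightarrow> form \<Rightarrow> form" where
  "wedge \<alpha> \<beta> = (\<lambda>I J. \<Sum>I\<^sub>1\<in>Pow I. \<Sum>J\<^sub>1\<in>Pow J.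
     (-1) ^ (card J\<^sub>1 * card (I - I\<^sub>1)) * shuffle_sign I\<^sub>1 (I - I\<^sub>1) * shuffle_sign J\<^sub>1 (J - J\<^sub>1)
       * \<alpha> I\<^sub>1 J\<^sub>1 * \<beta> (I - I\<^sub>1) (J - J\<^sub>1))"

definition unit_form :: form where
  "unit_form = (\<lambda>I J. if I = {} \<and> J = {} then 1 else 0)"

definition wedge_list :: "form list \<Rightarrow> form" where
  "wedge_list \<alpha>s = foldr wedge \<alpha>s unit_form"

definition wedge_power :: "form \<Rightarrow> nat \<Rightarrow> form" where
  "wedge_power \<alpha> m = wedge_list (replicate m \<alpha>)"

text \<open>
  The conjugate of \<open>c dx_J \<and> d(cnj x)_I\<close> is
  \<open>(cnj c) d(cnj x)_J \<and> dx_I = (-1)^{|I||J|} (cnj c) dx_I \<and> d(cnj x)_J\<close>.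
\<close>

definition conj_form :: "form \<Rightarrow> form" where
  "conj_form \<alpha> = (\<lambda>I J. (-1) ^ (card I * card J) * cnj (\<alpha> J I))"

definition real_forms :: "nat \<Rightarrow> nat \<Rightarrow> form set" where
  "real_forms n k = {\<alpha> \<in> forms n k k. conj_form \<alpha> = \<alpha>}"

text \<open>
  The Hermitian form associated with \<open>\<eta> = \<i>/2 \<Sum> h_{ij} dx_i \<and> d(cnj x)_j\<close> has the matrix
  \<open>(h_{ij})\<close>; it is Hermitian if and only if \<open>\<eta>\<close> is real, and then the sum below is a real number.
\<close>

definition herm_coeff :: "form \<Rightarrow> nat \<Rightarrow> nat \<Rightarrow> complex" where
  "herm_coeff \<eta> i j = \<eta> {i} {j} / (\<i> / 2)"

definition kahler :: "nat \<Rightarrow> form \<Rightarrow> bool" where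
  "kahler n \<eta> \<longleftrightarrow> \<eta> \<in> real_forms n 1 \<and>
     (\<forall>v \<in> carrier_vec n. v \<noteq> 0\<^sub>v n \<longrightarrow>
        0 < Re (\<Sum>i<n. \<Sum>j<n. herm_coeff \<eta> i j * (v $ i) * cnj (v $ j)))"

definition hermitian_form_matrix :: "nat \<Rightarrow> nat \<Rightarrow> form mat \<Rightarrow> bool" where
  "hermitian_form_matrix n k M \<longleftrightarrow> M \<in> carrier_mat k k \<and>
     (\<forall>a<k. \<forall>b<k. M $$ (a, b) \<in> forms n 1 1 \<and> M $$ (b, a) = conj_form (M $$ (a, b)))"

text \<open>
  The products are taken in the order of the rows; (1,1)-forms commute, so this is immaterial
  for matrices of (1,1)-forms.
\<close>

definition det_form :: "form mat \<Rightarrow> form" where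
  "det_form M = (\<lambda>I J. \<Sum>\<pi> | \<pi> permutes {..<dim_row M}.
     of_int (sign \<pi>) * wedge_list (map (\<lambda>a. M $$ (a, \<pi> a)) [0..<dim_row M]) I J)"

definition griffiths_positive :: "nat \<Rightarrow> nat \<Rightarrow> form mat \<Rightarrow> bool" where
  "griffiths_positive n k M \<longleftrightarrow>
     (\<forall>\<theta> \<in> carrier_vec k. \<theta> \<noteq> 0\<^sub>v k \<longrightarrow>
        kahler n (\<lambda>I J. \<Sum>a<k. \<Sum>b<k. (\<theta> $ a) * cnj (\<theta> $ b) * (M $$ (a, b)) I J))"

text \<open>
  An invertible matrix \<open>P\<close> gives the complex linear coordinates \<open>z_l = \<Sum>_i P_{li} x_i\<close>,
  and \<open>coord_diff n P l\<close> is \<open>dz_l\<close>.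
\<close>

definition coord_diff :: "nat \<Rightarrow> complex mat \<Rightarrow> nat \<Rightarrow> form" where
  "coord_diff n P l = (\<lambda>I J. \<Sum>i<n. if I = {i} \<and> J = {} then P $$ (l, i) else 0)"

definition coord_area :: "nat \<Rightarrow> complex mat \<Rightarrow> nat \<Rightarrow> form" where
  "coord_area n P l =
     (\<lambda>I J. \<i> / 2 * wedge (coord_diff n P l) (conj_form (coord_diff n P l)) I J)"

definition simultaneously_diagonalizable :: "nat \<Rightarrow> nat \<Rightarrow> form mat \<Rightarrow> bool" where
  "simultaneously_diagonalizable n k M \<longleftrightarrow>
     (\<exists>P \<in> carrier_mat n n. invertible_mat P \<and>
       (\<exists>B :: nat \<Rightarrow> complex mat.
          (\<forall>l<n. B l \<in> carrier_mat k k \<and> mat_adjoint (B l) = B l) \<and>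
          (\<forall>a<k. \<forall>b<k. M $$ (a, b) = (\<lambda>I J. \<Sum>l<n. B l $$ (a, b) * coord_area n P l I J))))"

definition lefschetz_map :: "form \<Rightarrow> form \<Rightarrow> form" where
  "lefschetz_map \<Omega> \<alpha> = wedge \<alpha> \<Omega>"

lemma lefschetz_map_linear:
  "lefschetz_map \<Omega> (\<lambda>I J. c * \<alpha> I J + d * \<beta> I J) =
     (\<lambda>I J. c * lefschetz_map \<Omega> \<alpha> I J + d * lefschetz_map \<Omega> \<beta> I J)"
proof -
  have *: "s * (c * x + d * y) * z = c * (s * x * z) + d * (s * y * z)" for s x y z :: complex
    by (simp add: algebra_simps)
  show ?thesis
    unfolding lefschetz_map_def wedge_def * by (simp only: sum.distrib sum_distrib_left)
qed

text \<open>
  Since \<open>lefschetz_map \<Omega>\<close> is linear, being an isomorphism amounts to being bijective. The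
  predicate is meant for (k,k)-forms \<open>\<Omega>\<close> with \<open>p + q = n - k\<close>.
\<close>

definition lefschetz :: "nat \<Rightarrow> nat \<Rightarrow> nat \<Rightarrow> form \<Rightarrow> bool" where
  "lefschetz n p q \<Omega> \<longleftrightarrow> bij_betw (lefschetz_map \<Omega>) (forms n p q) (forms n (n - q) (n - p))"

text \<open>
  Continuity refers to the product topology on the type of forms, that is, to continuity of all
  coefficients; on \<open>forms n k k\<close> this is the usual topology of a finite-dimensional space.
\<close>

definition hodge_riemann :: "nat \<Rightarrow> nat \<Rightarrow> nat \<Rightarrow> nat \<Rightarrow> form \<Rightarrow> form \<Rightarrow> bool" where
  "hodge_riemann n k p q \<omega> \<Omega> \<longleftrightarrow>
     (\<exists>\<Omega>\<^sub>t :: real \<Rightarrow> form.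
        continuous_on {0..1} \<Omega>\<^sub>t \<and>
        (\<forall>t\<in>{0..1}. \<Omega>\<^sub>t t \<in> real_forms n k) \<and>
        \<Omega>\<^sub>t 0 = \<Omega> \<and> \<Omega>\<^sub>t 1 = wedge_power \<omega> k \<and>
        (\<forall>t\<in>{0..1}. \<forall>r \<le> min p q.
           lefschetz n (p - r) (q - r) (wedge (\<Omega>\<^sub>t t) (wedge_power \<omega> (2 * r)))))"

end

theory Submission
  imports
    Defs
    "HOL-Analysis.Convex"
    "HOL-Computational_Algebra.Fundamental_Theorem_Algebra"
begin

text \<open>
  In the diagonalizing coordinates \<open>det M\<close> is the sum of \<open>c S V\<^sub>S\<close> over the \<open>k\<close>-subsets \<open>S\<close>, where
  \<open>c S\<close> is \<open>k!\<close> times the mixed discriminant of the \<open>B\<^sub>l\<close>, \<open>l \<in> S\<close>, and Griffiths positivity says that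
  all \<open>B\<^sub>l\<close> are positive definite, so \<open>c S > 0\<close>. By torus weights, the Lefschetz map in degree \<open>(0, q)\<close>
  is diagonal with entries \<open>c S\<close>, and in degree \<open>(1, q)\<close> it splits into such entries and, for every
  \<open>T\<close> with \<open>k + 2\<close> elements, the symmetric matrix \<open>A\<close> with zero diagonal and \<open>A i j = c (T - {i, j})\<close>.

  The polynomial \<open>det (\<Sum>x\<^sub>l B\<^sub>l)\<close> is stable, hence so are its multi-affine part and the reversal of the
  latter, which is the quadratic form of \<open>A\<close>. So this form is nonpositive on the hyperplane
  orthogonal to any row of \<open>A\<close>. Since positive definiteness is an open condition, this forces a
  singular \<open>A\<close> to stay singular when one \<open>B\<^sub>l\<close> is replaced by the identity matrix; but \<open>A\<close> is a
  nonzero multiple of \<open>J - I\<close> when all \<open>B\<^sub>l\<close> are the identity.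

  The path moves all \<open>B\<^sub>l\<close> to the identity, reaching the power of a Kaehler form, and then moves this
  Kaehler form to \<open>\<omega>\<close>; powers of Kaehler forms are determinants of the same kind. The condition with
  \<open>\<omega>\<^sup>2\<close> holds because its coefficient matrix is a positive combination of rank-one terms that span.
\<close>

section \<open>Positive definite Hermitian matrices\<close>

text \<open>The \<open>B l\<close> need not commute, so \<open>c S\<close> is not a product of
  eigenvalues and \<open>A\<close> has no explicit inverse; only sign information is available.
  Nonpositivity of the form on the hyperplane of row \<open>l\<close> comes from the zero diagonal:
  the basis vector of \<open>l\<close> is isotropic, so a vector \<open>z\<close> in that hyperplane
  can be shifted along it, without changing the value at \<open>z\<close>, until it is orthogonal to
  the all-ones vector. If the value were positive, subtracting a suitable multiple of
  \<open>\<i>\<close> from all entries would give a zero in the open lower half-plane, against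
  stability. Row \<open>l\<close> does not involve \<open>B l\<close>, so the hyperplane is fixed
  while that slot moves, and the form moves affinely. Openness lets the slot also move slightly away
  from the identity; a quantity that is zero at \<open>B l\<close>, affine along the line and of one
  sign on both sides is zero throughout. The same device gives \<open>c S > 0\<close> from
  \<open>c S \<ge> 0\<close>. Truncation keeps stability because the linear coefficient of a
  univariate polynomial, divided by the constant one, is minus the sum of the inverse roots.\<close>

definition quad_form :: "nat \<Rightarrow> (nat \<Rightarrow> nat \<Rightarrow> complex) \<Rightarrow> (nat \<Rightarrow> complex) \<Rightarrow> complex" where
  "quad_form k H v = (\<Sum>a<k. \<Sum>b<k. v a * cnj (v b) * H a b)"

definition pos_def :: "nat \<Rightarrow> (nat \<Rightarrow> nat \<Rightarrow> complex) \<Rightarrow> bool" where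
  "pos_def k H \<longleftrightarrow> (\<forall>a<k. \<forall>b<k. H b a = cnj (H a b)) \<and>
     (\<forall>v. (\<exists>a<k. v a \<noteq> 0) \<longrightarrow> 0 < Re (quad_form k H v))"

lemma pos_defD:
  assumes "pos_def k H"
  shows "a < k \<Longrightarrow> b < k \<Longrightarrow> H b a = cnj (H a b)"
    and "a < k \<Longrightarrow> v a \<noteq> 0 \<Longrightarrow> 0 < Re (quad_form k H v)"
  using assms unfolding pos_def_def by blast+

lemma quad_form_real:
  assumes "pos_def k H"
  shows "quad_form k H v = of_real (Re (quad_form k H v))"
proof -
  have "cnj (quad_form k H v) = (\<Sum>a<k. \<Sum>b<k. cnj (v a) * v b * cnj (H a b))"
    by (simp add: quad_form_def)
  also have "\<dots> = (\<Sum>a<k. \<Sum>b<k. v b * cnj (v a) * H b a)"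
  proof (intro sum.cong refl)
    fix a b assume "a \<in> {..<k}" "b \<in> {..<k}"
    then have "H b a = cnj (H a b)" by (intro pos_defD(1)[OF assms]) auto
    then show "cnj (v a) * v b * cnj (H a b) = v b * cnj (v a) * H b a" by (simp add: mult_ac)
  qed
  also have "\<dots> = quad_form k H v"
    unfolding quad_form_def by (rule sum.swap)
  finally show ?thesis
    by (simp add: complex_eq_iff)
qed

lemma quad_form_cong:
  assumes "\<And>a b. a < k \<Longrightarrow> b < k \<Longrightarrow> H a b = H' a b" "\<And>a. a < k \<Longrightarrow> v a = v' a"
  shows "quad_form k H v = quad_form k H' v'"
  unfolding quad_form_def by (intro sum.cong refl) (use assms in auto)

text \<open>Induction by Schur complements: completing the square in the last coordinate leaves the
  positive definite form of \<open>H'\<close>.\<close>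

lemma cholesky:
  assumes "pos_def n H"
  shows "\<exists>R. \<forall>a<n. \<forall>b<n. H a b = (\<Sum>m<n. R m a * cnj (R m b))"
  using assms
proof (induction n arbitrary: H)
  case 0
  then show ?case by simp
next
  case (Suc n)
  note hd = pos_defD[OF Suc.prems]
  define h where "h = H n n"
  have qn: "quad_form (Suc n) H (\<lambda>a. if a = n then 1 else 0) = h"
    by (simp add: quad_form_def h_def)
  have hre: "h = of_real (Re h)" and hpos: "0 < Re h"
    using quad_form_real[OF Suc.prems, of "\<lambda>a. if a = n then 1 else 0"]
      hd(2)[of n "\<lambda>a. if a = n then 1 else 0"] qn by auto
  have h0: "h \<noteq> 0" and hc: "cnj h = h"
    using hre hpos by auto (metis complex_cnj_complex_of_real)
  define H' where "H' a b = H a b - H a n * H n b / h" for a b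
  have "pos_def n H'"
    unfolding pos_def_def
  proof (intro conjI allI impI)
    fix a b assume "a < n" "b < n"
    then show "H' b a = cnj (H' a b)"
      using hd(1)[of a b] hd(1)[of a n] hd(1)[of n b] hd(1)[of b n] hd(1)[of n a] hc
      by (simp add: H'_def mult.commute)
  next
    fix v :: "nat \<Rightarrow> complex"
    assume "\<exists>a<n. v a \<noteq> 0"
    then obtain a0 where a0: "a0 < n" "v a0 \<noteq> 0" by blast
    define s where "s = (\<Sum>a<n. v a * H a n)"
    have cs: "cnj s = (\<Sum>b<n. cnj (v b) * H n b)"
      unfolding s_def cnj_sum complex_cnj_mult
      by (intro sum.cong refl) (simp add: hd(1)[of _ n])
    \<comment> \<open>The last coordinate is the one that minimizes the form over all extensions of
      \<open>v\<close>.\<close>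
    define u where "u a = (if a = n then - s / h else v a)" for a
    have un: "u n = - s / h" by (simp add: u_def)
    have "quad_form (Suc n) H u =
        (\<Sum>a<n. (\<Sum>b<n. u a * cnj (u b) * H a b) + u a * cnj (u n) * H a n)
        + ((\<Sum>b<n. u n * cnj (u b) * H n b) + u n * cnj (u n) * H n n)"
      by (simp add: quad_form_def)
    also have "\<dots> = quad_form n H v + (\<Sum>a<n. v a * cnj (u n) * H a n)
        + ((\<Sum>b<n. u n * cnj (v b) * H n b) + u n * cnj (u n) * h)"
    proof -
      have "u a = v a" if "a < n" for a using that by (simp add: u_def)
      then show ?thesis by (simp add: sum.distrib quad_form_def h_def)
    qed
    also have "(\<Sum>a<n. v a * cnj (u n) * H a n) = cnj (u n) * s"
      unfolding s_def sum_distrib_left by (intro sum.cong) auto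
    also have "(\<Sum>b<n. u n * cnj (v b) * H n b) = u n * cnj s"
      unfolding cs sum_distrib_left by (intro sum.cong) auto
    also have "quad_form n H v + cnj (u n) * s + (u n * cnj s + u n * cnj (u n) * h)
        = quad_form n H v - s * cnj s / h"
      unfolding un using h0 hc by (simp add: field_simps)
    also have "s * cnj s / h = (\<Sum>a<n. \<Sum>b<n. v a * cnj (v b) * (H a n * H n b / h))"
      unfolding cs unfolding s_def sum_product sum_divide_distrib
      by (intro sum.cong) auto
    also have "quad_form n H v - \<dots> = quad_form n H' v"
      unfolding quad_form_def H'_def sum_subtractf[symmetric]
      by (intro sum.cong refl) (rule right_diff_distrib[symmetric])
    finally have "quad_form n H' v = quad_form (Suc n) H u" by simp
    moreover have "0 < Re (quad_form (Suc n) H u)"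
      by (rule hd(2)[of a0]) (use a0 in \<open>auto simp: u_def\<close>)
    ultimately show "0 < Re (quad_form n H' v)" by simp
  qed
  then obtain R where R: "\<And>a b. a < n \<Longrightarrow> b < n \<Longrightarrow> H' a b = (\<Sum>m<n. R m a * cnj (R m b))"
    using Suc.IH by blast
  define r where "r = complex_of_real (sqrt (Re h))"
  have rr: "r * cnj r = h" and r0: "r \<noteq> 0" and rc: "cnj r = r"
    using hpos hre by (auto simp: r_def of_real_mult[symmetric] simp del: of_real_mult)
  \<comment> \<open>Row \<open>n\<close> reproduces the last row and column of \<open>H\<close>; the
    old rows get a zero in column \<open>n\<close>, so they only account for
    \<open>H'\<close>.\<close>
  define R' where "R' m a = (if m = n then H a n / r else if a = n then 0 else R m a)" for m a
  have "H a b = (\<Sum>m<Suc n. R' m a * cnj (R' m b))" if "a < Suc n" "b < Suc n" for a b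
  proof -
    have last: "R' n a * cnj (R' n b) = H a n * H n b / h"
      using hd(1)[of b n] that rr rc r0 by (simp add: R'_def mult.commute)
    have "(\<Sum>m<n. R' m a * cnj (R' m b)) = H a b - H a n * H n b / h"
    proof (cases "a = n \<or> b = n")
      case True
      then have "(\<Sum>m<n. R' m a * cnj (R' m b)) = 0"
        by (intro sum.neutral) (auto simp: R'_def)
      then show ?thesis using True h0 by (auto simp: h_def)
    next
      case False
      then have "(\<Sum>m<n. R' m a * cnj (R' m b)) = H' a b"
        using that R[of a b] by (auto simp: R'_def intro!: sum.cong)
      then show ?thesis by (simp add: H'_def)
    qed
    then show ?thesis using last by simp
  qed
  then show ?case by blast
qed

lemma quad_form_cholesky:
  assumes "\<And>a b. a < k \<Longrightarrow> b < k \<Longrightarrow> H a b = (\<Sum>m<n. R m a * cnj (R m b))"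
  shows "quad_form k H v = of_real (\<Sum>m<n. (cmod (\<Sum>a<k. R m a * v a))\<^sup>2)"
proof -
  have "quad_form k H v = (\<Sum>a<k. \<Sum>b<k. \<Sum>m<n. (R m a * v a) * cnj (R m b * v b))"
    unfolding quad_form_def
    by (intro sum.cong refl) (simp add: assms sum_distrib_left mult_ac)
  also have "\<dots> = (\<Sum>a<k. \<Sum>m<n. \<Sum>b<k. (R m a * v a) * cnj (R m b * v b))"
    by (intro sum.cong refl sum.swap)
  also have "\<dots> = (\<Sum>m<n. \<Sum>a<k. \<Sum>b<k. (R m a * v a) * cnj (R m b * v b))"
    by (rule sum.swap)
  also have "\<dots> = (\<Sum>m<n. (\<Sum>a<k. R m a * v a) * cnj (\<Sum>b<k. R m b * v b))"
    by (simp add: sum_product)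
  also have "\<dots> = (\<Sum>m<n. of_real ((cmod (\<Sum>a<k. R m a * v a))\<^sup>2))"
    by (intro sum.cong refl) (metis complex_norm_square)
  finally show ?thesis by simp
qed

text \<open>A trivial kernel makes the determinant nonzero. Used for Cholesky factors and again for
  the dimension count behind Lefschetz maps.\<close>

lemma square_system_inverse:
  fixes R :: "nat \<Rightarrow> nat \<Rightarrow> complex"
  assumes "\<And>v. (\<And>m. m < n \<Longrightarrow> (\<Sum>a<n. R m a * v a) = 0) \<Longrightarrow> (\<And>a. a < n \<Longrightarrow> v a = 0)"
  shows "\<exists>S. \<forall>a<n. \<forall>b<n. (\<Sum>m<n. S a m * R m b) = (if a = b then 1 else 0) \<and>
                          (\<Sum>m<n. R a m * S m b) = (if a = b then 1 else 0)"
proof -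
  define A where "A = mat n n (\<lambda>(i, j). R i j)"
  have A: "A \<in> carrier_mat n n" by (simp add: A_def)
  have "det A \<noteq> 0"
  proof
    assume "det A = 0"
    then obtain v where v: "v \<in> carrier_vec n" "v \<noteq> 0\<^sub>v n" "A *\<^sub>v v = 0\<^sub>v n"
      using det_0_iff_vec_prod_zero[OF A] by blast
    have "(\<Sum>a<n. R m a * v $ a) = 0" if "m < n" for m
    proof -
      have "(A *\<^sub>v v) $ m = (\<Sum>a<n. R m a * v $ a)"
        using that v(1) by (simp add: A_def scalar_prod_def lessThan_atLeast0)
      then show ?thesis using v(3) that by simp
    qed
    then have "v $ a = 0" if "a < n" for a using assms[of "\<lambda>a. v $ a"] that by blast
    then have "v = 0\<^sub>v n" using v(1) by auto
    with v(2) show False ..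
  qed
  then have "A \<in> Units (ring_mat TYPE(complex) n undefined)"
    by (rule det_non_zero_imp_unit[OF A])
  then obtain B where B: "B \<in> carrier_mat n n" "B * A = 1\<^sub>m n" "A * B = 1\<^sub>m n"
    unfolding Units_def ring_mat_def by auto
  have "(\<Sum>m<n. B $$ (a, m) * R m b) = (if a = b then 1 else 0)"
    "(\<Sum>m<n. R a m * B $$ (m, b)) = (if a = b then 1 else 0)" if "a < n" "b < n" for a b
  proof -
    have "(B * A) $$ (a, b) = (\<Sum>m<n. B $$ (a, m) * R m b)"
      "(A * B) $$ (a, b) = (\<Sum>m<n. R a m * B $$ (m, b))"
      using that B(1) by (auto simp: A_def scalar_prod_def lessThan_atLeast0 intro!: sum.cong)
    then show "(\<Sum>m<n. B $$ (a, m) * R m b) = (if a = b then 1 else 0)"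
      "(\<Sum>m<n. R a m * B $$ (m, b)) = (if a = b then 1 else 0)"
      using B(2,3) that by auto
  qed
  then show ?thesis by (intro exI[of _ "\<lambda>a m. B $$ (a, m)"]) auto
qed

lemma cholesky_inverse:
  assumes "pos_def n H" "\<And>a b. a < n \<Longrightarrow> b < n \<Longrightarrow> H a b = (\<Sum>m<n. R m a * cnj (R m b))"
  shows "\<exists>S. \<forall>a<n. \<forall>b<n. (\<Sum>m<n. S a m * R m b) = (if a = b then 1 else 0) \<and>
                          (\<Sum>m<n. R a m * S m b) = (if a = b then 1 else 0)"
proof (rule square_system_inverse)
  fix v a
  assume *: "\<And>m. m < n \<Longrightarrow> (\<Sum>a<n. R m a * v a) = 0" and a: "a < n"
  have "quad_form n H v = 0"
    by (subst quad_form_cholesky[OF assms(2)]) (auto simp: *)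
  then show "v a = 0"
    using pos_defD(2)[OF assms(1) a, of v] by auto
qed

definition id_matrix :: "nat \<Rightarrow> nat \<Rightarrow> complex" where
  "id_matrix a b = (if a = b then 1 else 0)"

lemma quad_form_id_matrix: "quad_form k id_matrix v = of_real (\<Sum>a<k. (cmod (v a))\<^sup>2)"
proof -
  have "quad_form k id_matrix v = (\<Sum>a<k. \<Sum>b<k. if a = b then v a * cnj (v b) else 0)"
    unfolding quad_form_def id_matrix_def by (intro sum.cong) auto
  also have "\<dots> = (\<Sum>a<k. v a * cnj (v a))" by simp
  also have "\<dots> = (\<Sum>a<k. of_real ((cmod (v a))\<^sup>2))"
    by (intro sum.cong refl) (metis complex_norm_square)
  finally show ?thesis by simp
qed

text \<open>Recovering \<open>v\<close> from its image under the Cholesky factor costs at most the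
  norm of the inverse factor, which replaces a compactness argument on the unit sphere.\<close>

lemma pos_def_coercive:
  assumes "pos_def k H"
  shows "\<exists>C\<ge>0. \<forall>v. Re (quad_form k id_matrix v) \<le> C * Re (quad_form k H v)"
proof -
  obtain R where R: "\<And>a b. a < k \<Longrightarrow> b < k \<Longrightarrow> H a b = (\<Sum>m<k. R m a * cnj (R m b))"
    using cholesky[OF assms] by blast
  obtain S where S: "\<And>a b. a < k \<Longrightarrow> b < k \<Longrightarrow>
      (\<Sum>m<k. S a m * R m b) = (if a = b then 1 else 0)"
    using cholesky_inverse[OF assms R] by blast
  \<comment> \<open>The squared Frobenius norm of the inverse of the Cholesky factor.\<close>
  define C where "C = (\<Sum>a<k. \<Sum>m<k. (cmod (S a m))\<^sup>2)"
  show ?thesis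
  proof (intro exI[of _ C] conjI allI)
    show "0 \<le> C" by (simp add: C_def sum_nonneg)
    fix v
    define w where "w m = (\<Sum>b<k. R m b * v b)" for m
    have qw: "Re (quad_form k H v) = (\<Sum>m<k. (cmod (w m))\<^sup>2)"
      by (subst quad_form_cholesky[OF R]) (auto simp: w_def)
    have vw: "v a = (\<Sum>m<k. S a m * w m)" if "a < k" for a
    proof -
      have "(\<Sum>m<k. S a m * w m) = (\<Sum>m<k. \<Sum>b<k. S a m * R m b * v b)"
        by (simp add: w_def sum_distrib_left mult.assoc)
      also have "\<dots> = (\<Sum>b<k. \<Sum>m<k. S a m * R m b * v b)" by (rule sum.swap)
      also have "\<dots> = (\<Sum>b<k. (if a = b then 1 else 0) * v b)"
        by (intro sum.cong refl) (simp add: S that sum_distrib_right[symmetric])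
      also have "\<dots> = (\<Sum>b<k. if a = b then v b else 0)" by (intro sum.cong) auto
      also have "\<dots> = v a" using that by simp
      finally show ?thesis by simp
    qed
    have "(cmod (v a))\<^sup>2 \<le> (\<Sum>m<k. (cmod (S a m))\<^sup>2) * (\<Sum>m<k. (cmod (w m))\<^sup>2)" if "a < k" for a
    proof -
      have "cmod (v a) \<le> (\<Sum>m<k. cmod (S a m) * cmod (w m))"
        unfolding vw[OF that] by (rule order_trans[OF norm_sum]) (simp add: norm_mult)
      then have "(cmod (v a))\<^sup>2 \<le> (\<Sum>m<k. cmod (S a m) * cmod (w m))\<^sup>2"
        by (intro power_mono) auto
      also have "\<dots> \<le> (\<Sum>m<k. (cmod (S a m))\<^sup>2) * (\<Sum>m<k. (cmod (w m))\<^sup>2)"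
        by (rule Cauchy_Schwarz_ineq_sum)
      finally show ?thesis .
    qed
    then have "(\<Sum>a<k. (cmod (v a))\<^sup>2) \<le> C * (\<Sum>m<k. (cmod (w m))\<^sup>2)"
      unfolding C_def sum_distrib_right by (intro sum_mono) auto
    then show "Re (quad_form k id_matrix v) \<le> C * Re (quad_form k H v)"
      by (simp add: quad_form_id_matrix qw)
  qed
qed

text \<open>Also used for negative \<open>t\<close>, where it continues the segment from the
  identity to \<open>H\<close> beyond \<open>H\<close>.\<close>

definition toward_id :: "real \<Rightarrow> (nat \<Rightarrow> nat \<Rightarrow> complex) \<Rightarrow> nat \<Rightarrow> nat \<Rightarrow> complex" where
  "toward_id t H a b = of_real (1 - t) * H a b + of_real t * id_matrix a b"

lemma quad_form_toward_id:
  "quad_form k (toward_id t H) v = of_real (1 - t) * quad_form k H v + of_real t * quad_form k id_matrix v"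
  unfolding quad_form_def toward_id_def sum_distrib_left sum.distrib[symmetric]
  by (intro sum.cong refl) (simp add: algebra_simps)

lemma pos_def_id_matrix: "pos_def k id_matrix"
  unfolding pos_def_def
proof (intro conjI allI impI)
  fix v :: "nat \<Rightarrow> complex" assume "\<exists>a<k. v a \<noteq> 0"
  then obtain a where "a < k" "v a \<noteq> 0" by blast
  then show "0 < Re (quad_form k id_matrix v)"
    by (auto simp: quad_form_id_matrix intro!: sum_pos2[of _ a])
qed (auto simp: id_matrix_def)

lemma pos_def_toward_id:
  assumes "pos_def k H"
  shows "\<exists>d>0. \<forall>t. - d \<le> t \<longrightarrow> t \<le> 1 \<longrightarrow> pos_def k (toward_id t H)"
proof -
  obtain C where C: "0 \<le> C" "\<And>v. Re (quad_form k id_matrix v) \<le> C * Re (quad_form k H v)"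
    using pos_def_coercive[OF assms] by blast
  show ?thesis
  \<comment> \<open>For \<open>t < 0\<close> the loss \<open>(- t) * id_matrix\<close> is bounded by
    \<open>C / (C + 1)\<close> times the form of \<open>H\<close>, hence by that form itself; adding
    1 covers the case \<open>C = 0\<close>.\<close>
  proof (intro exI[of _ "1 / (C + 1)"] conjI allI impI)
    show "0 < 1 / (C + 1)" using C(1) by simp
    fix t :: real assume t: "- (1 / (C + 1)) \<le> t" "t \<le> 1"
    show "pos_def k (toward_id t H)"
      unfolding pos_def_def
    proof (intro conjI allI impI)
      fix a b assume "a < k" "b < k"
      then show "toward_id t H b a = cnj (toward_id t H a b)"
        using pos_defD(1)[OF assms, of a b] by (simp add: toward_id_def id_matrix_def)
    next
      fix v :: "nat \<Rightarrow> complex" assume "\<exists>a<k. v a \<noteq> 0"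
      then have p: "0 < Re (quad_form k H v)" and i: "0 < Re (quad_form k id_matrix v)"
        using assms pos_def_id_matrix[of k] by (auto simp: pos_def_def)
      have "0 < (1 - t) * Re (quad_form k H v) + t * Re (quad_form k id_matrix v)"
      proof (cases "0 \<le> t")
        case True
        then show ?thesis
          using p i t
          by (cases "t = 0") (simp_all add: add_nonneg_pos)
      next
        case False
        have "(- t) * Re (quad_form k id_matrix v) \<le> 1 / (C + 1) * (C * Re (quad_form k H v))"
          using t False i C p by (intro mult_mono) auto
        also have "\<dots> \<le> Re (quad_form k H v)"
          using p C(1) by (simp add: field_simps)
        finally show ?thesis
          using mult_pos_pos[of "- t" "Re (quad_form k H v)"] False p by (simp add: algebra_simps)
      qed
      then show "0 < Re (quad_form k (toward_id t H) v)"
        by (simp add: quad_form_toward_id)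
    qed
  qed
qed

section \<open>Mixed discriminants and stability\<close>

text \<open>The determinant of the matrix whose row \<open>a\<close> is taken from
  \<open>B (\<sigma> a)\<close>. The determinant of a combination of the \<open>B l\<close> expands
  into these by multilinearity in the rows.\<close>

definition sel_det :: "nat \<Rightarrow> (nat \<Rightarrow> nat \<Rightarrow> nat \<Rightarrow> complex) \<Rightarrow> (nat \<Rightarrow> nat) \<Rightarrow> complex" where
  "sel_det k B \<sigma> = (\<Sum>\<pi> | \<pi> permutes {..<k}. of_int (sign \<pi>) * (\<Prod>a<k. B (\<sigma> a) a (\<pi> a)))"

text \<open>Restricted to extensional maps so that each bijection occurs once in a sum.\<close>

definition bijections :: "nat \<Rightarrow> nat set \<Rightarrow> (nat \<Rightarrow> nat) set" where
  "bijections k S = {\<sigma> \<in> {..<k} \<rightarrow>\<^sub>E S. bij_betw \<sigma> {..<k} S}"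

text \<open>\<open>k!\<close> times the mixed discriminant of the matrices \<open>B l\<close>, \<open>l \<in> S\<close>.\<close>

definition mixed_disc :: "nat \<Rightarrow> (nat \<Rightarrow> nat \<Rightarrow> nat \<Rightarrow> complex) \<Rightarrow> nat set \<Rightarrow> complex" where
  "mixed_disc k B S = (\<Sum>\<sigma>\<in>bijections k S. sel_det k B \<sigma>)"

definition maps_upto_once :: "nat \<Rightarrow> nat set \<Rightarrow> nat set \<Rightarrow> (nat \<Rightarrow> nat) set" where
  "maps_upto_once k L U = {\<sigma> \<in> {..<k} \<rightarrow>\<^sub>E L. \<forall>l\<in>U. card {a \<in> {..<k}. \<sigma> a = l} \<le> 1}"

text \<open>
  The terms of \<open>det (\<Sum>l\<in>L. x l * B l)\<close>, as a polynomial in \<open>x\<close>, whose degree in each variable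
  \<open>x l\<close>, \<open>l \<in> U\<close>, is at most one.
\<close>

definition trunc_det ::
    "nat \<Rightarrow> (nat \<Rightarrow> nat \<Rightarrow> nat \<Rightarrow> complex) \<Rightarrow> nat set \<Rightarrow> nat set \<Rightarrow> (nat \<Rightarrow> complex) \<Rightarrow> complex" where
  "trunc_det k B L U x = (\<Sum>\<sigma>\<in>maps_upto_once k L U. (\<Prod>a<k. x (\<sigma> a)) * sel_det k B \<sigma>)"

section \<open>Stability of the determinant and of its multi-affine part\<close>

lemma finite_bijections: "finite S \<Longrightarrow> finite (bijections k S)"
  unfolding bijections_def by (rule finite_subset[OF _ finite_PiE[of "{..<k}" "\<lambda>_. S"]]) auto

lemma finite_maps_upto_once: "finite L \<Longrightarrow> finite (maps_upto_once k L U)"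
  unfolding maps_upto_once_def by (rule finite_subset[OF _ finite_PiE[of "{..<k}" "\<lambda>_. L"]]) auto

lemma trunc_det_empty:
  assumes "finite L"
  shows "trunc_det k B L {} x = det (mat k k (\<lambda>(a, b). \<Sum>l\<in>L. x l * B l a b))"
proof -
  have "det (mat k k (\<lambda>(a, b). \<Sum>l\<in>L. x l * B l a b)) =
      (\<Sum>\<pi> | \<pi> permutes {..<k}. of_int (sign \<pi>) * (\<Prod>a<k. \<Sum>l\<in>L. x l * B l a (\<pi> a)))"
    unfolding det_def'[of _ k, OF mat_carrier] lessThan_atLeast0
    by (intro sum.cong refl arg_cong2[of _ _ _ _ "(*)"] prod.cong)
       (auto dest: permutes_in_image)
  also have "\<dots> = (\<Sum>\<pi> | \<pi> permutes {..<k}. of_int (sign \<pi>) *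
      (\<Sum>\<sigma>\<in>{..<k} \<rightarrow>\<^sub>E L. \<Prod>a<k. x (\<sigma> a) * B (\<sigma> a) a (\<pi> a)))"
    by (intro sum.cong refl arg_cong2[of _ _ _ _ "(*)"] prod_sum_PiE) (use assms in auto)
  also have "\<dots> = (\<Sum>\<pi> | \<pi> permutes {..<k}. \<Sum>\<sigma>\<in>{..<k} \<rightarrow>\<^sub>E L.
      (\<Prod>a<k. x (\<sigma> a)) * (of_int (sign \<pi>) * (\<Prod>a<k. B (\<sigma> a) a (\<pi> a))))"
    by (simp add: sum_distrib_left prod.distrib mult_ac)
  also have "\<dots> = (\<Sum>\<sigma>\<in>{..<k} \<rightarrow>\<^sub>E L. \<Sum>\<pi> | \<pi> permutes {..<k}.
      (\<Prod>a<k. x (\<sigma> a)) * (of_int (sign \<pi>) * (\<Prod>a<k. B (\<sigma> a) a (\<pi> a))))"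
    by (rule sum.swap)
  also have "\<dots> = trunc_det k B L {} x"
    by (simp add: trunc_det_def maps_upto_once_def sel_det_def sum_distrib_left)
  finally show ?thesis by simp
qed

text \<open>A kernel vector would give a relation between the \<open>x l\<close> whose coefficients
  are the values of the forms \<open>B l\<close>; these are real and positive, so the imaginary part
  of the combination cannot vanish.\<close>

lemma det_pencil_nonzero:
  assumes "finite L" "L \<noteq> {}" and pd: "\<And>l. l \<in> L \<Longrightarrow> pos_def k (B l)"
    and x: "\<And>l. l \<in> L \<Longrightarrow> 0 < Im (x l)"
  shows "det (mat k k (\<lambda>(a, b). \<Sum>l\<in>L. x l * B l a b)) \<noteq> 0"
proof
  define A where "A = mat k k (\<lambda>(a, b). \<Sum>l\<in>L. x l * B l a b)"
  assume "det (mat k k (\<lambda>(a, b). \<Sum>l\<in>L. x l * B l a b)) = 0"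
  then have "det A = 0" by (simp add: A_def)
  moreover have A: "A \<in> carrier_mat k k" by (simp add: A_def)
  ultimately obtain v where v: "v \<in> carrier_vec k" "v \<noteq> 0\<^sub>v k" "A *\<^sub>v v = 0\<^sub>v k"
    using det_0_iff_vec_prod_zero[OF A] by blast
  have row: "(\<Sum>b<k. (\<Sum>l\<in>L. x l * B l a b) * v $ b) = 0" if "a < k" for a
  proof -
    have "(A *\<^sub>v v) $ a = (\<Sum>b<k. (\<Sum>l\<in>L. x l * B l a b) * v $ b)"
      using that v(1) by (simp add: A_def scalar_prod_def lessThan_atLeast0)
    then show ?thesis using v(3) that by simp
  qed
  \<comment> \<open>Conjugated because \<open>quad_form\<close> conjugates its second argument,
    whereas the kernel vector multiplies the column index.\<close>
  define u where "u a = cnj (v $ a)" for a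
  have "(\<Sum>l\<in>L. x l * quad_form k (B l) u)
      = (\<Sum>l\<in>L. \<Sum>a<k. \<Sum>b<k. u a * (x l * B l a b * v $ b))"
    unfolding quad_form_def sum_distrib_left u_def by (intro sum.cong refl) (simp add: mult_ac)
  also have "\<dots> = (\<Sum>a<k. \<Sum>l\<in>L. \<Sum>b<k. u a * (x l * B l a b * v $ b))"
    by (rule sum.swap)
  also have "\<dots> = (\<Sum>a<k. \<Sum>b<k. \<Sum>l\<in>L. u a * (x l * B l a b * v $ b))"
    by (intro sum.cong refl sum.swap)
  also have "\<dots> = (\<Sum>a<k. u a * (\<Sum>b<k. (\<Sum>l\<in>L. x l * B l a b) * v $ b))"
    by (simp add: sum_distrib_left sum_distrib_right)
  also have "\<dots> = 0" using row by simp
  finally have "(\<Sum>l\<in>L. x l * quad_form k (B l) u) = 0" .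
  then have "Im (\<Sum>l\<in>L. x l * quad_form k (B l) u) = 0" by simp
  moreover have "Im (x l * quad_form k (B l) u) = Im (x l) * Re (quad_form k (B l) u)" if "l \<in> L" for l
    by (subst quad_form_real[OF pd[OF that]]) simp
  ultimately have "(\<Sum>l\<in>L. Im (x l) * Re (quad_form k (B l) u)) = 0" by simp
  moreover obtain a where "a < k" "u a \<noteq> 0"
    using v(1,2) unfolding u_def by (metis complex_cnj_zero_iff eq_vecI index_zero_vec carrier_vecD)
  then have "0 < (\<Sum>l\<in>L. Im (x l) * Re (quad_form k (B l) u))"
    using assms(1,2) pos_defD(2)[OF pd] x by (intro sum_pos mult_pos_pos) auto
  ultimately show False by simp
qed

text \<open>Splitting off a root \<open>r\<close> changes the ratio by \<open>- (1 / r)\<close>, and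
  \<open>1 / r\<close> lies in the closed upper half-plane.\<close>

lemma Im_linear_coeff_ratio_le:
  fixes p :: "complex poly"
  assumes "\<And>r. poly p r = 0 \<Longrightarrow> Im r \<le> 0 \<and> r \<noteq> 0"
  shows "Im (coeff p 1 / coeff p 0) \<le> 0"
  using assms
proof (induction "degree p" arbitrary: p)
  case 0
  then have "coeff p 1 = 0" by (intro coeff_eq_0) simp
  then show ?case by simp
next
  case (Suc n)
  have "\<not> constant (poly p)" using Suc.hyps(2) by (simp add: constant_degree)
  then obtain r where r: "poly p r = 0" using fundamental_theorem_of_algebra by blast
  then obtain q where q: "p = [:- r, 1:] * q" by (auto simp: poly_eq_0_iff_dvd dvd_def)
  have "q \<noteq> 0" using Suc.hyps(2) q by auto
  then have "degree p = Suc (degree q)" unfolding q by (subst degree_mult_eq) auto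
  then have IH: "Im (coeff q 1 / coeff q 0) \<le> 0"
  proof (intro Suc.hyps(1))
    show "n = degree q" using \<open>degree p = Suc (degree q)\<close> Suc.hyps(2) by simp
    fix r' assume "poly q r' = 0"
    then have "poly p r' = 0" by (simp add: q)
    then show "Im r' \<le> 0 \<and> r' \<noteq> 0" by (rule Suc.prems)
  qed
  have q0: "coeff q 0 \<noteq> 0" using Suc.prems[of 0] q by (auto simp: poly_0_coeff_0)
  have r0: "r \<noteq> 0" "Im r \<le> 0" using Suc.prems[OF r] by auto
  have "coeff p 0 = - r * coeff q 0" "coeff p 1 = coeff q 0 - r * coeff q 1"
    unfolding q by (simp_all)
  then have "coeff p 1 / coeff p 0 = - (1 / r) + coeff q 1 / coeff q 0"
    using q0 r0 by (simp add: field_simps)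
  moreover have "0 \<le> Im (1 / r)"
    using r0 by (simp add: Im_divide divide_nonpos_nonneg)
  ultimately show ?case using IH by simp
qed

text \<open>A zero \<open>t\<close> of the affine part would make the ratio of the two coefficients
  equal to \<open>- (1 / t)\<close>, which has positive imaginary part.\<close>

lemma affine_part_nonzero:
  fixes p :: "complex poly"
  assumes "\<And>t. 0 < Im t \<Longrightarrow> poly p t \<noteq> 0" "poly p 0 \<noteq> 0" "0 < Im t"
  shows "coeff p 0 + coeff p 1 * t \<noteq> 0"
proof
  assume eq: "coeff p 0 + coeff p 1 * t = 0"
  have p0: "coeff p 0 \<noteq> 0" using assms(2) by (simp add: poly_0_coeff_0)
  have t0: "t \<noteq> 0" using assms(3) by auto
  have "coeff p 1 / coeff p 0 = - (1 / t)"
    using eq p0 t0 by (simp add: field_simps add_eq_0_iff)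
  moreover have "Im (coeff p 1 / coeff p 0) \<le> 0"
    by (rule Im_linear_coeff_ratio_le) (use assms(1,2) in \<open>force simp: not_le[symmetric]\<close>)
  moreover have "Im (1 / t) < 0"
    using assms(3) t0 by (simp add: Im_divide divide_neg_pos sum_power2_gt_zero_iff complex_eq_iff)
  ultimately show False by simp
qed

definition trunc_poly :: "nat \<Rightarrow> (nat \<Rightarrow> nat \<Rightarrow> nat \<Rightarrow> complex) \<Rightarrow> nat set \<Rightarrow> nat set \<Rightarrow>
    nat \<Rightarrow> (nat \<Rightarrow> complex) \<Rightarrow> complex poly" where
  "trunc_poly k B L U l x = (\<Sum>\<sigma>\<in>maps_upto_once k L U.
    monom ((\<Prod>a\<in>{a \<in> {..<k}. \<sigma> a \<noteq> l}. x (\<sigma> a)) * sel_det k B \<sigma>) (card {a \<in> {..<k}. \<sigma> a = l}))"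

text \<open>Isolates the variable \<open>x l\<close> for \<open>affine_part_nonzero\<close>: the
  values at \<open>t\<close> and at 0 are truncations that are already known to be nonzero, the
  latter with \<open>l\<close> deleted from \<open>L\<close>, and the affine part is the next
  truncation.\<close>

lemma trunc_det_poly:
  assumes "finite L" "l \<in> L" "l \<notin> U"
  shows "trunc_det k B L U (x(l := t)) = poly (trunc_poly k B L U l x) t"
    and "trunc_det k B L (insert l U) x =
      coeff (trunc_poly k B L U l x) 0 + coeff (trunc_poly k B L U l x) 1 * x l"
    and "poly (trunc_poly k B L U l x) 0 = trunc_det k B (L - {l}) U x"
proof -
  let ?p = "trunc_poly k B L U l"
  note p_def = trunc_poly_def[of k B L U l]
  let ?c = "\<lambda>\<sigma>. card {a \<in> {..<k}. \<sigma> a = l}"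
  let ?g = "\<lambda>\<sigma>. (\<Prod>a\<in>{a \<in> {..<k}. \<sigma> a \<noteq> l}. x (\<sigma> a)) * sel_det k B \<sigma>"
  note fin = finite_maps_upto_once[OF assms(1), of k U]
  have split: "(\<Prod>a<k. (x(l := t)) (\<sigma> a)) = t ^ ?c \<sigma> * (\<Prod>a\<in>{a \<in> {..<k}. \<sigma> a \<noteq> l}. x (\<sigma> a))"
    for \<sigma> t
  proof -
    have "(\<Prod>a<k. (x(l := t)) (\<sigma> a)) = (\<Prod>a\<in>{a \<in> {..<k}. \<sigma> a = l} \<union> {a \<in> {..<k}. \<sigma> a \<noteq> l}. (x(l := t)) (\<sigma> a))"
      by (rule prod.cong) auto
    also have "\<dots> = (\<Prod>a\<in>{a \<in> {..<k}. \<sigma> a = l}. (x(l := t)) (\<sigma> a)) *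
        (\<Prod>a\<in>{a \<in> {..<k}. \<sigma> a \<noteq> l}. (x(l := t)) (\<sigma> a))"
      by (rule prod.union_disjoint) auto
    also have "(\<Prod>a\<in>{a \<in> {..<k}. \<sigma> a = l}. (x(l := t)) (\<sigma> a)) = t ^ ?c \<sigma>"
      by simp
    also have "(\<Prod>a\<in>{a \<in> {..<k}. \<sigma> a \<noteq> l}. (x(l := t)) (\<sigma> a)) = (\<Prod>a\<in>{a \<in> {..<k}. \<sigma> a \<noteq> l}. x (\<sigma> a))"
      by (rule prod.cong) auto
    finally show ?thesis .
  qed
  then have split': "(\<Prod>a<k. x (\<sigma> a)) = x l ^ ?c \<sigma> * (\<Prod>a\<in>{a \<in> {..<k}. \<sigma> a \<noteq> l}. x (\<sigma> a))" for \<sigma>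
    using split[of "x l" \<sigma>] by (simp only: fun_upd_triv)
  show "trunc_det k B L U (x(l := t)) = poly (?p x) t"
    unfolding trunc_det_def p_def poly_sum poly_monom split by (simp add: mult_ac)
  have co: "coeff (?p x) i = (\<Sum>\<sigma>\<in>{\<sigma> \<in> maps_upto_once k L U. ?c \<sigma> = i}. ?g \<sigma>)" for i
    unfolding p_def coeff_sum coeff_monom using fin by (simp add: sum.If_cases sum.inter_filter)
  have M: "maps_upto_once k L (insert l U) =
      {\<sigma> \<in> maps_upto_once k L U. ?c \<sigma> = 0} \<union> {\<sigma> \<in> maps_upto_once k L U. ?c \<sigma> = 1}"
    by (auto simp: maps_upto_once_def le_Suc_eq)
  have "trunc_det k B L (insert l U) x =
      (\<Sum>\<sigma>\<in>{\<sigma> \<in> maps_upto_once k L U. ?c \<sigma> = 0}. (\<Prod>a<k. x (\<sigma> a)) * sel_det k B \<sigma>) +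
      (\<Sum>\<sigma>\<in>{\<sigma> \<in> maps_upto_once k L U. ?c \<sigma> = 1}. (\<Prod>a<k. x (\<sigma> a)) * sel_det k B \<sigma>)"
    unfolding trunc_det_def M by (rule sum.union_disjoint) (use fin in \<open>auto simp del: card_0_eq\<close>)
  also have "\<dots> = coeff (?p x) 0 + coeff (?p x) 1 * x l"
    unfolding co sum_distrib_right
    by (intro arg_cong2[of _ _ _ _ "(+)"] sum.cong refl)
       (simp_all only: mem_Collect_eq split' power_0 power_one_right mult_1 mult_ac)
  finally show "trunc_det k B L (insert l U) x = coeff (?p x) 0 + coeff (?p x) 1 * x l" .
  have "maps_upto_once k (L - {l}) U = {\<sigma> \<in> maps_upto_once k L U. ?c \<sigma> = 0}"
    using assms(2) by (fastforce simp: maps_upto_once_def PiE_iff)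
  then have "trunc_det k B (L - {l}) U x = coeff (?p x) 0"
    unfolding co trunc_det_def
    by (intro sum.cong) (simp_all only: mem_Collect_eq split' power_0 mult_1)
  then show "poly (?p x) 0 = trunc_det k B (L - {l}) U x"
    by (simp add: poly_0_coeff_0)
qed

lemma maps_upto_once_all:
  assumes "finite L"
  shows "maps_upto_once k L L = {\<sigma> \<in> {..<k} \<rightarrow>\<^sub>E L. inj_on \<sigma> {..<k}}"
proof -
  have "(\<forall>l\<in>L. card {a \<in> {..<k}. \<sigma> a = l} \<le> 1) \<longleftrightarrow> inj_on \<sigma> {..<k}" if "\<sigma> \<in> {..<k} \<rightarrow>\<^sub>E L" for \<sigma>
  proof
    assume *: "\<forall>l\<in>L. card {a \<in> {..<k}. \<sigma> a = l} \<le> 1"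
    show "inj_on \<sigma> {..<k}"
    proof
      fix a b assume ab: "a \<in> {..<k}" "b \<in> {..<k}" "\<sigma> a = \<sigma> b"
      define A where "A = {c \<in> {..<k}. \<sigma> c = \<sigma> a}"
      have "\<sigma> a \<in> L" using that ab(1) by auto
      then have "card A \<le> Suc 0" using * by (simp add: A_def)
      moreover have "finite A" by (simp add: A_def)
      ultimately have "\<forall>c\<in>A. \<forall>d\<in>A. c = d" by (simp only: card_le_Suc0_iff_eq)
      moreover have "a \<in> A" "b \<in> A" using ab by (simp_all add: A_def)
      ultimately show "a = b" by blast
    qed
  next
    assume "inj_on \<sigma> {..<k}"
    then show "\<forall>l\<in>L. card {a \<in> {..<k}. \<sigma> a = l} \<le> 1"
      by (auto simp: card_le_Suc0_iff_eq dest: inj_onD)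
  qed
  then show ?thesis by (auto simp: maps_upto_once_def)
qed

lemma trunc_det_top:
  assumes "finite L" "card L = k"
  shows "trunc_det k B L L x = (\<Prod>l\<in>L. x l) * mixed_disc k B L"
proof -
  have M: "maps_upto_once k L L = bijections k L"
  proof -
    have "\<sigma> ` {..<k} = L" if "\<sigma> \<in> {..<k} \<rightarrow>\<^sub>E L" "inj_on \<sigma> {..<k}" for \<sigma>
      using assms that by (intro card_subset_eq) (auto simp: card_image)
    then show ?thesis
      unfolding maps_upto_once_all[OF assms(1)] bijections_def bij_betw_def by blast
  qed
  have "(\<Prod>a<k. x (\<sigma> a)) = (\<Prod>l\<in>L. x l)" if "\<sigma> \<in> bijections k L" for \<sigma>
    using that by (intro prod.reindex_bij_betw) (simp add: bijections_def)
  then show ?thesis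
    by (simp add: trunc_det_def M mixed_disc_def sum_distrib_left)
qed

text \<open>The variables are truncated one at a time. The condition on \<open>U\<close> excludes
  \<open>U = L\<close> with fewer than \<open>k\<close> indices, where no injective choice exists
  and the polynomial is zero.\<close>

lemma trunc_det_nonzero:
  assumes "finite U" "finite L" "U \<subseteq> L" "0 < k"
    and "\<And>l. l \<in> L \<Longrightarrow> pos_def k (B l)" "\<And>l. l \<in> L \<Longrightarrow> 0 < Im (x l)"
    and "U \<noteq> L \<or> k \<le> card U"
    and "\<And>K. K \<subseteq> L \<Longrightarrow> card K = k \<Longrightarrow> mixed_disc k B K \<noteq> 0"
  shows "trunc_det k B L U x \<noteq> 0"
  using assms
proof (induction U arbitrary: L x rule: finite_induct)
  case empty
  then have "L \<noteq> {}" by auto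
  show ?case
    unfolding trunc_det_empty[OF empty(1)]
    by (rule det_pencil_nonzero) (use empty \<open>L \<noteq> {}\<close> in auto)
next
  case (insert l V)
  show ?case
  \<comment> \<open>In this case deleting \<open>l\<close> leaves only \<open>k - 1\<close> indices,
    so the constant term is zero and the truncation argument breaks down; but the polynomial is then
    a single monomial.\<close>
  proof (cases "insert l V = L \<and> card L = k")
    case True
    then have "trunc_det k B L (insert l V) x = (\<Prod>l\<in>L. x l) * mixed_disc k B L"
      using trunc_det_top[of L k B x] insert.prems by simp
    moreover have "x l \<noteq> 0" if "l \<in> L" for l using insert.prems(5)[OF that] by auto
    then have "(\<Prod>l\<in>L. x l) \<noteq> 0" using insert.prems(1) by simp
    ultimately show ?thesis using insert.prems(7)[of L] True by auto
  next
    case False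
    have lL: "l \<in> L" using insert.prems by auto
    note P = trunc_det_poly[OF insert.prems(1) lL insert.hyps(2), of k B]
    show ?thesis
      unfolding P(2)
    proof (rule affine_part_nonzero)
      fix t :: complex assume "0 < Im t"
      then show "poly (trunc_poly k B L V l x) t \<noteq> 0"
        unfolding P(1)[symmetric] using insert.prems insert.hyps by (intro insert.IH) auto
    next
      have "V \<noteq> L - {l} \<or> k \<le> card V"
        using False insert.prems(6) insert.hyps lL card_gt_0_iff[of L] insert.prems(1)
        by (auto simp: card_insert_if)
      then show "poly (trunc_poly k B L V l x) 0 \<noteq> 0"
        unfolding P(3) using insert.prems insert.hyps by (intro insert.IH) auto
    qed (use insert.prems lL in auto)
  qed
qed

section \<open>Positivity of mixed discriminants\<close>

lemma mixed_disc_cong: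
  assumes "\<And>l. l \<in> S \<Longrightarrow> B l = B' l"
  shows "mixed_disc k B S = mixed_disc k B' S"
  unfolding mixed_disc_def sel_det_def
proof (intro sum.cong refl arg_cong2[of _ _ _ _ "(*)"] prod.cong)
  fix \<sigma> \<pi> a assume "\<sigma> \<in> bijections k S" "a \<in> {..<k}"
  then have "\<sigma> a \<in> S" by (auto simp: bijections_def)
  then show "B (\<sigma> a) a (\<pi> a) = B' (\<sigma> a) a (\<pi> a)" by (simp add: assms)
qed

text \<open>A bijection onto \<open>S\<close> takes the value \<open>l\<close> exactly once, so each
  product has exactly one factor from slot \<open>l\<close>.\<close>

lemma mixed_disc_slot_linear:
  assumes "l \<in> S"
  shows "mixed_disc k (B(l := \<lambda>a b. s * H a b + t * H' a b)) S =
    s * mixed_disc k (B(l := H)) S + t * mixed_disc k (B(l := H')) S"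
  unfolding mixed_disc_def sum_distrib_left sum.distrib[symmetric]
proof (intro sum.cong refl)
  fix \<sigma> assume "\<sigma> \<in> bijections k S"
  then have bij: "bij_betw \<sigma> {..<k} S" by (simp add: bijections_def)
  then obtain a0 where a0: "a0 < k" "\<sigma> a0 = l"
    using assms unfolding bij_betw_def by auto
  have ne: "\<sigma> a \<noteq> l" if "a \<in> {..<k} - {a0}" for a
    using bij a0 that unfolding bij_betw_def inj_on_def by blast
  have split: "(\<Prod>a<k. (B(l := G)) (\<sigma> a) a (\<pi> a)) =
      G a0 (\<pi> a0) * (\<Prod>a\<in>{..<k} - {a0}. B (\<sigma> a) a (\<pi> a))" for G \<pi>
  proof -
    have "(\<Prod>a<k. (B(l := G)) (\<sigma> a) a (\<pi> a)) = (B(l := G)) (\<sigma> a0) a0 (\<pi> a0) *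
        (\<Prod>a\<in>{..<k} - {a0}. (B(l := G)) (\<sigma> a) a (\<pi> a))"
      using a0 by (intro prod.remove) auto
    also have "(\<Prod>a\<in>{..<k} - {a0}. (B(l := G)) (\<sigma> a) a (\<pi> a)) =
        (\<Prod>a\<in>{..<k} - {a0}. B (\<sigma> a) a (\<pi> a))"
      by (intro prod.cong refl) (simp add: ne)
    finally show ?thesis using a0 by simp
  qed
  show "sel_det k (B(l := \<lambda>a b. s * H a b + t * H' a b)) \<sigma> =
      s * sel_det k (B(l := H)) \<sigma> + t * sel_det k (B(l := H')) \<sigma>"
    unfolding sel_det_def split sum_distrib_left sum.distrib[symmetric]
    by (intro sum.cong refl) (simp add: algebra_simps)
qed

lemma mixed_disc_toward_id:
  assumes "l \<in> S"
  shows "mixed_disc k (B(l := toward_id t (B l))) S =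
    of_real (1 - t) * mixed_disc k B S + of_real t * mixed_disc k (B(l := id_matrix)) S"
proof -
  have "toward_id t (B l) = (\<lambda>a b. of_real (1 - t) * B l a b + of_real t * id_matrix a b)"
    by (intro ext) (simp add: toward_id_def)
  then show ?thesis
    by (simp only: mixed_disc_slot_linear[OF assms] fun_upd_triv)
qed

text \<open>Composing with a fixed bijection identifies the bijections with permutations. The
  composite is not extensional, hence the hypothesis that \<open>f\<close> sees only the values
  below \<open>k\<close>.\<close>

lemma sum_bijections:
  assumes "\<sigma>0 \<in> bijections k S"
    and f: "\<And>\<sigma> \<tau>. (\<And>a. a < k \<Longrightarrow> \<sigma> a = \<tau> a) \<Longrightarrow> f \<sigma> = f \<tau>"
  shows "(\<Sum>\<sigma>\<in>bijections k S. f \<sigma>) = (\<Sum>\<rho> | \<rho> permutes {..<k}. f (\<sigma>0 \<circ> \<rho>))"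
proof -
  have bij0: "bij_betw \<sigma>0 {..<k} S" using assms(1) by (simp add: bijections_def)
  let ?i = "\<lambda>\<rho>. restrict (\<sigma>0 \<circ> \<rho>) {..<k}"
  let ?j = "\<lambda>\<sigma> a. if a < k then inv_into {..<k} \<sigma>0 (\<sigma> a) else a"
  show ?thesis
  proof (rule sum.reindex_bij_witness[of _ ?i ?j])
    fix \<sigma> assume "\<sigma> \<in> bijections k S"
    then have bij: "bij_betw \<sigma> {..<k} S" and ex: "\<sigma> \<in> extensional {..<k}"
      by (auto simp: bijections_def PiE_def)
    have S: "\<sigma> a \<in> S" if "a < k" for a using bij that by (auto simp: bij_betw_def)
    have inv0: "\<sigma>0 (inv_into {..<k} \<sigma>0 (\<sigma> a)) = \<sigma> a" if "a < k" for a
      using bij_betw_inv_into_right[OF bij0 S[OF that]] .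
    show "?i (?j \<sigma>) = \<sigma>"
      by (rule extensionalityI[of _ "{..<k}"]) (use ex inv0 in auto)
    have "bij_betw (inv_into {..<k} \<sigma>0 \<circ> \<sigma>) {..<k} {..<k}"
      by (rule bij_betw_trans[OF bij bij_betw_inv_into[OF bij0]])
    then have "bij_betw (?j \<sigma>) {..<k} {..<k}"
      by (subst bij_betw_cong[of _ _ "inv_into {..<k} \<sigma>0 \<circ> \<sigma>"]) auto
    then show "?j \<sigma> \<in> {\<rho>. \<rho> permutes {..<k}}"
      unfolding mem_Collect_eq by (rule bij_imp_permutes) simp
    show "f (\<sigma>0 \<circ> ?j \<sigma>) = f \<sigma>"
      by (rule f) (simp add: inv0)
  next
    fix \<rho> assume "\<rho> \<in> {\<rho>. \<rho> permutes {..<k}}"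
    then have \<rho>: "\<rho> permutes {..<k}" by simp
    have lt: "\<rho> a < k" if "a < k" for a using permutes_in_image[OF \<rho>, of a] that by simp
    show "?j (?i \<rho>) = \<rho>"
    proof
      fix a
      show "?j (?i \<rho>) a = \<rho> a"
        using lt permutes_not_in[OF \<rho>, of a] bij0
        by (auto simp: bij_betw_inv_into_left)
    qed
    have "bij_betw (\<sigma>0 \<circ> \<rho>) {..<k} S"
      by (rule bij_betw_trans[OF permutes_imp_bij[OF \<rho>] bij0])
    then have "bij_betw (?i \<rho>) {..<k} S"
      by (subst bij_betw_cong[of _ _ "\<sigma>0 \<circ> \<rho>"]) auto
    then show "?i \<rho> \<in> bijections k S"
      by (auto simp: bijections_def bij_betw_def)
  qed
qed

lemma sel_det_cong:
  assumes "\<And>a. a < k \<Longrightarrow> \<sigma> a = \<tau> a"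
  shows "sel_det k B \<sigma> = sel_det k B \<tau>"
  unfolding sel_det_def by (intro sum.cong refl arg_cong2[of _ _ _ _ "(*)"] prod.cong) (simp_all add: assms)

text \<open>Rows and columns are permuted independently here; this symmetric form is what factors
  into a determinant times its conjugate.\<close>

lemma mixed_disc_permutations:
  assumes "\<sigma>0 \<in> bijections k S"
  shows "mixed_disc k B S = (\<Sum>\<rho> | \<rho> permutes {..<k}. \<Sum>\<tau> | \<tau> permutes {..<k}.
    of_int (sign \<rho>) * of_int (sign \<tau>) * (\<Prod>c<k. B (\<sigma>0 c) (\<rho> c) (\<tau> c)))"
proof -
  have "mixed_disc k B S = (\<Sum>\<rho> | \<rho> permutes {..<k}. sel_det k B (\<sigma>0 \<circ> \<rho>))"
    unfolding mixed_disc_def by (rule sum_bijections[OF assms sel_det_cong])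
  also have "\<dots> = (\<Sum>\<rho> | \<rho> permutes {..<k}. sel_det k B (\<sigma>0 \<circ> Hilbert_Choice.inv \<rho>))"
    by (rule sum_permutations_inverse)
  also have "\<dots> = (\<Sum>\<rho> | \<rho> permutes {..<k}. \<Sum>\<tau> | \<tau> permutes {..<k}.
    of_int (sign \<rho>) * of_int (sign \<tau>) * (\<Prod>c<k. B (\<sigma>0 c) (\<rho> c) (\<tau> c)))"
  proof (intro sum.cong refl)
    fix \<rho> assume "\<rho> \<in> {\<rho>. \<rho> permutes {..<k}}"
    then have \<rho>: "\<rho> permutes {..<k}" by simp
    have "sel_det k B (\<sigma>0 \<circ> Hilbert_Choice.inv \<rho>) = (\<Sum>\<pi> | \<pi> permutes {..<k}. of_int (sign \<pi>) *
        (\<Prod>c<k. B (\<sigma>0 c) (\<rho> c) ((\<pi> \<circ> \<rho>) c)))"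
      unfolding sel_det_def
    proof (intro sum.cong refl arg_cong2[of _ _ _ _ "(*)"])
      fix \<pi>
      have "(\<Prod>c<k. B (\<sigma>0 c) (\<rho> c) ((\<pi> \<circ> \<rho>) c)) =
          (\<Prod>c<k. (\<lambda>a. B ((\<sigma>0 \<circ> Hilbert_Choice.inv \<rho>) a) a (\<pi> a)) (\<rho> c))"
        using permutes_inverses(2)[OF \<rho>] by simp
      also have "\<dots> = (\<Prod>a<k. B ((\<sigma>0 \<circ> Hilbert_Choice.inv \<rho>) a) a (\<pi> a))"
        by (rule prod.reindex_bij_betw[OF permutes_imp_bij[OF \<rho>]])
      finally show "(\<Prod>a<k. B ((\<sigma>0 \<circ> Hilbert_Choice.inv \<rho>) a) a (\<pi> a)) =
          (\<Prod>c<k. B (\<sigma>0 c) (\<rho> c) ((\<pi> \<circ> \<rho>) c))" by simp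
    qed
    \<comment> \<open>Substitutes the column permutation
      \<open>\<tau> = \<pi> \<circ> \<rho>\<close>, whose sign splits off that of
      \<open>\<rho>\<close>.\<close>
    also have "\<dots> = (\<Sum>\<pi> | \<pi> permutes {..<k}. of_int (sign (\<pi> \<circ> Hilbert_Choice.inv \<rho>)) *
        (\<Prod>c<k. B (\<sigma>0 c) (\<rho> c) (((\<pi> \<circ> Hilbert_Choice.inv \<rho>) \<circ> \<rho>) c)))"
      by (rule sum_permutations_compose_right[OF permutes_inv[OF \<rho>]])
    also have "\<dots> = (\<Sum>\<tau> | \<tau> permutes {..<k}.
        of_int (sign \<rho>) * of_int (sign \<tau>) * (\<Prod>c<k. B (\<sigma>0 c) (\<rho> c) (\<tau> c)))"
    proof (intro sum.cong refl)
      fix \<tau> assume "\<tau> \<in> {\<tau>. \<tau> permutes {..<k}}"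
      then have "sign (\<tau> \<circ> Hilbert_Choice.inv \<rho>) = sign \<tau> * sign \<rho>"
        using sign_compose[of \<tau> "Hilbert_Choice.inv \<rho>"] sign_inverse[of \<rho>]
          permutation_inverse[of \<rho>] \<rho> permutation_permutes by (metis finite_lessThan mem_Collect_eq)
      moreover have "(\<tau> \<circ> Hilbert_Choice.inv \<rho>) \<circ> \<rho> = \<tau>"
        by (simp add: comp_assoc permutes_inv_o(2)[OF \<rho>])
      ultimately show "of_int (sign (\<tau> \<circ> Hilbert_Choice.inv \<rho>)) * (\<Prod>c<k. B (\<sigma>0 c) (\<rho> c) (((\<tau> \<circ> Hilbert_Choice.inv \<rho>) \<circ> \<rho>) c)) =
          of_int (sign \<rho>) * of_int (sign \<tau>) * (\<Prod>c<k. B (\<sigma>0 c) (\<rho> c) (\<tau> c))"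
        by simp
    qed
    finally show "sel_det k B (\<sigma>0 \<circ> Hilbert_Choice.inv \<rho>) = \<dots>" .
  qed
  finally show ?thesis .
qed

text \<open>By Cholesky every slot is a sum of rank-one matrices, and for rank-one slots the double
  permutation sum is the squared modulus of a determinant.\<close>

lemma mixed_disc_nonneg:
  assumes "\<And>l. l \<in> S \<Longrightarrow> pos_def k (B l)"
  shows "\<exists>r\<ge>0. mixed_disc k B S = of_real r"
proof (cases "bijections k S = {}")
  case True
  then show ?thesis by (intro exI[of _ 0]) (simp add: mixed_disc_def)
next
  case False
  then obtain \<sigma>0 where s0: "\<sigma>0 \<in> bijections k S" by blast
  then have S: "\<sigma>0 c \<in> S" if "c < k" for c using that by (auto simp: bijections_def)
  have "\<exists>R. \<forall>c<k. \<forall>a<k. \<forall>b<k. B (\<sigma>0 c) a b = (\<Sum>m<k. R c m a * cnj (R c m b))"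
    using cholesky[OF assms[OF S]] by metis
  then obtain R where R: "\<And>c a b. c < k \<Longrightarrow> a < k \<Longrightarrow> b < k \<Longrightarrow>
      B (\<sigma>0 c) a b = (\<Sum>m<k. R c m a * cnj (R c m b))" by blast
  \<comment> \<open>The determinant of the matrix whose row \<open>c\<close> is row
    \<open>\<mu> c\<close> of the Cholesky factor of slot \<open>c\<close>.\<close>
  define Z where "Z \<mu> = (\<Sum>\<rho> | \<rho> permutes {..<k}. of_int (sign \<rho>) * (\<Prod>c<k. R c (\<mu> c) (\<rho> c)))" for \<mu>
  let ?M = "{..<k} \<rightarrow>\<^sub>E {..<k}" and ?P = "{\<rho>. \<rho> permutes {..<k}}"
  have "mixed_disc k B S = (\<Sum>\<rho>\<in>?P. \<Sum>\<tau>\<in>?P. of_int (sign \<rho>) * of_int (sign \<tau>) *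
      (\<Prod>c<k. \<Sum>m<k. R c m (\<rho> c) * cnj (R c m (\<tau> c))))"
    unfolding mixed_disc_permutations[OF s0]
  proof (intro sum.cong refl arg_cong2[of _ _ _ _ "(*)"] prod.cong)
    fix \<rho> \<tau> c assume "\<rho> \<in> ?P" "\<tau> \<in> ?P" "c \<in> {..<k}"
    then show "B (\<sigma>0 c) (\<rho> c) (\<tau> c) = (\<Sum>m<k. R c m (\<rho> c) * cnj (R c m (\<tau> c)))"
      using permutes_in_image[of \<rho> "{..<k}" c] permutes_in_image[of \<tau> "{..<k}" c] by (intro R) auto
  qed
  also have "\<dots> = (\<Sum>\<rho>\<in>?P. \<Sum>\<tau>\<in>?P. of_int (sign \<rho>) * of_int (sign \<tau>) *
      (\<Sum>\<mu>\<in>?M. \<Prod>c<k. R c (\<mu> c) (\<rho> c) * cnj (R c (\<mu> c) (\<tau> c))))"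
    by (intro sum.cong refl arg_cong2[of _ _ _ _ "(*)"] prod_sum_PiE) auto
  also have "\<dots> = (\<Sum>\<rho>\<in>?P. \<Sum>\<tau>\<in>?P. \<Sum>\<mu>\<in>?M. (of_int (sign \<rho>) * (\<Prod>c<k. R c (\<mu> c) (\<rho> c))) *
      cnj (of_int (sign \<tau>) * (\<Prod>c<k. R c (\<mu> c) (\<tau> c))))"
    unfolding sum_distrib_left by (intro sum.cong refl) (simp add: prod.distrib mult_ac)
  also have "\<dots> = (\<Sum>\<rho>\<in>?P. \<Sum>\<mu>\<in>?M. \<Sum>\<tau>\<in>?P. (of_int (sign \<rho>) * (\<Prod>c<k. R c (\<mu> c) (\<rho> c))) *
      cnj (of_int (sign \<tau>) * (\<Prod>c<k. R c (\<mu> c) (\<tau> c))))"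
    by (intro sum.cong refl sum.swap)
  also have "\<dots> = (\<Sum>\<mu>\<in>?M. \<Sum>\<rho>\<in>?P. \<Sum>\<tau>\<in>?P. (of_int (sign \<rho>) * (\<Prod>c<k. R c (\<mu> c) (\<rho> c))) *
      cnj (of_int (sign \<tau>) * (\<Prod>c<k. R c (\<mu> c) (\<tau> c))))"
    by (rule sum.swap)
  also have "\<dots> = (\<Sum>\<mu>\<in>?M. Z \<mu> * cnj (Z \<mu>))"
    unfolding Z_def sum_product cnj_sum ..
  also have "\<dots> = (\<Sum>\<mu>\<in>?M. of_real ((cmod (Z \<mu>))\<^sup>2))"
    by (intro sum.cong refl) (metis complex_norm_square)
  also have "\<dots> = of_real (\<Sum>\<mu>\<in>?M. (cmod (Z \<mu>))\<^sup>2)" by simp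
  finally show ?thesis
    by (intro exI[of _ "\<Sum>\<mu>\<in>?M. (cmod (Z \<mu>))\<^sup>2"]) (simp add: sum_nonneg)
qed

lemma bijections_nonempty:
  assumes "finite S" "card S = k"
  obtains \<sigma> where "\<sigma> \<in> bijections k S"
proof -
  obtain h where "bij_betw h {..<k} S"
    using ex_bij_betw_nat_finite[OF assms(1)] assms(2) by (auto simp: lessThan_atLeast0)
  then have "restrict h {..<k} \<in> bijections k S"
    by (auto simp: bijections_def bij_betw_def inj_on_def)
  then show ?thesis by (rule that)
qed

lemma mixed_disc_id_matrix:
  assumes "finite S" "card S = k" "\<And>l. l \<in> S \<Longrightarrow> B l = id_matrix"
  shows "mixed_disc k B S = fact k"
proof -
  obtain \<sigma>0 where s0: "\<sigma>0 \<in> bijections k S" using bijections_nonempty[OF assms(1,2)] .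
  have "sel_det k (\<lambda>_. id_matrix) \<sigma> = 1" for \<sigma>
  proof -
    have "(\<Prod>a<k. id_matrix a (\<pi> a)) = (if \<pi> = id then 1 else 0)" if "\<pi> permutes {..<k}" for \<pi>
    proof (cases "\<pi> = id")
      case False
      then obtain a where "\<pi> a \<noteq> a" by (auto simp: fun_eq_iff)
      moreover from this have "a < k" using permutes_not_in[OF that, of a] by auto
      ultimately show ?thesis using False by (auto simp: id_matrix_def intro!: bexI[of _ a])
    qed (simp add: id_matrix_def)
    then have "sel_det k (\<lambda>_. id_matrix) \<sigma> =
        (\<Sum>\<pi> | \<pi> permutes {..<k}. if \<pi> = id then of_int (sign \<pi>) else 0)"
      unfolding sel_det_def by (intro sum.cong refl) auto
    also have "\<dots> = 1"
      by (subst sum.delta) (auto simp: finite_permutations permutes_id)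
    finally show ?thesis .
  qed
  then have "mixed_disc k (\<lambda>_. id_matrix) S = (\<Sum>\<rho> | \<rho> permutes {..<k}. 1)"
    unfolding mixed_disc_def by (subst sum_bijections[OF s0]) auto
  also have "\<dots> = fact k" by (simp add: card_permutations)
  finally show ?thesis
    using mixed_disc_cong[of S B "\<lambda>_. id_matrix"] assms(3) by simp
qed

text \<open>Applied with a degeneracy \<open>P\<close> that passes to the identity slot by slot,
  although the all-identity case does not have it.\<close>

lemma pos_def_replace_by_id:
  assumes "finite U" "U \<subseteq> T" "\<And>l. l \<in> T \<Longrightarrow> pos_def k (B l)" "P B"
    and "\<And>B l. l \<in> T \<Longrightarrow> (\<And>l. l \<in> T \<Longrightarrow> pos_def k (B l)) \<Longrightarrow> P B \<Longrightarrow> P (B(l := id_matrix))"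
  shows "P (\<lambda>l. if l \<in> U then id_matrix else B l)"
  using assms(1,2)
proof (induction U rule: finite_induct)
  case empty
  then show ?case using assms(4) by simp
next
  case (insert l U)
  have "P ((\<lambda>l. if l \<in> U then id_matrix else B l)(l := id_matrix))"
    by (rule assms(5)) (use insert assms(3) pos_def_id_matrix in auto)
  moreover have "(\<lambda>l. if l \<in> U then id_matrix else B l)(l := id_matrix) =
      (\<lambda>m. if m \<in> insert l U then id_matrix else B m)" by auto
  ultimately show ?case by simp
qed

lemma mixed_disc_pos:
  assumes "finite S" "card S = k" "\<And>l. l \<in> S \<Longrightarrow> pos_def k (B l)"
  shows "\<exists>r>0. mixed_disc k B S = of_real r"
proof -
  have step: "mixed_disc k (C(l := id_matrix)) S = 0"
    if l: "l \<in> S" and C: "\<And>l. l \<in> S \<Longrightarrow> pos_def k (C l)" and 0: "mixed_disc k C S = 0" for C l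
  proof -
    obtain d where d: "d > 0" "\<And>t. - d \<le> t \<Longrightarrow> t \<le> 1 \<Longrightarrow> pos_def k (toward_id t (C l))"
      using pos_def_toward_id[OF C[OF l]] by blast
    have eq: "mixed_disc k (C(l := toward_id t (C l))) S = of_real t * mixed_disc k (C(l := id_matrix)) S" for t
      using mixed_disc_toward_id[OF l, of k C t] 0 by simp
    have "pos_def k ((C(l := id_matrix)) m)" if "m \<in> S" for m
      using C[OF that] pos_def_id_matrix by simp
    then obtain r where r: "r \<ge> 0" "mixed_disc k (C(l := id_matrix)) S = of_real r"
      using mixed_disc_nonneg by blast
    have "pos_def k ((C(l := toward_id (- d) (C l))) m)" if "m \<in> S" for m
      using C[OF that] d(2)[of "- d"] d(1) by simp
    then obtain r' where r': "r' \<ge> 0" "mixed_disc k (C(l := toward_id (- d) (C l))) S = of_real r'"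
      using mixed_disc_nonneg by blast
    \<comment> \<open>The value along the line is \<open>t * r\<close>; it is nonnegative at
      \<open>t = 1\<close> and at \<open>t = - d\<close>, so \<open>r\<close> is zero.\<close>
    have "r' = (- d) * r"
      using r'(2) unfolding eq r(2) by (metis of_real_eq_iff of_real_mult)
    then have "r = 0" using r(1) r'(1) d(1) by (auto simp: mult_le_0_iff)
    then show ?thesis using r(2) by simp
  qed
  have "mixed_disc k B S \<noteq> 0"
  proof
    assume "mixed_disc k B S = 0"
    then have "mixed_disc k (\<lambda>l. if l \<in> S then id_matrix else B l) S = 0"
      using pos_def_replace_by_id[of S S k B "\<lambda>C. mixed_disc k C S = 0"] assms step by blast
    then show False using mixed_disc_id_matrix[OF assms(1,2)] by simp
  qed
  then show ?thesis using mixed_disc_nonneg[of S k B] assms(3) by (metis of_real_0 order_le_less)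
qed

section \<open>The reduced discriminant matrix\<close>

text \<open>Taking \<open>Re\<close> loses nothing for positive definite slots, as their mixed
  discriminants are real; a real matrix allows sign arguments.\<close>

definition disc_matrix :: "nat \<Rightarrow> (nat \<Rightarrow> nat \<Rightarrow> nat \<Rightarrow> complex) \<Rightarrow> nat set \<Rightarrow> nat \<Rightarrow> nat \<Rightarrow> real" where
  "disc_matrix k B T i j = (if i = j then 0 else Re (mixed_disc k B (T - {i, j})))"

definition bil :: "nat set \<Rightarrow> (nat \<Rightarrow> nat \<Rightarrow> real) \<Rightarrow> (nat \<Rightarrow> real) \<Rightarrow> (nat \<Rightarrow> real) \<Rightarrow> real" where
  "bil T A u v = (\<Sum>i\<in>T. u i * (\<Sum>j\<in>T. A i j * v j))"

lemma bil_add_scaled: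
  assumes "\<And>i j. A i j = A j i"
  shows "bil T A (\<lambda>i. u i + s * w i) (\<lambda>i. u i + s * w i) =
    bil T A u u + 2 * s * bil T A w u + s\<^sup>2 * bil T A w w"
proof -
  have comm: "bil T A u w = bil T A w u"
  proof -
    have "bil T A u w = (\<Sum>i\<in>T. \<Sum>j\<in>T. A i j * u i * w j)"
      by (simp add: bil_def sum_distrib_left mult_ac)
    also have "\<dots> = (\<Sum>j\<in>T. \<Sum>i\<in>T. A i j * u i * w j)" by (rule sum.swap)
    also have "\<dots> = bil T A w u"
      unfolding bil_def sum_distrib_left
      by (intro sum.cong refl) (simp add: mult_ac assms)
    finally show ?thesis .
  qed
  have "bil T A (\<lambda>i. u i + s * w i) (\<lambda>i. u i + s * w i) =
    bil T A u u + s * bil T A u w + s * bil T A w u + s\<^sup>2 * bil T A w w"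
    unfolding bil_def
    by (simp add: algebra_simps sum.distrib sum_distrib_left power2_eq_square)
  then show ?thesis using comm by simp
qed

section \<open>Stability, semidefiniteness and nonsingularity of the reduced matrix\<close>

lemma disc_matrix_sym: "disc_matrix k B T i j = disc_matrix k B T j i"
  by (simp add: disc_matrix_def insert_commute)

lemma card_remove2:
  assumes "finite T" "card T = k + 2" "i \<in> T" "j \<in> T" "i \<noteq> j"
  shows "card (T - {i, j}) = k"
  using assms by (subst card_Diff_subset) auto

lemma mixed_disc_remove2:
  assumes "finite T" "card T = k + 2" "\<And>l. l \<in> T \<Longrightarrow> pos_def k (B l)" "i \<in> T" "j \<in> T" "i \<noteq> j"
  shows "mixed_disc k B (T - {i, j}) = of_real (disc_matrix k B T i j)"
    and "0 < disc_matrix k B T i j"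
proof -
  obtain r where "r > 0" "mixed_disc k B (T - {i, j}) = of_real r"
    using mixed_disc_pos[of "T - {i, j}" k B] card_remove2[OF assms(1,2,4-6)] assms(1,3) by auto
  then show "mixed_disc k B (T - {i, j}) = of_real (disc_matrix k B T i j)"
    "0 < disc_matrix k B T i j"
    using assms(6) by (simp_all add: disc_matrix_def)
qed

text \<open>The quadratic form of \<open>disc_matrix\<close> is the reversal of the multi-affine polynomial.\<close>

lemma disc_form_trunc_det:
  fixes y :: "nat \<Rightarrow> complex"
  assumes T: "finite T" "card T = k + 2" and y: "\<And>l. l \<in> T \<Longrightarrow> y l \<noteq> 0"
  shows "(\<Sum>i\<in>T. \<Sum>j\<in>T - {i}. mixed_disc k B (T - {i, j}) * (y i * y j)) =
    2 * (\<Prod>l\<in>T. y l) * trunc_det k B T T (\<lambda>l. 1 / y l)"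
proof -
  define I where "I = maps_upto_once k T T"
  have I: "I = {\<sigma> \<in> {..<k} \<rightarrow>\<^sub>E T. inj_on \<sigma> {..<k}}"
    unfolding I_def by (rule maps_upto_once_all[OF T(1)])
  have finI: "finite I" unfolding I_def by (rule finite_maps_upto_once[OF T(1)])
  define g where "g \<sigma> = (\<Prod>a<k. 1 / y (\<sigma> a)) * sel_det k B \<sigma>" for \<sigma>
  define X where "X = Sigma T (\<lambda>i. T - {i})"
  have finX: "finite X" using T(1) by (simp add: X_def)
  have bij: "bijections k (T - {i, j}) = {\<sigma> \<in> I. \<sigma> ` {..<k} = T - {i, j}}" for i j
  proof (intro equalityI subsetI)
    fix \<sigma> assume "\<sigma> \<in> bijections k (T - {i, j})"
    then show "\<sigma> \<in> {\<sigma> \<in> I. \<sigma> ` {..<k} = T - {i, j}}"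
      unfolding I bijections_def bij_betw_def by auto
  next
    fix \<sigma> assume "\<sigma> \<in> {\<sigma> \<in> I. \<sigma> ` {..<k} = T - {i, j}}"
    then have "\<sigma> \<in> extensional {..<k}" "inj_on \<sigma> {..<k}" "\<sigma> ` {..<k} = T - {i, j}"
      unfolding I by (auto simp: PiE_def)
    moreover from this(3) have "\<sigma> \<in> {..<k} \<rightarrow> T - {i, j}" by blast
    ultimately show "\<sigma> \<in> bijections k (T - {i, j})"
      by (simp add: bijections_def bij_betw_def PiE_def)
  qed
  have term_eq: "mixed_disc k B (T - {i, j}) * (y i * y j) =
      (\<Prod>l\<in>T. y l) * (\<Sum>\<sigma>\<in>I. if \<sigma> ` {..<k} = T - {i, j} then g \<sigma> else 0)"
    if "(i, j) \<in> X" for i j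
  proof -
    have ij: "i \<in> T" "j \<in> T" "i \<noteq> j" using that by (auto simp: X_def)
    have "(\<Prod>l\<in>T. y l) = (\<Prod>l\<in>{i, j} \<union> (T - {i, j}). y l)"
      using ij by (intro prod.cong) auto
    also have "\<dots> = (\<Prod>l\<in>{i, j}. y l) * (\<Prod>l\<in>T - {i, j}. y l)"
      using T(1) by (intro prod.union_disjoint) auto
    finally have split: "(\<Prod>l\<in>T. y l) = y i * y j * (\<Prod>l\<in>T - {i, j}. y l)" using ij by simp
    have "(\<Sum>\<sigma>\<in>I. if \<sigma> ` {..<k} = T - {i, j} then g \<sigma> else 0) =
        (\<Sum>\<sigma>\<in>bijections k (T - {i, j}). g \<sigma>)"
      unfolding bij by (rule sum.inter_filter[OF finI, symmetric])
    also have "\<dots> = (\<Sum>\<sigma>\<in>bijections k (T - {i, j}). 1 / (\<Prod>l\<in>T - {i, j}. y l) * sel_det k B \<sigma>)"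
    proof (intro sum.cong refl)
      fix \<sigma> assume "\<sigma> \<in> bijections k (T - {i, j})"
      then have "bij_betw \<sigma> {..<k} (T - {i, j})" by (simp add: bijections_def)
      then have "(\<Prod>a<k. y (\<sigma> a)) = (\<Prod>l\<in>T - {i, j}. y l)" by (rule prod.reindex_bij_betw)
      then show "g \<sigma> = 1 / (\<Prod>l\<in>T - {i, j}. y l) * sel_det k B \<sigma>"
        by (simp add: g_def prod_dividef)
    qed
    also have "\<dots> = 1 / (\<Prod>l\<in>T - {i, j}. y l) * mixed_disc k B (T - {i, j})"
      by (simp add: mixed_disc_def sum_distrib_left)
    finally show ?thesis
      unfolding split using y T(1) by (simp add: field_simps)
  qed
  \<comment> \<open>An injective choice misses exactly two elements of \<open>T\<close>, and the
    pair of them is listed in both orders; this is the factor 2.\<close>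
  have two: "(\<Sum>x\<in>X. if \<sigma> ` {..<k} = T - {fst x, snd x} then g \<sigma> else 0) = 2 * g \<sigma>" if "\<sigma> \<in> I" for \<sigma>
  proof -
    have sub: "\<sigma> ` {..<k} \<subseteq> T" and inj: "inj_on \<sigma> {..<k}" using that by (auto simp: I)
    have "card (T - \<sigma> ` {..<k}) = 2"
      using sub inj T by (simp add: card_Diff_subset card_image)
    then obtain p q where pq: "T - \<sigma> ` {..<k} = {p, q}" "p \<noteq> q" by (meson card_2_iff)
    have "{x \<in> X. \<sigma> ` {..<k} = T - {fst x, snd x}} = {(p, q), (q, p)}"
    proof (intro equalityI subsetI)
      fix x assume x: "x \<in> {x \<in> X. \<sigma> ` {..<k} = T - {fst x, snd x}}"
      then obtain i j where ij: "x = (i, j)" "i \<in> T" "j \<in> T" "i \<noteq> j" by (auto simp: X_def)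
      then have "T - \<sigma> ` {..<k} = {i, j}" using x by auto
      then show "x \<in> {(p, q), (q, p)}" using pq ij by (auto simp: doubleton_eq_iff)
    next
      fix x assume "x \<in> {(p, q), (q, p)}"
      then have "x = (p, q) \<or> x = (q, p)" by simp
      moreover have "p \<in> T" "q \<in> T" "\<sigma> ` {..<k} = T - {p, q}" "\<sigma> ` {..<k} = T - {q, p}"
        using pq sub by auto
      ultimately show "x \<in> {x \<in> X. \<sigma> ` {..<k} = T - {fst x, snd x}}"
        using pq(2) by (elim disjE) (simp_all add: X_def)
    qed
    then show ?thesis
      using pq(2) finX by (simp add: sum.inter_filter[symmetric])
  qed
  have "(\<Sum>i\<in>T. \<Sum>j\<in>T - {i}. mixed_disc k B (T - {i, j}) * (y i * y j)) =
      (\<Sum>x\<in>X. mixed_disc k B (T - {fst x, snd x}) * (y (fst x) * y (snd x)))"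
    unfolding X_def using T(1) by (subst sum.Sigma) (auto simp: case_prod_beta)
  also have "\<dots> = (\<Sum>x\<in>X. (\<Prod>l\<in>T. y l) *
      (\<Sum>\<sigma>\<in>I. if \<sigma> ` {..<k} = T - {fst x, snd x} then g \<sigma> else 0))"
    by (intro sum.cong refl term_eq) simp
  also have "\<dots> = (\<Prod>l\<in>T. y l) *
      (\<Sum>x\<in>X. \<Sum>\<sigma>\<in>I. if \<sigma> ` {..<k} = T - {fst x, snd x} then g \<sigma> else 0)"
    by (simp add: sum_distrib_left)
  also have "(\<Sum>x\<in>X. \<Sum>\<sigma>\<in>I. if \<sigma> ` {..<k} = T - {fst x, snd x} then g \<sigma> else 0) =
      (\<Sum>\<sigma>\<in>I. \<Sum>x\<in>X. if \<sigma> ` {..<k} = T - {fst x, snd x} then g \<sigma> else 0)"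
    by (rule sum.swap)
  also have "\<dots> = 2 * trunc_det k B T T (\<lambda>l. 1 / y l)"
    by (simp add: two trunc_det_def I_def[symmetric] g_def sum_distrib_left)
  finally show ?thesis by simp
qed

text \<open>Inversion exchanges the open lower and upper half-planes, so the reversed polynomial
  inherits stability in the lower one.\<close>

lemma disc_form_stable:
  fixes y :: "nat \<Rightarrow> complex"
  assumes T: "finite T" "card T = k + 2" and k: "0 < k"
    and pd: "\<And>l. l \<in> T \<Longrightarrow> pos_def k (B l)" and y: "\<And>l. l \<in> T \<Longrightarrow> Im (y l) < 0"
  shows "(\<Sum>i\<in>T. y i * (\<Sum>j\<in>T. of_real (disc_matrix k B T i j) * y j)) \<noteq> 0"
proof -
  have y0: "y l \<noteq> 0" if "l \<in> T" for l using y[OF that] by auto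
  have "trunc_det k B T T (\<lambda>l. 1 / y l) \<noteq> 0"
  proof (rule trunc_det_nonzero[OF T(1) T(1)])
    fix l assume "l \<in> T"
    then have "Im (y l) < 0" "0 < (Re (y l))\<^sup>2 + (Im (y l))\<^sup>2"
      using y[of l] by (auto simp: sum_power2_gt_zero_iff)
    then show "0 < Im (1 / y l)"
      by (simp add: Im_divide divide_neg_pos)
  next
    fix K assume "K \<subseteq> T" "card K = k"
    then show "mixed_disc k B K \<noteq> 0"
      using mixed_disc_pos[of K k B] pd T(1) finite_subset by fastforce
  qed (use k T pd in auto)
  moreover have "(\<Prod>l\<in>T. y l) \<noteq> 0" using y0 T(1) by auto
  ultimately have "(\<Sum>i\<in>T. \<Sum>j\<in>T - {i}. mixed_disc k B (T - {i, j}) * (y i * y j)) \<noteq> 0"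
    using disc_form_trunc_det[where y = y and B = B, OF T y0] by simp
  moreover have "(\<Sum>j\<in>T - {i}. mixed_disc k B (T - {i, j}) * (y i * y j)) =
      y i * (\<Sum>j\<in>T. of_real (disc_matrix k B T i j) * y j)" if i: "i \<in> T" for i
  proof -
    have "(\<Sum>j\<in>T. of_real (disc_matrix k B T i j) * y j) =
        (\<Sum>j\<in>T - {i}. of_real (disc_matrix k B T i j) * y j)"
      by (rule sum.mono_neutral_right) (use T in \<open>auto simp: disc_matrix_def\<close>)
    also have "\<dots> = (\<Sum>j\<in>T - {i}. mixed_disc k B (T - {i, j}) * y j)"
      by (intro sum.cong refl) (use mixed_disc_remove2(1)[where B = B, OF T pd i] in auto)
    finally show ?thesis by (simp add: sum_distrib_left mult_ac)
  qed
  ultimately show ?thesis by simp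
qed

text \<open>A positive value at \<open>z\<close> yields a complex zero of the quadratic form all of
  whose coordinates have the same negative imaginary part.\<close>

lemma disc_form_nonpos:
  assumes T: "finite T" "card T = k + 2" and k: "0 < k"
    and pd: "\<And>l. l \<in> T \<Longrightarrow> pos_def k (B l)" and l: "l \<in> T"
    and row: "(\<Sum>j\<in>T. disc_matrix k B T l j * z j) = 0"
  shows "bil T (disc_matrix k B T) z z \<le> 0"
proof (rule ccontr)
  let ?A = "disc_matrix k B T"
  let ?b = "bil T ?A"
  assume "\<not> ?b z z \<le> 0"
  then have pos: "0 < ?b z z" by simp
  define e where "e i = (if i = l then 1 else 0::real)" for i
  define one where "one = (\<lambda>_::nat. 1::real)"
  have nn: "0 \<le> ?A i j" if "i \<in> T" "j \<in> T" for i j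
  proof (cases "i = j")
    case True
    then show ?thesis by (simp add: disc_matrix_def)
  next
    case False
    then show ?thesis using mixed_disc_remove2(2)[where B = B, OF T pd that] by simp
  qed
  have be: "?b e v = (\<Sum>j\<in>T. ?A l j * v j)" for v
    using l T(1) by (simp add: bil_def e_def if_distrib[of "\<lambda>x. x * _"] cong: if_cong)
  have bee: "?b e e = 0"
    unfolding be using T(1) l by (simp add: e_def disc_matrix_def)
  obtain m where m: "m \<in> T" "m \<noteq> l"
  proof -
    have "T \<noteq> {l}" using T(2) by auto
    then show ?thesis using l that by auto
  qed
  have be1: "0 < ?b e one"
    unfolding be one_def
    by (rule sum_pos2[of _ m]) (use T(1) m l nn mixed_disc_remove2(2)[where B = B, OF T pd l m(1)] in auto)
  have b11: "0 < ?b one one"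
    unfolding bil_def one_def
  proof (rule sum_pos2[of _ l])
    show "0 < 1 * (\<Sum>j\<in>T. ?A l j * 1)" using be1 by (simp add: be one_def)
  qed (use T(1) l nn in \<open>auto intro!: sum_nonneg\<close>)
  \<comment> \<open>Chosen to make \<open>w\<close> orthogonal to \<open>one\<close>. The value at
    \<open>w\<close> equals that at \<open>z\<close>, since \<open>e\<close> is isotropic and
    orthogonal to \<open>z\<close>.\<close>
  define c where "c = - ?b one z / ?b e one"
  define w where "w = (\<lambda>i. z i + c * e i)"
  have bww: "?b w w = ?b z z"
    unfolding w_def by (subst bil_add_scaled[OF disc_matrix_sym]) (simp add: be row bee[unfolded be])
  have b1e: "?b one e = ?b e one"
    unfolding be unfolding bil_def one_def e_def
    using l T(1) by (simp add: disc_matrix_sym[of k B T _ l] if_distrib[of "\<lambda>x. _ * x"] cong: if_cong)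
  have "?b one w = ?b one z + c * ?b one e"
    unfolding bil_def w_def by (simp add: algebra_simps sum.distrib sum_distrib_left)
  then have b1w: "?b one w = 0" using be1 by (simp add: c_def b1e)
  \<comment> \<open>With the cross terms gone, the form at \<open>w - \<i> * s * one\<close> is the
    value at \<open>w\<close> minus \<open>s^2\<close> times the value at \<open>one\<close>; this
    \<open>s\<close> makes it zero.\<close>
  define s where "s = sqrt (?b z z / ?b one one)"
  have s: "0 < s" "s\<^sup>2 * ?b one one = ?b z z" using pos b11 by (auto simp: s_def)
  define y where "y i = Complex (w i) (- s)" for i
  have yi: "y i = of_real (w i) - \<i> * of_real s" for i by (simp add: y_def complex_eq_iff)
  have comm: "?b w one = ?b one w"
  proof -
    have "?b w one = (\<Sum>i\<in>T. \<Sum>j\<in>T. ?A i j * w i)"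
      by (simp add: bil_def sum_distrib_left mult_ac one_def)
    also have "\<dots> = (\<Sum>j\<in>T. \<Sum>i\<in>T. ?A i j * w i)" by (rule sum.swap)
    also have "\<dots> = ?b one w"
      unfolding bil_def one_def by (intro sum.cong refl) (simp add: disc_matrix_sym)
    finally show ?thesis .
  qed
  have "(\<Sum>i\<in>T. y i * (\<Sum>j\<in>T. of_real (?A i j) * y j)) =
      of_real (?b w w) - \<i> * of_real s * of_real (?b w one) - \<i> * of_real s * of_real (?b one w)
      - of_real (s\<^sup>2 * ?b one one)"
    unfolding bil_def yi one_def
    by (simp add: algebra_simps sum.distrib sum_subtractf sum_distrib_left power2_eq_square)
  also have "\<dots> = 0" using s(2) bww by (simp add: comm b1w)
  finally show False
    using disc_form_stable[where y = y, OF T k pd] s(1) by (simp add: y_def)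
qed

text \<open>Entries with \<open>i = l\<close> or \<open>j = l\<close> do not contain slot
  \<open>l\<close> and stay constant; in the others the slot enters linearly.\<close>

lemma disc_matrix_toward_id:
  assumes "l \<in> T" "i \<in> T" "j \<in> T"
  shows "disc_matrix k (B(l := toward_id t (B l))) T i j =
    (1 - t) * disc_matrix k B T i j + t * disc_matrix k (B(l := id_matrix)) T i j"
proof (cases "l \<in> T - {i, j}")
  case True
  show ?thesis unfolding disc_matrix_def mixed_disc_toward_id[OF True] by simp
next
  case False
  have "mixed_disc k (B(l := H)) (T - {i, j}) = mixed_disc k B (T - {i, j})" for H
    by (rule mixed_disc_cong) (use False in auto)
  then show ?thesis by (simp add: disc_matrix_def algebra_simps)
qed

lemma disc_matrix_upd_row: "disc_matrix k (B(l := H)) T l j = disc_matrix k B T l j"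
proof -
  have "mixed_disc k (B(l := H)) (T - {l, j}) = mixed_disc k B (T - {l, j})"
    by (rule mixed_disc_cong) auto
  then show ?thesis by (simp add: disc_matrix_def)
qed

definition disc_singular :: "nat \<Rightarrow> nat set \<Rightarrow> (nat \<Rightarrow> nat \<Rightarrow> nat \<Rightarrow> complex) \<Rightarrow> bool" where
  "disc_singular k T B \<longleftrightarrow> (\<exists>y::nat \<Rightarrow> real. (\<exists>j\<in>T. y j \<noteq> 0) \<and>
     (\<forall>i\<in>T. (\<Sum>j\<in>T. disc_matrix k B T i j * y j) = 0))"

text \<open>
  For a null vector \<open>y\<close> the quadratic form moves linearly with the slot \<open>l\<close>, and it stays
  nonpositive on the hyperplane orthogonal to row \<open>l\<close> on both sides of \<open>B l\<close>. Hence \<open>y\<close> stays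
  isotropic and, by semidefiniteness, becomes a null vector again after correcting \<open>y l\<close>.
\<close>

lemma disc_singular_replace:
  assumes T: "finite T" "card T = k + 2" and k: "0 < k"
    and l: "l \<in> T" and pd: "\<And>l. l \<in> T \<Longrightarrow> pos_def k (B l)" and sing: "disc_singular k T B"
  shows "disc_singular k T (B(l := id_matrix))"
proof -
  obtain y where y: "\<exists>j\<in>T. y j \<noteq> 0" "\<And>i. i \<in> T \<Longrightarrow> (\<Sum>j\<in>T. disc_matrix k B T i j * y j) = 0"
    using sing unfolding disc_singular_def by blast
  let ?A = "disc_matrix k B T" and ?A1 = "disc_matrix k (B(l := id_matrix)) T"
  let ?b = "bil T ?A" and ?b1 = "bil T ?A1"
  obtain d where d: "d > 0" "\<And>t. - d \<le> t \<Longrightarrow> t \<le> 1 \<Longrightarrow> pos_def k (toward_id t (B l))"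
    using pos_def_toward_id[OF pd[OF l]] by blast
  have nonpos: "(1 - t) * ?b z z + t * ?b1 z z \<le> 0"
    if t: "- d \<le> t" "t \<le> 1" and z: "(\<Sum>j\<in>T. ?A l j * z j) = 0" for t z
  proof -
    let ?Bt = "B(l := toward_id t (B l))"
    have "bil T (disc_matrix k ?Bt T) z z \<le> 0"
    proof (rule disc_form_nonpos[OF T k _ l])
      show "pos_def k (?Bt m)" if "m \<in> T" for m using pd[OF that] d(2)[OF t] by simp
      show "(\<Sum>j\<in>T. disc_matrix k ?Bt T l j * z j) = 0" using z by (simp add: disc_matrix_upd_row)
    qed
    also have "bil T (disc_matrix k ?Bt T) z z = (1 - t) * ?b z z + t * ?b1 z z"
      unfolding bil_def sum_distrib_left sum.distrib[symmetric]
      by (intro sum.cong refl) (simp add: disc_matrix_toward_id[OF l] algebra_simps)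
    finally show ?thesis .
  qed
  have byy: "?b y y = 0" by (simp add: bil_def y(2))
  \<comment> \<open>At \<open>y\<close> the bound is \<open>t * ?b1 y y \<le> 0\<close>;
    \<open>t = - d\<close> and \<open>t = 1\<close> give the two signs.\<close>
  have b1yy: "?b1 y y = 0"
    using nonpos[of "- d" y] nonpos[of 1 y] d(1) y(2)[OF l]
    by (auto simp: byy zero_le_mult_iff)
  \<comment> \<open>An isotropic vector of a semidefinite form is orthogonal to the whole
    hyperplane; this is tested along \<open>y + s * z\<close>.\<close>
  have orth: "?b1 z y = 0" if z: "(\<Sum>j\<in>T. ?A l j * z j) = 0" for z
  proof (rule ccontr)
    assume ne: "?b1 z y \<noteq> 0"
    have "bil T ?A1 (\<lambda>i. y i + s * z i) (\<lambda>i. y i + s * z i) \<le> 0" for s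
    proof -
      have "(\<Sum>j\<in>T. ?A l j * (y j + s * z j)) = (\<Sum>j\<in>T. ?A l j * y j) + s * (\<Sum>j\<in>T. ?A l j * z j)"
        by (simp add: algebra_simps sum.distrib sum_distrib_left)
      then show ?thesis using nonpos[of 1 "\<lambda>i. y i + s * z i"] y(2)[OF l] z d(1) by simp
    qed
    then have le: "2 * s * ?b1 z y + s\<^sup>2 * ?b1 z z \<le> 0" for s
      by (simp add: bil_add_scaled[OF disc_matrix_sym] b1yy)
    \<comment> \<open>With \<open>s = ?b1 z y / M\<close> the term linear in \<open>s\<close>
      outweighs the quadratic one, because \<open>M\<close> exceeds the modulus of
      \<open>?b1 z z\<close>.\<close>
    define M where "M = \<bar>?b1 z z\<bar> + 1"
    have M: "0 < M" "\<bar>?b1 z z\<bar> < M" by (simp_all add: M_def)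
    have "2 * (?b1 z y)\<^sup>2 / M + (?b1 z y / M)\<^sup>2 * ?b1 z z \<le> 0"
      using le[of "?b1 z y / M"] by (simp add: power2_eq_square)
    then have "2 * (?b1 z y)\<^sup>2 * M + (?b1 z y)\<^sup>2 * ?b1 z z \<le> 0"
      using M(1) by (simp add: field_simps power2_eq_square)
    then have "(?b1 z y)\<^sup>2 * (2 * M + ?b1 z z) \<le> 0" by (simp add: algebra_simps)
    moreover have "0 < 2 * M + ?b1 z z" using M by linarith
    ultimately show False using ne by (simp add: mult_le_0_iff)
  qed
  define g where "g i = (\<Sum>j\<in>T. ?A1 i j * y j)" for i
  obtain m where m: "m \<in> T" "m \<noteq> l"
  proof -
    have "T \<noteq> {l}" using T(2) by auto
    then show ?thesis using l that by auto
  qed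
  have am: "0 < ?A l m" using mixed_disc_remove2(2)[where B = B, OF T pd l m(1)] m(2) by auto
  have g: "g j * ?A l m = ?A l j * g m" if j: "j \<in> T" for j
  proof -
    \<comment> \<open>A vector supported on \<open>j\<close> and \<open>m\<close> and orthogonal to
      row \<open>l\<close>; testing with it shows that \<open>g\<close> is proportional to row
      \<open>l\<close>.\<close>
    define z where "z i = (if i = j then ?A l m else 0) - (if i = m then ?A l j else 0)" for i
    have zsum: "(\<Sum>i\<in>T. h i * z i) = h j * ?A l m - h m * ?A l j" for h
      using T(1) j m(1) by (simp add: z_def algebra_simps sum_subtractf if_distrib[of "\<lambda>x. _ * x"] cong: if_cong)
    have "?b1 z y = (\<Sum>i\<in>T. g i * z i)" by (simp add: bil_def g_def mult.commute)
    moreover have "(\<Sum>i\<in>T. ?A l i * z i) = 0" unfolding zsum by simp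
    ultimately show ?thesis using orth[of z] unfolding zsum by simp
  qed
  define \<mu> where "\<mu> = g m / ?A l m"
  have g\<mu>: "g j = \<mu> * ?A l j" if "j \<in> T" for j
    using g[OF that] am by (simp add: \<mu>_def field_simps)
  \<comment> \<open>Column \<open>l\<close> of \<open>?A1\<close> is row \<open>l\<close> of
    \<open>?A\<close>, so changing only the entry at \<open>l\<close> cancels
    \<open>g\<close>.\<close>
  define y1 where "y1 i = y i - (if i = l then \<mu> else 0)" for i
  have "(\<Sum>j\<in>T. ?A1 i j * y1 j) = 0" if i: "i \<in> T" for i
  proof -
    have "(\<Sum>j\<in>T. ?A1 i j * y1 j) = g i - ?A1 i l * \<mu>"
      using T(1) l
      by (simp add: y1_def g_def right_diff_distrib sum_subtractf if_distrib[of "\<lambda>x. _ * x"] cong: if_cong)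
    also have "?A1 i l = ?A l i"
      by (subst disc_matrix_sym) (rule disc_matrix_upd_row)
    also have "g i - ?A l i * \<mu> = 0" using g\<mu>[OF i] by simp
    finally show ?thesis .
  qed
  moreover have "\<exists>j\<in>T. y1 j \<noteq> 0"
  proof (rule ccontr)
    assume "\<not> ?thesis"
    \<comment> \<open>Then \<open>y\<close> would be supported at \<open>l\<close> alone, and the
      positive entry of \<open>?A\<close> at \<open>m\<close> and \<open>l\<close> forces it to
      vanish.\<close>
    then have *: "y j = (if j = l then \<mu> else 0)" if "j \<in> T" for j using that by (auto simp: y1_def)
    then have "(\<Sum>j\<in>T. ?A m j * y j) = (\<Sum>j\<in>T. ?A m j * (if j = l then \<mu> else 0))"
      by (intro sum.cong) auto
    also have "\<dots> = ?A m l * \<mu>" using T(1) l by (simp add: if_distrib[of "\<lambda>x. _ * x"] cong: if_cong)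
    finally have "?A m l * \<mu> = 0" using y(2)[OF m(1)] by simp
    then have "\<mu> = 0" using am by (simp add: disc_matrix_sym[of k B T m])
    then show False using * y(1) by auto
  qed
  ultimately show ?thesis unfolding disc_singular_def by blast
qed

lemma disc_matrix_nonsingular:
  assumes T: "finite T" "card T = k + 2" and k: "0 < k"
    and pd: "\<And>l. l \<in> T \<Longrightarrow> pos_def k (B l)"
  shows "\<not> disc_singular k T B"
proof
  assume "disc_singular k T B"
  then have "disc_singular k T (\<lambda>l. if l \<in> T then id_matrix else B l)"
    using pos_def_replace_by_id[of T T k B "disc_singular k T"] T(1) pd
      disc_singular_replace[OF T k] by blast
  then obtain y where y: "\<exists>j\<in>T. y j \<noteq> 0"
    and null: "\<And>i. i \<in> T \<Longrightarrow> (\<Sum>j\<in>T. disc_matrix k (\<lambda>l. if l \<in> T then id_matrix else B l) T i j * y j) = 0"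
    unfolding disc_singular_def by blast
  have mat: "disc_matrix k (\<lambda>l. if l \<in> T then id_matrix else B l) T i j =
      (if i = j then 0 else fact k)" if "i \<in> T" "j \<in> T" for i j
    using mixed_disc_id_matrix[of "T - {i, j}" k] card_remove2[OF T that] T(1)
    by (auto simp: disc_matrix_def)
  have row: "(\<Sum>j\<in>T. (if i = j then 0 else fact k) * y j) = 0" if "i \<in> T" for i
  proof -
    have "(\<Sum>j\<in>T. (if i = j then 0 else fact k) * y j) =
        (\<Sum>j\<in>T. disc_matrix k (\<lambda>l. if l \<in> T then id_matrix else B l) T i j * y j)"
      by (intro sum.cong refl) (simp add: mat that)
    then show ?thesis using null[OF that] by simp
  qed
  define s where "s = sum y T"
  have ys: "y i = s" if i: "i \<in> T" for i
  proof -
    have "(\<Sum>j\<in>T. (if i = j then 0 else fact k) * y j) =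
        (\<Sum>j\<in>T. fact k * y j - (if i = j then fact k * y j else 0))"
      by (intro sum.cong) auto
    also have "\<dots> = fact k * (s - y i)"
      using T(1) i by (simp add: sum_subtractf s_def sum_distrib_left right_diff_distrib)
    finally show ?thesis using row[OF i] by simp
  qed
  \<comment> \<open>All entries equal their own sum \<open>s\<close>; adding the
    \<open>k + 2\<close> of them gives \<open>(k + 1) * s = 0\<close>.\<close>
  have "sum y T = (\<Sum>i\<in>T. s)" by (intro sum.cong refl ys)
  then have "s = of_nat (card T) * s" by (simp add: s_def[symmetric])
  then have "s * of_nat (Suc k) = 0" using T(2) by (simp add: algebra_simps)
  then have "s = 0" by (simp only: mult_eq_0_iff of_nat_neq_0 simp_thms)
  then show False using ys y by auto
qed

section \<open>The ring of constant-coefficient forms\<close>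

lemma shuffle_sign_empty [simp]: "shuffle_sign {} J = 1" "shuffle_sign I {} = 1"
  by (simp_all add: shuffle_sign_def)

lemma finite_inversions:
  fixes I J :: "nat set"
  shows "finite I \<Longrightarrow> finite J \<Longrightarrow> finite {(i, j). i \<in> I \<and> j \<in> J \<and> j < i}"
  by (rule finite_subset[of _ "I \<times> J"]) auto

lemma shuffle_sign_Un_left:
  assumes "finite A" "finite B" "finite C" "A \<inter> B = {}"
  shows "shuffle_sign (A \<union> B) C = shuffle_sign A C * shuffle_sign B C"
proof -
  have "{(i, j). i \<in> A \<union> B \<and> j \<in> C \<and> j < i} =
      {(i, j). i \<in> A \<and> j \<in> C \<and> j < i} \<union> {(i, j). i \<in> B \<and> j \<in> C \<and> j < i}" by auto
  moreover have "{(i, j). i \<in> A \<and> j \<in> C \<and> j < i} \<inter> {(i, j). i \<in> B \<and> j \<in> C \<and> j < i} = {}"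
    using assms(4) by auto
  ultimately show ?thesis
    using assms by (simp add: shuffle_sign_def card_Un_disjoint finite_inversions power_add)
qed

lemma shuffle_sign_Un_right:
  assumes "finite A" "finite B" "finite C" "B \<inter> C = {}"
  shows "shuffle_sign A (B \<union> C) = shuffle_sign A B * shuffle_sign A C"
proof -
  have "{(i, j). i \<in> A \<and> j \<in> B \<union> C \<and> j < i} =
      {(i, j). i \<in> A \<and> j \<in> B \<and> j < i} \<union> {(i, j). i \<in> A \<and> j \<in> C \<and> j < i}" by auto
  moreover have "{(i, j). i \<in> A \<and> j \<in> B \<and> j < i} \<inter> {(i, j). i \<in> A \<and> j \<in> C \<and> j < i} = {}"
    using assms(4) by auto
  ultimately show ?thesis
    using assms by (simp add: shuffle_sign_def card_Un_disjoint finite_inversions power_add)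
qed

lemma shuffle_sign_square [simp]: "shuffle_sign I J * shuffle_sign I J = 1"
  by (simp add: shuffle_sign_def power_mult_distrib[symmetric])

lemma shuffle_sign_cnj [simp]: "cnj (shuffle_sign I J) = shuffle_sign I J"
  by (simp add: shuffle_sign_def)

lemma shuffle_sign_nonzero [simp]: "shuffle_sign I J \<noteq> 0"
  by (simp add: shuffle_sign_def)

text \<open>Every pair in \<open>A \<times> B\<close> is an inversion in exactly one of the two
  orders.\<close>

lemma shuffle_sign_swap:
  assumes "finite A" "finite B" "A \<inter> B = {}"
  shows "shuffle_sign B A = (-1) ^ (card A * card B) * shuffle_sign A B"
proof -
  have "A \<times> B = {(i, j). i \<in> A \<and> j \<in> B \<and> j < i} \<union> prod.swap ` {(i, j). i \<in> B \<and> j \<in> A \<and> j < i}"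
    using assms(3) by (auto simp: image_iff)
  then have "card (A \<times> B) = card {(i, j). i \<in> A \<and> j \<in> B \<and> j < i} +
      card (prod.swap ` {(i, j). i \<in> B \<and> j \<in> A \<and> j < i})"
    using assms by (simp add: card_Un_disjoint finite_inversions disjoint_iff image_iff)
  also have "card (prod.swap ` {(i, j). i \<in> B \<and> j \<in> A \<and> j < i}) = card {(i, j). i \<in> B \<and> j \<in> A \<and> j < i}"
    by (rule card_image) (simp add: inj_on_def)
  finally have "(-1 :: complex) ^ (card A * card B) = shuffle_sign A B * shuffle_sign B A"
    by (simp add: shuffle_sign_def card_cartesian_product power_add)
  then show ?thesis using shuffle_sign_square[of A B] by (simp add: mult_ac)
qed

lemma shuffle_sign_below:
  assumes "\<And>i j. i \<in> A \<Longrightarrow> j \<in> B \<Longrightarrow> i < j"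
  shows "shuffle_sign A B = 1"
proof -
  have "{(i, j). i \<in> A \<and> j \<in> B \<and> j < i} = {}" using assms by force
  then show ?thesis by (simp only: shuffle_sign_def card.empty power_0)
qed

text \<open>The sign that brings the product of the monomials with index sets \<open>I, J\<close>
  and \<open>I', J'\<close> into normal order.\<close>

definition wedge_sign :: "nat set \<Rightarrow> nat set \<Rightarrow> nat set \<Rightarrow> nat set \<Rightarrow> complex" where
  "wedge_sign I J I' J' = (-1) ^ (card J * card I') * shuffle_sign I I' * shuffle_sign J J'"

text \<open>Both ways of bracketing three monomials collect the same pairwise signs; this is the
  sign part of associativity.\<close>

lemma wedge_sign_cocycle:
  assumes "finite I1" "finite I2" "finite I3" "finite J1" "finite J2" "finite J3"
    and "I1 \<inter> I2 = {}" "(I1 \<union> I2) \<inter> I3 = {}" "J1 \<inter> J2 = {}" "(J1 \<union> J2) \<inter> J3 = {}"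
  shows "wedge_sign (I1 \<union> I2) (J1 \<union> J2) I3 J3 * wedge_sign I1 J1 I2 J2 =
    wedge_sign I1 J1 (I2 \<union> I3) (J2 \<union> J3) * wedge_sign I2 J2 I3 J3"
proof -
  have "I2 \<inter> I3 = {}" "J2 \<inter> J3 = {}" using assms by auto
  then show ?thesis
    using assms
    by (simp add: wedge_sign_def shuffle_sign_Un_left shuffle_sign_Un_right card_Un_disjoint
        power_add algebra_simps)
qed

lemma wedge_sign_swap:
  assumes "finite I" "finite I'" "finite J" "finite J'" "I \<inter> I' = {}" "J \<inter> J' = {}"
  shows "wedge_sign I' J' I J = (-1) ^ ((card I + card J) * (card I' + card J')) * wedge_sign I J I' J'"
proof -
  have e: "(-1 :: complex) ^ (a * b) * (-1) ^ (a * b) = 1" for a b :: nat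
    by (simp add: power_mult_distrib[symmetric])
  show ?thesis
    unfolding wedge_sign_def shuffle_sign_swap[OF assms(1,2,5)] shuffle_sign_swap[OF assms(3,4,6)]
    using e[of "card J" "card I'"]
    by (simp add: power_add algebra_simps)
qed

text \<open>Both sides run over the ordered pairs of disjoint subsets of \<open>N\<close>. Used for
  associativity and for the multiplicativity of \<open>ext_hom\<close>.\<close>

lemma sum_Pow_Pow_diff:
  fixes f :: "'a set \<Rightarrow> 'a set \<Rightarrow> 'b::comm_monoid_add"
  assumes "finite N"
  shows "(\<Sum>I\<in>Pow N. \<Sum>K\<in>Pow I. f K (I - K)) = (\<Sum>K\<in>Pow N. \<Sum>K'\<in>Pow (N - K). f K K')"
proof -
  have "(\<Sum>I\<in>Pow N. \<Sum>K\<in>Pow I. f K (I - K)) = (\<Sum>(I, K)\<in>Sigma (Pow N) Pow. f K (I - K))"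
    using assms by (subst sum.Sigma) (auto intro: finite_subset)
  also have "\<dots> = (\<Sum>(K, K')\<in>Sigma (Pow N) (\<lambda>K. Pow (N - K)). f K K')"
    by (rule sum.reindex_bij_witness[of _ "\<lambda>(K, K'). (K \<union> K', K)" "\<lambda>(I, K). (K, I - K)"]) auto
  also have "\<dots> = (\<Sum>K\<in>Pow N. \<Sum>K'\<in>Pow (N - K). f K K')"
    using assms by (subst sum.Sigma) auto
  finally show ?thesis .
qed

lemma wedge_alt: "wedge \<alpha> \<beta> I J =
  (\<Sum>I1\<in>Pow I. \<Sum>J1\<in>Pow J. wedge_sign I1 J1 (I - I1) (J - J1) * \<alpha> I1 J1 * \<beta> (I - I1) (J - J1))"
  by (simp add: wedge_def wedge_sign_def)

lemma wedge_assoc_finite: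
  assumes "finite I" "finite J"
  shows "wedge (wedge a b) c I J = wedge a (wedge b c) I J"
proof -
  let ?F = "\<lambda>I1 I2 I3 J1 J2 J3. wedge_sign (I1 \<union> I2) (J1 \<union> J2) I3 J3 * wedge_sign I1 J1 I2 J2 *
    a I1 J1 * b I2 J2 * c I3 J3"
  have fin: "A \<subseteq> I \<Longrightarrow> finite A" "A \<subseteq> J \<Longrightarrow> finite A" for A
    using assms finite_subset by auto
  have "wedge (wedge a b) c I J = (\<Sum>I12\<in>Pow I. \<Sum>J12\<in>Pow J. \<Sum>I1\<in>Pow I12. \<Sum>J1\<in>Pow J12.
      ?F I1 (I12 - I1) (I - I12) J1 (J12 - J1) (J - J12))"
    unfolding wedge_alt sum_distrib_left sum_distrib_right
    by (intro sum.cong refl) (auto simp: mult_ac Un_absorb1)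
  also have "\<dots> = (\<Sum>I12\<in>Pow I. \<Sum>I1\<in>Pow I12. \<Sum>J12\<in>Pow J. \<Sum>J1\<in>Pow J12.
      ?F I1 (I12 - I1) (I - I12) J1 (J12 - J1) (J - J12))"
    by (intro sum.cong refl sum.swap)
  also have "\<dots> = (\<Sum>I12\<in>Pow I. \<Sum>I1\<in>Pow I12. \<Sum>J12\<in>Pow J. \<Sum>J1\<in>Pow J12.
      ?F I1 (I12 - I1) (I - I1 - (I12 - I1)) J1 (J12 - J1) (J - J1 - (J12 - J1)))"
  proof -
    have "B \<subseteq> A \<Longrightarrow> A \<subseteq> N \<Longrightarrow> N - B - (A - B) = N - A" for A B N :: "nat set" by auto
    then show ?thesis by (intro sum.cong refl) simp
  qed
  also have "\<dots> = (\<Sum>I1\<in>Pow I. \<Sum>I2\<in>Pow (I - I1). \<Sum>J12\<in>Pow J. \<Sum>J1\<in>Pow J12.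
      ?F I1 I2 (I - I1 - I2) J1 (J12 - J1) (J - J1 - (J12 - J1)))"
    by (rule sum_Pow_Pow_diff[OF assms(1)])
  also have "\<dots> = (\<Sum>I1\<in>Pow I. \<Sum>I2\<in>Pow (I - I1). \<Sum>J1\<in>Pow J. \<Sum>J2\<in>Pow (J - J1).
      ?F I1 I2 (I - I1 - I2) J1 J2 (J - J1 - J2))"
    by (intro sum.cong refl sum_Pow_Pow_diff[OF assms(2)])
  also have "\<dots> = (\<Sum>I1\<in>Pow I. \<Sum>J1\<in>Pow J. \<Sum>I2\<in>Pow (I - I1). \<Sum>J2\<in>Pow (J - J1).
      ?F I1 I2 (I - I1 - I2) J1 J2 (J - J1 - J2))"
    by (intro sum.cong refl sum.swap)
  also have "\<dots> = wedge a (wedge b c) I J"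
    unfolding wedge_alt sum_distrib_left
  proof (intro sum.cong refl)
    fix I1 J1 I2 J2
    assume "I1 \<in> Pow I" "J1 \<in> Pow J" "I2 \<in> Pow (I - I1)" "J2 \<in> Pow (J - J1)"
    then have sub: "I1 \<subseteq> I" "J1 \<subseteq> J" "I2 \<subseteq> I - I1" "J2 \<subseteq> J - J1" by auto
    then have "I2 \<subseteq> I" "J2 \<subseteq> J" by auto
    have "wedge_sign (I1 \<union> I2) (J1 \<union> J2) (I - I1 - I2) (J - J1 - J2) * wedge_sign I1 J1 I2 J2 =
        wedge_sign I1 J1 (I2 \<union> (I - I1 - I2)) (J2 \<union> (J - J1 - J2)) *
        wedge_sign I2 J2 (I - I1 - I2) (J - J1 - J2)"
      by (rule wedge_sign_cocycle) (use sub fin \<open>I2 \<subseteq> I\<close> \<open>J2 \<subseteq> J\<close> in auto)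
    moreover have "I2 \<union> (I - I1 - I2) = I - I1" "J2 \<union> (J - J1 - J2) = J - J1" using sub by auto
    ultimately show "?F I1 I2 (I - I1 - I2) J1 J2 (J - J1 - J2) =
        wedge_sign I1 J1 (I - I1) (J - J1) * a I1 J1 *
        (wedge_sign I2 J2 (I - I1 - I2) (J - J1 - J2) * b I2 J2 * c (I - I1 - I2) (J - J1 - J2))"
      by simp
  qed
  finally show ?thesis .
qed

text \<open>A sum over an infinite set is 0 by convention, so products satisfy the invariant of the
  type \<open>ext\<close>.\<close>

lemma wedge_infinite: "infinite I \<or> infinite J \<Longrightarrow> wedge a b I J = 0"
proof (cases "infinite I")
  case True
  then have "infinite (Pow I)" by simp
  then show ?thesis unfolding wedge_alt by (rule sum.infinite)
next
  case False
  moreover assume "infinite I \<or> infinite J"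
  ultimately have "infinite (Pow J)" by simp
  then show ?thesis unfolding wedge_alt by simp
qed

text \<open>
  The forms whose coefficients vanish outside finite index sets are a ring under the wedge
  product; without this restriction \<^const>\<open>unit_form\<close> would not be a unit.
\<close>

typedef ext = "{\<alpha> :: form. \<forall>I J. infinite I \<or> infinite J \<longrightarrow> \<alpha> I J = 0}"
  morphisms cf Ext
  by (intro exI[of _ "\<lambda>_ _. 0"]) simp

setup_lifting type_definition_ext

section \<open>Ring structure, scalars and degrees\<close>

lemma cf_infinite: "infinite I \<or> infinite J \<Longrightarrow> cf a I J = 0"
  using cf[of a] by auto

lemma ext_eqI: "(\<And>I J. finite I \<Longrightarrow> finite J \<Longrightarrow> cf a I J = cf b I J) \<Longrightarrow> a = b"
  by (metis cf_infinite cf_inject ext)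

lemma sum_delta_empty:
  fixes f :: "'a set \<Rightarrow> 'b::comm_monoid_add"
  assumes "finite I" "\<And>A. A \<subseteq> I \<Longrightarrow> A \<noteq> {} \<Longrightarrow> f A = 0"
  shows "(\<Sum>A\<in>Pow I. f A) = f {}"
proof -
  have "(\<Sum>A\<in>Pow I. f A) = (\<Sum>A\<in>{{}}. f A)"
    by (rule sum.mono_neutral_right) (use assms in auto)
  then show ?thesis by simp
qed

lemma sum_delta_full:
  fixes f :: "'a set \<Rightarrow> 'b::comm_monoid_add"
  assumes "finite I" "\<And>A. A \<subseteq> I \<Longrightarrow> A \<noteq> I \<Longrightarrow> f A = 0"
  shows "(\<Sum>A\<in>Pow I. f A) = f I"
proof -
  have "(\<Sum>A\<in>Pow I. f A) = (\<Sum>A\<in>{I}. f A)"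
    by (rule sum.mono_neutral_right) (use assms in auto)
  then show ?thesis by simp
qed

instantiation ext :: ring_1
begin

lift_definition zero_ext :: ext is "\<lambda>_ _. 0" by simp
lift_definition one_ext :: ext is unit_form by (auto simp: unit_form_def)
lift_definition plus_ext :: "ext \<Rightarrow> ext \<Rightarrow> ext" is "\<lambda>a b I J. a I J + b I J" by simp
lift_definition minus_ext :: "ext \<Rightarrow> ext \<Rightarrow> ext" is "\<lambda>a b I J. a I J - b I J" by simp
lift_definition uminus_ext :: "ext \<Rightarrow> ext" is "\<lambda>a I J. - a I J" by simp
lift_definition times_ext :: "ext \<Rightarrow> ext \<Rightarrow> ext" is wedge by (simp add: wedge_infinite)

instance
proof
  fix a b c :: ext
  show "a * b * c = a * (b * c)"
    by (rule ext_eqI) (simp add: times_ext.rep_eq wedge_assoc_finite)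
  show "1 * a = a"
  proof (rule ext_eqI)
    fix I J :: "nat set" assume f: "finite I" "finite J"
    have "cf (1 * a) I J = (\<Sum>I1\<in>Pow I. \<Sum>J1\<in>Pow J.
        wedge_sign I1 J1 (I - I1) (J - J1) * unit_form I1 J1 * cf a (I - I1) (J - J1))"
      by (simp add: times_ext.rep_eq one_ext.rep_eq wedge_alt)
    also have "\<dots> = (\<Sum>J1\<in>Pow J. wedge_sign {} J1 I (J - J1) * unit_form {} J1 * cf a I (J - J1))"
      using f by (subst sum_delta_empty) (auto simp: unit_form_def)
    also have "\<dots> = cf a I J"
      using f by (subst sum_delta_empty) (auto simp: unit_form_def wedge_sign_def)
    finally show "cf (1 * a) I J = cf a I J" .
  qed
  show "a * 1 = a"
  proof (rule ext_eqI)
    fix I J :: "nat set" assume f: "finite I" "finite J"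
    have "cf (a * 1) I J = (\<Sum>I1\<in>Pow I. \<Sum>J1\<in>Pow J.
        wedge_sign I1 J1 (I - I1) (J - J1) * cf a I1 J1 * unit_form (I - I1) (J - J1))"
      by (simp add: times_ext.rep_eq one_ext.rep_eq wedge_alt)
    also have "\<dots> = (\<Sum>J1\<in>Pow J. wedge_sign I J1 {} (J - J1) * cf a I J1 * unit_form {} (J - J1))"
      using f by (subst sum_delta_full) (auto simp: unit_form_def)
    also have "\<dots> = cf a I J"
      using f by (subst sum_delta_full) (auto simp: unit_form_def wedge_sign_def)
    finally show "cf (a * 1) I J = cf a I J" .
  qed
  show "(a + b) * c = a * c + b * c" "a * (b + c) = a * b + a * c"
    by (rule ext_eqI; simp add: times_ext.rep_eq plus_ext.rep_eq wedge_alt algebra_simps sum.distrib)+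
  show "(0::ext) \<noteq> 1"
  proof
    assume "(0::ext) = 1"
    then have "cf 0 {} {} = cf 1 {} {}" by simp
    then show False by (simp add: zero_ext.rep_eq one_ext.rep_eq unit_form_def)
  qed
qed (rule ext_eqI; simp add: plus_ext.rep_eq minus_ext.rep_eq uminus_ext.rep_eq zero_ext.rep_eq)+

end

lemma cf_simps [simp]:
  "cf 0 I J = 0" "cf (a + b) I J = cf a I J + cf b I J"
  "cf (a - b) I J = cf a I J - cf b I J" "cf (- a) I J = - cf a I J"
  by (simp_all add: zero_ext.rep_eq plus_ext.rep_eq minus_ext.rep_eq uminus_ext.rep_eq)

lemma cf_sum: "cf (\<Sum>x\<in>A. f x) I J = (\<Sum>x\<in>A. cf (f x) I J)"
  by (induction A rule: infinite_finite_induct) simp_all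

lemma cf_mult: "cf (a * b) I J = (\<Sum>I1\<in>Pow I. \<Sum>J1\<in>Pow J.
    wedge_sign I1 J1 (I - I1) (J - J1) * cf a I1 J1 * cf b (I - I1) (J - J1))"
  by (simp add: times_ext.rep_eq wedge_alt)

text \<open>Scalars enter as central ring elements, so that scalar multiplication is ring
  multiplication.\<close>

lift_definition cst :: "complex \<Rightarrow> ext" is "\<lambda>c I J. c * unit_form I J"
  by (auto simp: unit_form_def)

lemma cf_cst: "cf (cst c) I J = (if I = {} \<and> J = {} then c else 0)"
  by (simp add: cst.rep_eq unit_form_def)

lemma cf_cst_mult [simp]: "cf (cst c * a) I J = c * cf a I J"
proof (cases "finite I \<and> finite J")
  case True
  have "cf (cst c * a) I J = (\<Sum>J1\<in>Pow J. wedge_sign {} J1 I (J - J1) * cf (cst c) {} J1 * cf a I (J - J1))"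
    unfolding cf_mult using True by (subst sum_delta_empty) (auto simp: cf_cst)
  also have "\<dots> = c * cf a I J"
    using True by (subst sum_delta_empty) (auto simp: cf_cst wedge_sign_def)
  finally show ?thesis .
qed (use cf_infinite in auto)

lemma cf_mult_cst [simp]: "cf (a * cst c) I J = c * cf a I J"
proof (cases "finite I \<and> finite J")
  case True
  have "cf (a * cst c) I J = (\<Sum>J1\<in>Pow J. wedge_sign I J1 {} (J - J1) * cf a I J1 * cf (cst c) {} (J - J1))"
    unfolding cf_mult using True by (subst sum_delta_full) (auto simp: cf_cst)
  also have "\<dots> = c * cf a I J"
    using True by (subst sum_delta_full) (auto simp: cf_cst wedge_sign_def)
  finally show ?thesis .
qed (use cf_infinite in auto)

lemma cst_commute: "a * cst c = cst c * a"
  by (rule ext_eqI) simp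

lemma cst_left_commute: "a * (cst c * b) = cst c * (a * b)"
  by (metis cst_commute mult.assoc)

lemma cst_simps [simp]: "cst 0 = 0" "cst 1 = 1"
  by (rule ext_eqI; simp add: cf_cst one_ext.rep_eq unit_form_def)+

lemma cst_add: "cst (c + d) = cst c + cst d"
  by (rule ext_eqI) (simp add: cf_cst)

lemma cst_minus: "cst (- c) = - cst c"
  by (rule ext_eqI) (simp add: cf_cst)

lemma cst_mult: "cst (c * d) = cst c * cst d"
  by (rule ext_eqI) (simp add: cf_cst)

lemma cst_mult_assoc: "cst c * (cst d * a) = cst (c * d) * a"
  by (simp add: cst_mult mult.assoc)

lemma cst_sum: "cst (\<Sum>x\<in>A. f x) = (\<Sum>x\<in>A. cst (f x))"
  by (induction A rule: infinite_finite_induct) (simp_all add: cst_add)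

definition supported :: "nat \<Rightarrow> ext \<Rightarrow> bool" where
  "supported n a \<longleftrightarrow> (\<forall>I J. cf a I J \<noteq> 0 \<longrightarrow> I \<subseteq> {..<n} \<and> J \<subseteq> {..<n})"

lemma formsD:
  assumes "\<alpha> \<in> forms n p q" "\<alpha> I J \<noteq> 0"
  shows "I \<subseteq> {..<n} \<and> card I = p \<and> J \<subseteq> {..<n} \<and> card J = q"
  using assms by (simp add: forms_def)

lemma forms_supported: "cf a \<in> forms n p q \<Longrightarrow> supported n a"
  by (auto simp: forms_def supported_def)

lemma cf_Ext_forms:
  assumes "\<alpha> \<in> forms n p q"
  shows "cf (Ext \<alpha>) = \<alpha>"
proof (rule Ext_inverse)
  show "\<alpha> \<in> {\<alpha>. \<forall>I J. infinite I \<or> infinite J \<longrightarrow> \<alpha> I J = 0}"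
  proof (intro CollectI allI impI, rule ccontr)
    fix I J assume "infinite I \<or> infinite J" "\<alpha> I J \<noteq> 0"
    then show False using formsD[OF assms, of I J] finite_subset[OF _ finite_lessThan[of n]] by metis
  qed
qed

lemma forms_zero: "cf 0 \<in> forms n p q"
  by (simp add: forms_def)

lemma forms_add: "cf a \<in> forms n p q \<Longrightarrow> cf b \<in> forms n p q \<Longrightarrow> cf (a + b) \<in> forms n p q"
  unfolding forms_def by (simp add: mem_Collect_eq) (metis add.right_neutral)

lemma forms_cst_mult:
  assumes "cf a \<in> forms n p q"
  shows "cf (cst c * a) \<in> forms n p q"
  unfolding forms_def
proof (intro CollectI allI impI)
  fix I J assume "cf (cst c * a) I J \<noteq> 0"
  then have "cf a I J \<noteq> 0" by simp
  then show "I \<subseteq> {..<n} \<and> card I = p \<and> J \<subseteq> {..<n} \<and> card J = q" by (rule formsD[OF assms])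
qed

lemma forms_sum: "(\<And>x. x \<in> A \<Longrightarrow> cf (f x) \<in> forms n p q) \<Longrightarrow> cf (\<Sum>x\<in>A. f x) \<in> forms n p q"
  by (induction A rule: infinite_finite_induct) (simp_all add: forms_zero forms_add)

lemma forms_one: "cf 1 \<in> forms n 0 0"
  by (simp add: forms_def one_ext.rep_eq unit_form_def)

lemma forms_mult:
  assumes "cf a \<in> forms n p q" "cf b \<in> forms n p' q'"
  shows "cf (a * b) \<in> forms n (p + p') (q + q')"
  unfolding forms_def
proof (intro CollectI allI impI)
  fix I J assume nz: "cf (a * b) I J \<noteq> 0"
  then obtain I1 J1 where sub: "I1 \<subseteq> I" "J1 \<subseteq> J"
    and "cf a I1 J1 \<noteq> 0" "cf b (I - I1) (J - J1) \<noteq> 0"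
    unfolding cf_mult by (metis (no_types, lifting) Pow_iff mult_eq_0_iff sum.neutral)
  then have a: "I1 \<subseteq> {..<n}" "J1 \<subseteq> {..<n}" "card I1 = p" "card J1 = q"
    and b: "I - I1 \<subseteq> {..<n}" "J - J1 \<subseteq> {..<n}" "card (I - I1) = p'" "card (J - J1) = q'"
    using assms unfolding forms_def by blast+
  have fin: "finite I" "finite J" using nz cf_infinite by blast+
  have "card I = card I1 + card (I - I1)" "card J = card J1 + card (J - J1)"
    using sub fin by (auto simp: card_Diff_subset finite_subset card_mono)
  then show "I \<subseteq> {..<n} \<and> card I = p + p' \<and> J \<subseteq> {..<n} \<and> card J = q + q'"
    using a b by auto
qed

lemma sum_Pow_compl:
  "(\<Sum>A\<in>Pow I. f A (I - A)) = (\<Sum>A\<in>Pow I. f (I - A) A)"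
  by (rule sum.reindex_bij_witness[of _ "\<lambda>A. I - A" "\<lambda>A. I - A"]) (auto simp: double_diff)

text \<open>Complementing the index sets in the sum for \<open>b * a\<close> gives the terms of
  \<open>a * b\<close>; the sign between them depends only on the total degrees.\<close>

lemma supercommute:
  assumes "cf a \<in> forms n p q" "cf b \<in> forms n p' q'"
  shows "b * a = cst ((-1) ^ ((p + q) * (p' + q'))) * (a * b)"
proof (rule ext_eqI)
  fix I J :: "nat set" assume fin: "finite I" "finite J"
  have "cf (b * a) I J = (\<Sum>I1\<in>Pow I. \<Sum>J1\<in>Pow J.
      wedge_sign (I - I1) J1 I1 (J - J1) * cf b (I - I1) J1 * cf a I1 (J - J1))"
    unfolding cf_mult
    by (rule sum_Pow_compl[of "\<lambda>A A'. \<Sum>J1\<in>Pow J. wedge_sign A J1 A' (J - J1) * cf b A J1 * cf a A' (J - J1)"])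
  also have "\<dots> = (\<Sum>I1\<in>Pow I. \<Sum>J1\<in>Pow J.
      wedge_sign (I - I1) (J - J1) I1 J1 * cf b (I - I1) (J - J1) * cf a I1 J1)"
    by (intro sum.cong refl sum_Pow_compl[of "\<lambda>A A'. wedge_sign (I - I1) A I1 A' * cf b (I - I1) A * cf a I1 A'" for I1])
  also have "\<dots> = (\<Sum>I1\<in>Pow I. \<Sum>J1\<in>Pow J. (-1) ^ ((p + q) * (p' + q')) *
      (wedge_sign I1 J1 (I - I1) (J - J1) * cf a I1 J1 * cf b (I - I1) (J - J1)))"
  proof (intro sum.cong refl)
    fix I1 J1 assume "I1 \<in> Pow I" "J1 \<in> Pow J"
    then have f: "finite I1" "finite J1" using fin finite_subset by auto
    show "wedge_sign (I - I1) (J - J1) I1 J1 * cf b (I - I1) (J - J1) * cf a I1 J1 =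
        (-1) ^ ((p + q) * (p' + q')) *
        (wedge_sign I1 J1 (I - I1) (J - J1) * cf a I1 J1 * cf b (I - I1) (J - J1))"
    proof (cases "cf a I1 J1 = 0 \<or> cf b (I - I1) (J - J1) = 0")
      case True
      then show ?thesis by auto
    next
      case False
      then have "card I1 = p" "card J1 = q" "card (I - I1) = p'" "card (J - J1) = q'"
        using assms by (auto simp: forms_def)
      then show ?thesis
        using wedge_sign_swap[of I1 "I - I1" J1 "J - J1"] fin f by (simp add: mult_ac)
    qed
  qed
  also have "\<dots> = cf (cst ((-1) ^ ((p + q) * (p' + q'))) * (a * b)) I J"
    unfolding cf_cst_mult cf_mult[of a b] sum_distrib_left ..
  finally show "cf (b * a) I J = cf (cst ((-1) ^ ((p + q) * (p' + q'))) * (a * b)) I J" .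
qed

lemma one_forms_anticommute:
  assumes "cf a \<in> forms n p q" "cf b \<in> forms n p' q'" "p + q = 1" "p' + q' = 1"
  shows "a * b = - (b * a)"
  using supercommute[OF assms(2,1)] assms(3,4) by (simp add: cst_minus)

lemma ext_eq_minus_self:
  fixes a :: ext
  assumes "a = - a"
  shows "a = 0"
proof (rule ext_eqI)
  fix I J
  have "cf a I J = cf (- a) I J" using arg_cong[OF assms, of "\<lambda>x. cf x I J"] .
  then show "cf a I J = cf 0 I J" by simp
qed

lemma cst_mult_cst_mult: "(cst c * a) * (cst d * b) = cst (c * d) * (a * b)"
  by (simp only: mult.assoc cst_left_commute[of a] cst_mult)

text \<open>The basis monomial \<open>dx_K \<and> d(cnj x)_L\<close>, set to 0 when an index set is
  infinite so that it stays in the type.\<close>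

lift_definition dl :: "nat set \<Rightarrow> nat set \<Rightarrow> ext" is
  "\<lambda>K L I J. if I = K \<and> J = L \<and> finite K \<and> finite L then 1 else 0"
  by auto

lemma cf_dl: "finite K \<Longrightarrow> finite L \<Longrightarrow> cf (dl K L) I J = (if I = K \<and> J = L then 1 else 0)"
  by (simp add: dl.rep_eq)

lemma dl_empty: "dl {} {} = 1"
  by (rule ext_eqI) (simp add: cf_dl one_ext.rep_eq unit_form_def)

lemma cf_dl_mult:
  assumes "finite K" "finite L" "finite I" "finite J"
  shows "cf (dl K L * b) I J =
    (if K \<subseteq> I \<and> L \<subseteq> J then wedge_sign K L (I - K) (J - L) * cf b (I - K) (J - L) else 0)"
proof -
  have "cf (dl K L * b) I J = (\<Sum>I1\<in>Pow I. if I1 = K then (\<Sum>J1\<in>Pow J. if J1 = L then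
      wedge_sign K L (I - K) (J - L) * cf b (I - K) (J - L) else 0) else 0)"
    unfolding cf_mult cf_dl[OF assms(1,2)] by (auto intro!: sum.cong sum.neutral)
  then show ?thesis using assms by simp
qed

lemma dl_mult_dl:
  assumes "finite K" "finite L" "finite K'" "finite L'"
  shows "dl K L * dl K' L' = (if K \<inter> K' = {} \<and> L \<inter> L' = {}
    then cst (wedge_sign K L K' L') * dl (K \<union> K') (L \<union> L') else 0)"
proof (rule ext_eqI)
  fix I J :: "nat set" assume f: "finite I" "finite J"
  have "K \<subseteq> I \<and> I - K = K' \<longleftrightarrow> K \<inter> K' = {} \<and> I = K \<union> K'"
    "L \<subseteq> J \<and> J - L = L' \<longleftrightarrow> L \<inter> L' = {} \<and> J = L \<union> L'" by auto
  then show "cf (dl K L * dl K' L') I J = cf (if K \<inter> K' = {} \<and> L \<inter> L' = {}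
    then cst (wedge_sign K L K' L') * dl (K \<union> K') (L \<union> L') else 0) I J"
    using assms f by (auto simp: cf_dl_mult cf_dl)
qed

lemma sum_Pow_Pow_delta:
  fixes g :: "'a set \<Rightarrow> 'a set \<Rightarrow> 'b::comm_monoid_add"
  assumes "finite N"
  shows "(\<Sum>K\<in>Pow N. \<Sum>L\<in>Pow N. if K = I \<and> L = J then g K L else 0) =
    (if I \<subseteq> N \<and> J \<subseteq> N then g I J else 0)"
proof -
  have "(\<Sum>K\<in>Pow N. \<Sum>L\<in>Pow N. if K = I \<and> L = J then g K L else 0) =
      (\<Sum>K\<in>Pow N. if K = I then (\<Sum>L\<in>Pow N. if L = J then g I L else 0) else 0)"
    by (intro sum.cong refl) auto
  then show ?thesis using assms by simp
qed

lemma supported_expansion: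
  assumes "supported n a"
  shows "a = (\<Sum>K\<in>Pow {..<n}. \<Sum>L\<in>Pow {..<n}. cst (cf a K L) * dl K L)"
proof (rule ext_eqI)
  fix I J :: "nat set" assume f: "finite I" "finite J"
  have fin: "K \<subseteq> {..<n} \<Longrightarrow> finite K" for K using finite_subset by auto
  have "cf (\<Sum>K\<in>Pow {..<n}. \<Sum>L\<in>Pow {..<n}. cst (cf a K L) * dl K L) I J =
      (\<Sum>K\<in>Pow {..<n}. \<Sum>L\<in>Pow {..<n}. if K = I \<and> L = J then cf a K L else 0)"
    unfolding cf_sum by (intro sum.cong refl) (auto simp: cf_dl fin)
  also have "\<dots> = (if I \<subseteq> {..<n} \<and> J \<subseteq> {..<n} then cf a I J else 0)"
    by (rule sum_Pow_Pow_delta) simp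
  also have "\<dots> = cf a I J" using assms by (auto simp: supported_def)
  finally show "cf a I J = cf (\<Sum>K\<in>Pow {..<n}. \<Sum>L\<in>Pow {..<n}. cst (cf a K L) * dl K L) I J" by simp
qed

subsection \<open>Ordered products and the induced ring homomorphism\<close>

text \<open>The ring is not commutative, so an order is fixed; the increasing one agrees with the
  basis monomials.\<close>

definition ordprod :: "(nat \<Rightarrow> ext) \<Rightarrow> nat set \<Rightarrow> ext" where
  "ordprod e K = prod_list (map e (sorted_list_of_set K))"

lemma ordprod_empty [simp]: "ordprod e {} = 1"
  by (simp add: ordprod_def)

lemma ordprod_insert_min:
  assumes "finite K" "\<And>a. a \<in> K \<Longrightarrow> b < a"
  shows "ordprod e (insert b K) = e b * ordprod e K"
proof -
  have "b \<notin> K" using assms(2) by auto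
  then have "sorted_list_of_set (insert b K) = b # sorted_list_of_set K"
    using assms by (simp add: insort_is_Cons less_imp_le)
  then show ?thesis by (simp add: ordprod_def)
qed

text \<open>The case \<open>i = j\<close> of the hypothesis makes every \<open>e i\<close> square to
  zero. Each induction step prepends a new least index \<open>b\<close>, which \<open>e i\<close>
  has to pass, at the cost of a sign, only if \<open>b < i\<close>.\<close>

lemma ordprod_mult_one:
  assumes ac: "\<And>i j. e i * e j = - (e j * e i)" and "finite K"
  shows "e i * ordprod e K = (if i \<in> K then 0 else cst (shuffle_sign {i} K) * ordprod e (insert i K))"
  using assms(2)
proof (induction K rule: finite_linorder_min_induct)
  case empty
  then show ?case using ordprod_insert_min[of "{}" i e] by simp
next
  case (insert b A)
  have ee: "e j * e j = 0" for j using ac[of j j] by (rule ext_eq_minus_self)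
  note ins = ordprod_insert_min[OF insert.hyps(1), of b e]
  consider "i < b" | "i = b" | "b < i" by linarith
  then show ?case
  proof cases
    case 1
    then have lt: "a \<in> insert b A \<Longrightarrow> i < a" for a using insert.hyps(2) by force
    then have "i \<notin> insert b A" by blast
    moreover have "shuffle_sign {i} (insert b A) = 1"
      by (rule shuffle_sign_below) (use lt in auto)
    moreover have "ordprod e (insert i (insert b A)) = e i * ordprod e (insert b A)"
      using insert.hyps(1) lt by (intro ordprod_insert_min) auto
    ultimately show ?thesis by simp
  next
    case 2
    then show ?thesis using insert.hyps(2) ins
      by (simp add: mult.assoc[symmetric] ee)
  next
    case 3
    have "e i * ordprod e (insert b A) = - (e b * (e i * ordprod e A))"
      using insert.hyps(2) ins by (simp add: mult.assoc[symmetric] ac[of i b])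
    also have "\<dots> = (if i \<in> insert b A then 0
        else cst (- shuffle_sign {i} A) * (e b * ordprod e (insert i A)))"
      using insert.IH 3 by (auto simp: cst_left_commute cst_minus)
    also have "e b * ordprod e (insert i A) = ordprod e (insert b (insert i A))"
      using insert.hyps 3 by (intro ordprod_insert_min[symmetric]) auto
    also have "- shuffle_sign {i} A = shuffle_sign {i} (insert b A)" if "i \<notin> insert b A"
    proof -
      have "shuffle_sign {i} ({b} \<union> A) = shuffle_sign {i} {b} * shuffle_sign {i} A"
        using insert.hyps by (intro shuffle_sign_Un_right) auto
      moreover have "{(x, y). x \<in> {i} \<and> y \<in> {b} \<and> y < x} = {(i, b)}" using 3 by auto
      then have "shuffle_sign {i} {b} = - 1" by (simp add: shuffle_sign_def del: singleton_iff)
      ultimately show ?thesis by simp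
    qed
    then have "(if i \<in> insert b A then 0
        else cst (- shuffle_sign {i} A) * ordprod e (insert b (insert i A))) =
      (if i \<in> insert b A then 0
        else cst (shuffle_sign {i} (insert b A)) * ordprod e (insert i (insert b A)))"
      by (auto simp: insert_commute)
    finally show ?thesis .
  qed
qed

lemma ordprod_mult:
  assumes ac: "\<And>i j. e i * e j = - (e j * e i)" and "finite K" and K': "finite K'"
  shows "ordprod e K * ordprod e K' =
    (if K \<inter> K' = {} then cst (shuffle_sign K K') * ordprod e (K \<union> K') else 0)"
  using assms(2)
proof (induction K rule: finite_linorder_min_induct)
  case empty
  then show ?case by simp
next
  case (insert b A)
  have bA: "b \<notin> A" using insert.hyps(2) by auto
  have "ordprod e (insert b A) * ordprod e K' = e b * (ordprod e A * ordprod e K')"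
    using insert.hyps by (simp add: ordprod_insert_min mult.assoc)
  also have "\<dots> = (if A \<inter> K' = {} then cst (shuffle_sign A K') * (e b * ordprod e (A \<union> K')) else 0)"
    using insert.IH by (simp add: cst_left_commute)
  also have "\<dots> = (if insert b A \<inter> K' = {} then cst (shuffle_sign (insert b A) K') * ordprod e (insert b A \<union> K') else 0)"
  proof (cases "insert b A \<inter> K' = {}")
    case True
    have "shuffle_sign {b} (A \<union> K') = shuffle_sign {b} A * shuffle_sign {b} K'"
      using insert.hyps K' True by (intro shuffle_sign_Un_right) auto
    also have "shuffle_sign {b} A = 1" using insert.hyps(2) by (intro shuffle_sign_below) auto
    finally have "shuffle_sign A K' * shuffle_sign {b} (A \<union> K') = shuffle_sign ({b} \<union> A) K'"
      using shuffle_sign_Un_left[of "{b}" A K'] insert.hyps(1) K' bA by simp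
    then show ?thesis
      using True bA ordprod_mult_one[where K = "A \<union> K'" and i = b and e = e, OF ac] insert.hyps(1) K'
      by (simp add: cst_mult_assoc)
  next
    case False
    then show ?thesis
      using ordprod_mult_one[where K = "A \<union> K'" and i = b and e = e, OF ac] insert.hyps(1) K' by auto
  qed
  finally show ?case .
qed

lemma ordprod_forms:
  assumes "\<And>i. cf (e i) \<in> forms n p q" "finite K"
  shows "cf (ordprod e K) \<in> forms n (card K * p) (card K * q)"
  using assms(2)
proof (induction K rule: finite_linorder_min_induct)
  case empty
  then show ?case by (simp add: forms_one)
next
  case (insert b A)
  then have "b \<notin> A" by auto
  then show ?case
    using insert forms_mult[OF assms(1)[of b] insert.IH] by (simp add: ordprod_insert_min)
qed

text \<open>Substitutes \<open>e i\<close> for \<open>dx_i\<close> and \<open>f i\<close> for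
  \<open>d(cnj x)_i\<close>; coefficients outside the first \<open>n\<close> coordinates are
  dropped.\<close>

definition ext_hom :: "nat \<Rightarrow> (nat \<Rightarrow> ext) \<Rightarrow> (nat \<Rightarrow> ext) \<Rightarrow> ext \<Rightarrow> ext" where
  "ext_hom n e f a = (\<Sum>K\<in>Pow {..<n}. \<Sum>L\<in>Pow {..<n}. cst (cf a K L) * (ordprod e K * ordprod f L))"

locale coframe =
  fixes n :: nat and e f :: "nat \<Rightarrow> ext"
  assumes e: "\<And>i. cf (e i) \<in> forms n 1 0" and f: "\<And>i. cf (f i) \<in> forms n 0 1"
begin

lemma ac: "e i * e j = - (e j * e i)" "f i * f j = - (f j * f i)"
  by (rule one_forms_anticommute[OF e e] one_forms_anticommute[OF f f]; simp)+

lemma monomial_mult: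
  assumes "finite K" "finite L" "finite K'" "finite L'"
  shows "(ordprod e K * ordprod f L) * (ordprod e K' * ordprod f L') =
    (if K \<inter> K' = {} \<and> L \<inter> L' = {}
     then cst (wedge_sign K L K' L') * (ordprod e (K \<union> K') * ordprod f (L \<union> L')) else 0)"
proof -
  have "ordprod f L * ordprod e K' = cst ((-1) ^ (card L * card K')) * (ordprod e K' * ordprod f L)"
    using supercommute[OF ordprod_forms[OF e assms(3)] ordprod_forms[OF f assms(2)]]
    by (simp add: mult.commute)
  then have "(ordprod e K * ordprod f L) * (ordprod e K' * ordprod f L') =
      cst ((-1) ^ (card L * card K')) * ((ordprod e K * ordprod e K') * (ordprod f L * ordprod f L'))"
    by (metis (no_types, lifting) mult.assoc cst_left_commute)
  then show ?thesis
    unfolding ordprod_mult[where e = e, OF ac(1) assms(1,3)] ordprod_mult[where e = f, OF ac(2) assms(2,4)]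
    by (auto simp: cst_mult_cst_mult cst_mult_assoc wedge_sign_def mult.assoc[where 'a = complex])
qed

lemma hom_add: "ext_hom n e f (a + b) = ext_hom n e f a + ext_hom n e f b"
  by (simp add: ext_hom_def cst_add distrib_right sum.distrib)

lemma hom_cst_mult: "ext_hom n e f (cst c * a) = cst c * ext_hom n e f a"
  by (simp add: ext_hom_def sum_distrib_left cst_mult_assoc)

lemma hom_zero: "ext_hom n e f 0 = 0"
  by (simp add: ext_hom_def)

lemma hom_sum: "ext_hom n e f (\<Sum>x\<in>A. g x) = (\<Sum>x\<in>A. ext_hom n e f (g x))"
  by (induction A rule: infinite_finite_induct) (simp_all add: hom_zero hom_add)

lemma hom_dl:
  assumes "K \<subseteq> {..<n}" "L \<subseteq> {..<n}"
  shows "ext_hom n e f (dl K L) = ordprod e K * ordprod f L"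
proof -
  have fin: "finite K" "finite L" using assms finite_subset by auto
  have "ext_hom n e f (dl K L) = (\<Sum>K'\<in>Pow {..<n}. \<Sum>L'\<in>Pow {..<n}.
      if K' = K \<and> L' = L then ordprod e K' * ordprod f L' else 0)"
    unfolding ext_hom_def cf_dl[OF fin] by (intro sum.cong refl) auto
  then show ?thesis using assms by (simp add: sum_Pow_Pow_delta)
qed

lemma hom_one: "ext_hom n e f 1 = 1"
  using hom_dl[of "{}" "{}"] by (simp add: dl_empty)

text \<open>The image of the product is a sum over disjoint pairs of index sets, the product of the
  images one over all pairs; overlapping pairs contribute nothing by \<open>monomial_mult\<close>,
  and disjoint ones carry the same \<open>wedge_sign\<close>.\<close>

lemma hom_mult: "ext_hom n e f (a * b) = ext_hom n e f a * ext_hom n e f b"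
proof -
  let ?N = "Pow {..<n}"
  define G where "G K K' L L' = cst (wedge_sign K L K' L' * cf a K L * cf b K' L') *
    (ordprod e (K \<union> K') * ordprod f (L \<union> L'))" for K K' L L'
  have fin: "K \<in> ?N \<Longrightarrow> finite K" for K using finite_subset by auto
  have "ext_hom n e f (a * b) = (\<Sum>I\<in>?N. \<Sum>J\<in>?N. \<Sum>K\<in>Pow I. \<Sum>L\<in>Pow J. G K (I - K) L (J - L))"
    unfolding ext_hom_def cf_mult cst_sum sum_distrib_right G_def
    by (intro sum.cong refl) (auto simp: Un_absorb1)
  also have "\<dots> = (\<Sum>I\<in>?N. \<Sum>K\<in>Pow I. \<Sum>J\<in>?N. \<Sum>L\<in>Pow J. G K (I - K) L (J - L))"
    by (intro sum.cong refl sum.swap)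
  also have "\<dots> = (\<Sum>K\<in>?N. \<Sum>K'\<in>Pow ({..<n} - K). \<Sum>J\<in>?N. \<Sum>L\<in>Pow J. G K K' L (J - L))"
    by (rule sum_Pow_Pow_diff) simp
  also have "\<dots> = (\<Sum>K\<in>?N. \<Sum>K'\<in>Pow ({..<n} - K). \<Sum>L\<in>?N. \<Sum>L'\<in>Pow ({..<n} - L). G K K' L L')"
    by (intro sum.cong refl sum_Pow_Pow_diff) simp
  also have "\<dots> = (\<Sum>K\<in>?N. \<Sum>K'\<in>?N. \<Sum>L\<in>?N. \<Sum>L'\<in>?N.
      if K \<inter> K' = {} \<and> L \<inter> L' = {} then G K K' L L' else 0)"
  proof (rule sum.cong[OF refl])
    fix K assume "K \<in> ?N"
    have "(\<Sum>K'\<in>Pow ({..<n} - K). \<Sum>L\<in>?N. \<Sum>L'\<in>Pow ({..<n} - L). G K K' L L') =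
        (\<Sum>K'\<in>Pow ({..<n} - K). \<Sum>L\<in>?N. \<Sum>L'\<in>?N. if K \<inter> K' = {} \<and> L \<inter> L' = {} then G K K' L L' else 0)"
      by (intro sum.cong refl sum.mono_neutral_cong_left) auto
    also have "\<dots> = (\<Sum>K'\<in>?N. \<Sum>L\<in>?N. \<Sum>L'\<in>?N. if K \<inter> K' = {} \<and> L \<inter> L' = {} then G K K' L L' else 0)"
    proof (rule sum.mono_neutral_left)
      show "\<forall>K'\<in>?N - Pow ({..<n} - K). (\<Sum>L\<in>?N. \<Sum>L'\<in>?N.
          if K \<inter> K' = {} \<and> L \<inter> L' = {} then G K K' L L' else 0) = 0"
      proof
        fix K' assume "K' \<in> ?N - Pow ({..<n} - K)"
        then have "K \<inter> K' \<noteq> {}" by auto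
        then show "(\<Sum>L\<in>?N. \<Sum>L'\<in>?N.
          if K \<inter> K' = {} \<and> L \<inter> L' = {} then G K K' L L' else 0) = 0" by simp
      qed
    qed auto
    finally show "(\<Sum>K'\<in>Pow ({..<n} - K). \<Sum>L\<in>?N. \<Sum>L'\<in>Pow ({..<n} - L). G K K' L L') = \<dots>" .
  qed
  also have "\<dots> = (\<Sum>K\<in>?N. \<Sum>K'\<in>?N. \<Sum>L\<in>?N. \<Sum>L'\<in>?N.
      (cst (cf a K L) * (ordprod e K * ordprod f L)) * (cst (cf b K' L') * (ordprod e K' * ordprod f L')))"
  proof (intro sum.cong refl)
    fix K K' L L' assume "K \<in> ?N" "K' \<in> ?N" "L \<in> ?N" "L' \<in> ?N"
    note mm = monomial_mult[OF this(1,3,2,4)[THEN fin]]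
    have "(cst (cf a K L) * (ordprod e K * ordprod f L)) * (cst (cf b K' L') * (ordprod e K' * ordprod f L')) =
        cst (cf a K L * cf b K' L') * ((ordprod e K * ordprod f L) * (ordprod e K' * ordprod f L'))"
      by (rule cst_mult_cst_mult)
    then show "(if K \<inter> K' = {} \<and> L \<inter> L' = {} then G K K' L L' else 0) =
        (cst (cf a K L) * (ordprod e K * ordprod f L)) * (cst (cf b K' L') * (ordprod e K' * ordprod f L'))"
      unfolding mm by (simp add: G_def cst_mult_assoc mult_ac)
  qed
  also have "\<dots> = (\<Sum>K\<in>?N. \<Sum>L\<in>?N. \<Sum>K'\<in>?N. \<Sum>L'\<in>?N.
      (cst (cf a K L) * (ordprod e K * ordprod f L)) * (cst (cf b K' L') * (ordprod e K' * ordprod f L')))"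
    by (intro sum.cong refl sum.swap)
  also have "\<dots> = ext_hom n e f a * ext_hom n e f b"
    by (simp only: ext_hom_def sum_distrib_right) (simp only: sum_distrib_left)
  finally show ?thesis .
qed

lemma hom_prod_list: "ext_hom n e f (prod_list xs) = prod_list (map (ext_hom n e f) xs)"
  by (induction xs) (simp_all add: hom_one hom_mult)

lemma hom_forms:
  assumes "cf a \<in> forms n p q"
  shows "cf (ext_hom n e f a) \<in> forms n p q"
  unfolding ext_hom_def
proof (intro forms_sum)
  fix K L assume "K \<in> Pow {..<n}" "L \<in> Pow {..<n}"
  then have fin: "finite K" "finite L" using finite_subset by auto
  show "cf (cst (cf a K L) * (ordprod e K * ordprod f L)) \<in> forms n p q"
  proof (cases "cf a K L = 0")
    case True
    then show ?thesis by (simp add: forms_zero)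
  next
    case False
    then have "card K = p" "card L = q" using assms by (auto simp: forms_def)
    then show ?thesis
      using forms_mult[OF ordprod_forms[OF e fin(1)] ordprod_forms[OF f fin(2)]]
      by (intro forms_cst_mult) simp
  qed
qed

end

section \<open>Linear changes of coordinates\<close>

definition lin :: "nat \<Rightarrow> (nat \<Rightarrow> complex) \<Rightarrow> ext" where
  "lin n v = (\<Sum>i<n. cst (v i) * dl {i} {})"

definition conjlin :: "nat \<Rightarrow> (nat \<Rightarrow> complex) \<Rightarrow> ext" where
  "conjlin n v = (\<Sum>i<n. cst (v i) * dl {} {i})"

lemma lin_forms: "cf (lin n v) \<in> forms n 1 0"
  unfolding lin_def by (intro forms_sum forms_cst_mult) (auto simp: forms_def cf_dl split: if_splits)

lemma conjlin_forms: "cf (conjlin n v) \<in> forms n 0 1"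
  unfolding conjlin_def by (intro forms_sum forms_cst_mult) (auto simp: forms_def cf_dl split: if_splits)

text \<open>Pull-back along the linear map with matrix \<open>P\<close>: the differential
  \<open>dx_l\<close> becomes the differential of the coordinate given by row
  \<open>l\<close>.\<close>

definition pull :: "nat \<Rightarrow> (nat \<Rightarrow> nat \<Rightarrow> complex) \<Rightarrow> ext \<Rightarrow> ext" where
  "pull n P = ext_hom n (\<lambda>l. lin n (P l)) (\<lambda>l. conjlin n (\<lambda>i. cnj (P l i)))"

interpretation pull: coframe n "\<lambda>l. lin n (P l)" "\<lambda>l. conjlin n (\<lambda>i. cnj (P l i))"
  rewrites "ext_hom n (\<lambda>l. lin n (P l)) (\<lambda>l. conjlin n (\<lambda>i. cnj (P l i))) = pull n P"
  for n P
  by unfold_locales (simp_all only: lin_forms conjlin_forms pull_def)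

lemma pull_cst [simp]: "pull n P (cst c) = cst c"
  using pull.hom_cst_mult[of n P c 1] by (simp add: pull.hom_one)

lemma ordprod_singleton [simp]: "ordprod e {i} = e i"
  by (simp add: ordprod_def)

lemma pull_lin: "pull n P (lin n v) = lin n (\<lambda>j. \<Sum>l<n. v l * P l j)"
proof -
  have "pull n P (lin n v) = (\<Sum>l<n. cst (v l) * lin n (P l))"
    unfolding lin_def[of n v] pull.hom_sum pull.hom_cst_mult
    by (intro sum.cong refl) (simp add: pull.hom_dl)
  also have "\<dots> = (\<Sum>l<n. \<Sum>j<n. cst (v l * P l j) * dl {j} {})"
    by (simp add: lin_def sum_distrib_left cst_mult_assoc)
  also have "\<dots> = (\<Sum>j<n. \<Sum>l<n. cst (v l * P l j) * dl {j} {})" by (rule sum.swap)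
  also have "\<dots> = lin n (\<lambda>j. \<Sum>l<n. v l * P l j)"
    by (simp add: lin_def cst_sum sum_distrib_right)
  finally show ?thesis .
qed

lemma pull_conjlin: "pull n P (conjlin n v) = conjlin n (\<lambda>j. \<Sum>l<n. v l * cnj (P l j))"
proof -
  have "pull n P (conjlin n v) = (\<Sum>l<n. cst (v l) * conjlin n (\<lambda>i. cnj (P l i)))"
    unfolding conjlin_def[of n v] pull.hom_sum pull.hom_cst_mult
    by (intro sum.cong refl) (simp add: pull.hom_dl)
  also have "\<dots> = (\<Sum>l<n. \<Sum>j<n. cst (v l * cnj (P l j)) * dl {} {j})"
    by (simp add: conjlin_def sum_distrib_left cst_mult_assoc)
  also have "\<dots> = (\<Sum>j<n. \<Sum>l<n. cst (v l * cnj (P l j)) * dl {} {j})" by (rule sum.swap)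
  also have "\<dots> = conjlin n (\<lambda>j. \<Sum>l<n. v l * cnj (P l j))"
    by (simp add: conjlin_def cst_sum sum_distrib_right)
  finally show ?thesis .
qed

lemma lin_delta:
  assumes "i < n" "\<And>j. j < n \<Longrightarrow> v j = (if i = j then 1 else 0)"
  shows "lin n v = dl {i} {}" "conjlin n v = dl {} {i}"
proof -
  have "lin n v = (\<Sum>j<n. if j = i then dl {i} {} else 0)"
    "conjlin n v = (\<Sum>j<n. if j = i then dl {} {i} else 0)"
    unfolding lin_def conjlin_def by (intro sum.cong refl; simp add: assms(2))+
  then show "lin n v = dl {i} {}" "conjlin n v = dl {} {i}" using assms(1) by simp_all
qed

lemma ordprod_dl:
  assumes "finite K"
  shows "ordprod (\<lambda>i. dl {i} {}) K = dl K {}" "ordprod (\<lambda>i. dl {} {i}) K = dl {} K"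
  using assms
proof (induction K rule: finite_linorder_min_induct)
  case (insert b A)
  have "b \<notin> A" "shuffle_sign {b} A = 1"
    using insert.hyps(2) by (auto intro!: shuffle_sign_below)
  then show "ordprod (\<lambda>i. dl {i} {}) (insert b A) = dl (insert b A) {}"
    "ordprod (\<lambda>i. dl {} {i}) (insert b A) = dl {} (insert b A)"
    using insert by (simp_all add: ordprod_insert_min dl_mult_dl wedge_sign_def)
qed (simp_all add: dl_empty)

lemma dl_split: "finite K \<Longrightarrow> finite L \<Longrightarrow> dl K {} * dl {} L = dl K L"
  by (simp add: dl_mult_dl wedge_sign_def)

definition inverse_matrices :: "nat \<Rightarrow> (nat \<Rightarrow> nat \<Rightarrow> complex) \<Rightarrow> (nat \<Rightarrow> nat \<Rightarrow> complex) \<Rightarrow> bool" where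
  "inverse_matrices n P Q \<longleftrightarrow> (\<forall>a<n. \<forall>b<n.
     (\<Sum>m<n. P a m * Q m b) = (if a = b then 1 else 0) \<and>
     (\<Sum>m<n. Q a m * P m b) = (if a = b then 1 else 0))"

lemma inverse_matrices_sym: "inverse_matrices n P Q \<longleftrightarrow> inverse_matrices n Q P"
  by (auto simp: inverse_matrices_def)

lemma ordprod_cong: "(\<And>i. i \<in> K \<Longrightarrow> e i = e' i) \<Longrightarrow> finite K \<Longrightarrow> ordprod e K = ordprod e' K"
  by (auto simp: ordprod_def intro!: arg_cong[of _ _ prod_list])

text \<open>Pull-back is contravariant, so the substitution is by the rows of \<open>Q P\<close>.
  Support in the first \<open>n\<close> coordinates ensures that no coefficient is dropped.\<close>

lemma pull_pull:
  assumes "inverse_matrices n P Q" "supported n a"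
  shows "pull n P (pull n Q a) = a"
proof -
  have QP: "(\<Sum>m<n. Q i m * P m j) = (if i = j then 1 else 0)" if "i < n" "j < n" for i j
    using assms(1) that by (simp add: inverse_matrices_def)
  have QPc: "(\<Sum>m<n. cnj (Q i m) * cnj (P m j)) = (if i = j then 1 else 0)" if "i < n" "j < n" for i j
    using arg_cong[OF QP[OF that], of cnj] by simp
  have op: "pull n P (ordprod e K) = ordprod (\<lambda>i. pull n P (e i)) K" for e K
    by (simp add: ordprod_def pull.hom_prod_list comp_def)
  have "pull n P (pull n Q a) = (\<Sum>K\<in>Pow {..<n}. \<Sum>L\<in>Pow {..<n}. cst (cf a K L) * dl K L)"
    unfolding pull_def[of n Q] ext_hom_def pull.hom_sum pull.hom_cst_mult pull.hom_mult op
  proof (intro sum.cong refl arg_cong2[of _ _ _ _ "(*)"])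
    fix K L assume "K \<in> Pow {..<n}" "L \<in> Pow {..<n}"
    then have KL: "K \<subseteq> {..<n}" "L \<subseteq> {..<n}" and fin: "finite K" "finite L"
      using finite_subset by auto
    have "ordprod (\<lambda>i. pull n P (lin n (Q i))) K = ordprod (\<lambda>i. dl {i} {}) K"
      using KL QP fin by (intro ordprod_cong) (auto simp: pull_lin intro!: lin_delta(1))
    moreover have "ordprod (\<lambda>i. pull n P (conjlin n (\<lambda>j. cnj (Q i j)))) L = ordprod (\<lambda>i. dl {} {i}) L"
      using KL QPc fin by (intro ordprod_cong) (auto simp: pull_conjlin intro!: lin_delta(2))
    ultimately show "ordprod (\<lambda>i. pull n P (lin n (Q i))) K *
        ordprod (\<lambda>i. pull n P (conjlin n (\<lambda>j. cnj (Q i j)))) L = dl K L"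
      using fin by (simp add: ordprod_dl dl_split)
  qed simp
  also have "\<dots> = a" by (rule supported_expansion[OF assms(2), symmetric])
  finally show ?thesis .
qed

section \<open>Complex conjugation\<close>

lift_definition cj :: "ext \<Rightarrow> ext" is conj_form
  by (auto simp: conj_form_def)

lemma cf_cj: "cf (cj a) I J = (-1) ^ (card I * card J) * cnj (cf a J I)"
  by (simp add: cj.rep_eq conj_form_def)

lemma cj_cj [simp]: "cj (cj a) = a"
proof (rule ext_eqI)
  fix I J :: "nat set"
  have "(-1 :: complex) ^ (card I * card J) * (-1) ^ (card I * card J) = 1"
    by (simp add: power_mult_distrib[symmetric])
  then show "cf (cj (cj a)) I J = cf a I J"
    by (simp add: cf_cj mult.commute[of "card J"] mult.assoc[symmetric])
qed

lemma cj_add: "cj (a + b) = cj a + cj b"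
  by (rule ext_eqI) (simp add: cf_cj algebra_simps)

lemma cj_zero [simp]: "cj 0 = 0"
  by (rule ext_eqI) (simp add: cf_cj)

lemma cj_sum: "cj (\<Sum>x\<in>A. f x) = (\<Sum>x\<in>A. cj (f x))"
  by (induction A rule: infinite_finite_induct) (simp_all add: cj_add)

lemma cj_cst_mult: "cj (cst c * a) = cst (cnj c) * cj a"
  by (rule ext_eqI) (simp add: cf_cj)

lemma cj_one [simp]: "cj 1 = 1"
  by (rule ext_eqI) (auto simp: cf_cj one_ext.rep_eq unit_form_def)

lemma cj_cst [simp]: "cj (cst c) = cst (cnj c)"
  using cj_cst_mult[of c 1] by simp

lemma cj_forms:
  assumes "cf a \<in> forms n p q"
  shows "cf (cj a) \<in> forms n q p"
  unfolding forms_def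
proof (intro CollectI allI impI)
  fix I J assume "cf (cj a) I J \<noteq> 0"
  then have "cf a J I \<noteq> 0" by (simp add: cf_cj)
  then show "I \<subseteq> {..<n} \<and> card I = q \<and> J \<subseteq> {..<n} \<and> card J = p"
    using formsD[OF assms] by blast
qed

lemma cj_mult: "cj (a * b) = cj a * cj b"
proof (rule ext_eqI)
  fix I J :: "nat set" assume fin: "finite I" "finite J"
  have "cf (cj (a * b)) I J = (\<Sum>J1\<in>Pow J. \<Sum>I1\<in>Pow I. (-1) ^ (card I * card J) *
      (wedge_sign J1 I1 (J - J1) (I - I1) * cnj (cf a J1 I1) * cnj (cf b (J - J1) (I - I1))))"
    by (simp add: cf_cj cf_mult sum_distrib_left wedge_sign_def)
  also have "\<dots> = (\<Sum>I1\<in>Pow I. \<Sum>J1\<in>Pow J. (-1) ^ (card I * card J) *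
      (wedge_sign J1 I1 (J - J1) (I - I1) * cnj (cf a J1 I1) * cnj (cf b (J - J1) (I - I1))))"
    by (rule sum.swap)
  also have "\<dots> = cf (cj a * cj b) I J"
    unfolding cf_mult
  proof (intro sum.cong refl)
    fix I1 J1 assume "I1 \<in> Pow I" "J1 \<in> Pow J"
    then have "card I = card I1 + card (I - I1)" "card J = card J1 + card (J - J1)"
      using fin by (auto simp: card_Diff_subset finite_subset card_mono)
    \<comment> \<open>Expanding \<open>card I * card J\<close> gives four products. One mixed
      product is the sign in the target \<open>wedge_sign\<close>; the other occurs twice and
      cancels.\<close>
    then have s: "(-1 :: complex) ^ (card I * card J) * wedge_sign J1 I1 (J - J1) (I - I1) =
        wedge_sign I1 J1 (I - I1) (J - J1) *
        ((-1) ^ (card I1 * card J1) * (-1) ^ (card (I - I1) * card (J - J1))) *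
        ((-1) ^ (card I1 * card (J - J1)) * (-1) ^ (card I1 * card (J - J1)))"
      by (simp only: wedge_sign_def distrib_left distrib_right power_add) (simp add: mult_ac)
    have "(-1 :: complex) ^ (card I1 * card (J - J1)) * (-1) ^ (card I1 * card (J - J1)) = 1"
      by (simp add: power_mult_distrib[symmetric])
    then show "(-1) ^ (card I * card J) *
      (wedge_sign J1 I1 (J - J1) (I - I1) * cnj (cf a J1 I1) * cnj (cf b (J - J1) (I - I1))) =
      wedge_sign I1 J1 (I - I1) (J - J1) * cf (cj a) I1 J1 * cf (cj b) (I - I1) (J - J1)"
      using s by (simp add: cf_cj mult_ac)
  qed
  finally show "cf (cj (a * b)) I J = cf (cj a * cj b) I J" .
qed

lemma cj_prod_list: "cj (prod_list xs) = prod_list (map cj xs)"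
  by (induction xs) (simp_all add: cj_mult)

lemma cj_dl: "finite K \<Longrightarrow> finite L \<Longrightarrow> cj (dl K L) = cst ((-1) ^ (card K * card L)) * dl L K"
  by (rule ext_eqI) (auto simp: cf_cj cf_dl mult.commute)

lemma cj_lin: "cj (lin n v) = conjlin n (\<lambda>i. cnj (v i))"
  by (simp add: lin_def conjlin_def cj_sum cj_cst_mult cj_dl)

lemma cj_conjlin: "cj (conjlin n v) = lin n (\<lambda>i. cnj (v i))"
  by (simp add: lin_def conjlin_def cj_sum cj_cst_mult cj_dl)

text \<open>Conjugation exchanges the two coframes, and the sign for restoring their order is the
  one in \<open>conj_form\<close>.\<close>

lemma cj_pull: "cj (pull n P a) = pull n P (cj a)"
proof -
  let ?e = "\<lambda>l. lin n (P l)" and ?f = "\<lambda>l. conjlin n (\<lambda>i. cnj (P l i))"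
  have co: "cj (ordprod ?e K) = ordprod ?f K" "cj (ordprod ?f K) = ordprod ?e K" for K
    by (simp_all add: ordprod_def cj_prod_list comp_def cj_lin cj_conjlin)
  have "cj (pull n P a) = (\<Sum>K\<in>Pow {..<n}. \<Sum>L\<in>Pow {..<n}. cst (cnj (cf a K L)) * (ordprod ?f K * ordprod ?e L))"
    by (simp add: pull_def ext_hom_def cj_sum cj_cst_mult cj_mult co)
  also have "\<dots> = (\<Sum>K\<in>Pow {..<n}. \<Sum>L\<in>Pow {..<n}. cst (cf (cj a) L K) * (ordprod ?e L * ordprod ?f K))"
  proof (intro sum.cong refl)
    fix K L assume "K \<in> Pow {..<n}" "L \<in> Pow {..<n}"
    then have fin: "finite K" "finite L" using finite_subset by auto
    show "cst (cnj (cf a K L)) * (ordprod ?f K * ordprod ?e L) =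
        cst (cf (cj a) L K) * (ordprod ?e L * ordprod ?f K)"
      using supercommute[OF ordprod_forms[where e = ?e, OF lin_forms fin(2)]
          ordprod_forms[where e = ?f, OF conjlin_forms fin(1)]]
      by (simp add: cf_cj cst_mult_assoc mult.commute)
  qed
  also have "\<dots> = pull n P (cj a)"
    unfolding pull_def ext_hom_def by (rule sum.swap)
  finally show ?thesis .
qed

subsection \<open>Coordinate areas and diagonal forms\<close>

definition area :: "nat \<Rightarrow> (nat \<Rightarrow> complex) \<Rightarrow> ext" where
  "area n v = cst (\<i> / 2) * (lin n v * conjlin n (\<lambda>i. cnj (v i)))"

lemma area_forms: "cf (area n v) \<in> forms n 1 1"
  using forms_mult[OF lin_forms conjlin_forms] unfolding area_def by (intro forms_cst_mult) simp

lemma cj_area: "cj (area n v) = area n v"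
proof -
  have "conjlin n (\<lambda>i. cnj (v i)) * lin n v = - (lin n v * conjlin n (\<lambda>i. cnj (v i)))"
    by (rule one_forms_anticommute[OF conjlin_forms lin_forms]) auto
  then show ?thesis
    by (simp add: area_def cj_cst_mult cj_mult cj_lin cj_conjlin cst_minus[of "\<i> / 2", simplified])
qed

lemma pull_area: "pull n P (area n v) = area n (\<lambda>j. \<Sum>l<n. v l * P l j)"
  by (simp add: area_def pull.hom_cst_mult pull.hom_mult pull_lin pull_conjlin)

lemma cf_lin: "cf (lin n (\<lambda>i. P $$ (l, i))) = coord_diff n P l"
proof (intro ext)
  fix I J
  show "cf (lin n (\<lambda>i. P $$ (l, i))) I J = coord_diff n P l I J"
    unfolding lin_def coord_diff_def cf_sum cf_cst_mult
    by (intro sum.cong refl) (simp add: cf_dl)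
qed

lemma cf_area: "cf (area n (\<lambda>i. P $$ (l, i))) = coord_area n P l"
  unfolding area_def coord_area_def cf_lin[symmetric] cj.rep_eq[symmetric] cj_lin times_ext.rep_eq[symmetric]
  by (intro ext) (simp only: cf_cst_mult)

text \<open>Equal to \<open>(\<i> / 2)^m * (-1)^(m * (m - 1) / 2)\<close>, the coefficient of
  \<open>dx_S \<and> d(cnj x)_S\<close> in the product of the \<open>m\<close> areas of
  \<open>S\<close>. A further \<open>dx_l\<close> has to cross \<open>m\<close> conjugate
  differentials, which gives \<open>(-1) ^ m\<close>.\<close>

fun area_const :: "nat \<Rightarrow> complex" where
  "area_const 0 = 1"
| "area_const (Suc m) = area_const m * (\<i> / 2) * (-1) ^ m"

lemma area_const_add: "area_const (l + m) = area_const l * area_const m * (-1) ^ (l * m)"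
  by (induction m) (simp_all add: power_add)

lemma area_const_nonzero [simp]: "area_const m \<noteq> 0"
  by (induction m) auto

lemma cnj_area_const: "cnj (area_const m) = (-1) ^ (m * m) * area_const m"
proof (induction m)
  case (Suc m)
  have "(-1 :: complex) ^ (Suc m * Suc m) = - ((-1) ^ (m * m))"
    by (simp add: power_add)
  then show ?case using Suc by simp
qed simp

text \<open>The constant \<^const>\<open>area_const\<close> makes the product of diagonal forms free of signs.\<close>

lift_definition diag :: "nat \<Rightarrow> (nat set \<Rightarrow> complex) \<Rightarrow> ext" is
  "\<lambda>n c I J. if I = J \<and> I \<subseteq> {..<n} then area_const (card I) * c I else 0"
  using finite_subset[OF _ finite_lessThan] by auto

lemma cf_diag: "cf (diag n c) I J = (if I = J \<and> I \<subseteq> {..<n} then area_const (card I) * c I else 0)"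
  by (simp add: diag.rep_eq)

text \<open>Multiplication in the commutative algebra with basis \<open>V_S\<close>, where
  \<open>V_S V_T\<close> is \<open>V_{S \<union> T}\<close> for disjoint sets and 0
  otherwise.\<close>

definition set_conv :: "(nat set \<Rightarrow> complex) \<Rightarrow> (nat set \<Rightarrow> complex) \<Rightarrow> nat set \<Rightarrow> complex" where
  "set_conv c d S = (\<Sum>A\<in>Pow S. c A * d (S - A))"

lemma diag_cong: "(\<And>S. S \<subseteq> {..<n} \<Longrightarrow> c S = d S) \<Longrightarrow> diag n c = diag n d"
  by (rule ext_eqI) (auto simp: cf_diag)

lemma diag_mult: "diag n c * diag n d = diag n (set_conv c d)"
proof (rule ext_eqI)
  fix I J :: "nat set" assume fin: "finite I" "finite J"
  show "cf (diag n c * diag n d) I J = cf (diag n (set_conv c d)) I J"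
  proof (cases "I = J \<and> I \<subseteq> {..<n}")
    case False
    have "cf (diag n c) I1 J1 * cf (diag n d) (I - I1) (J - J1) = 0"
      if "I1 \<in> Pow I" "J1 \<in> Pow J" for I1 J1
    proof (rule ccontr)
      assume "cf (diag n c) I1 J1 * cf (diag n d) (I - I1) (J - J1) \<noteq> 0"
      then have "I1 = J1" "I1 \<subseteq> {..<n}" "I - I1 = J - J1" "I - I1 \<subseteq> {..<n}"
        by (auto simp: cf_diag split: if_splits)
      then have "I = J \<and> I \<subseteq> {..<n}" using that by auto
      with False show False by blast
    qed
    then have "cf (diag n c * diag n d) I J = 0"
      unfolding cf_mult by (intro sum.neutral ballI) (simp add: mult.assoc)
    moreover have "cf (diag n (set_conv c d)) I J = 0"
      unfolding cf_diag by (rule if_not_P[OF False])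
    ultimately show ?thesis by simp
  next
    case True
    have "cf (diag n c * diag n d) I J = (\<Sum>I1\<in>Pow I. \<Sum>J1\<in>Pow I. if J1 = I1 then
        area_const (card I) * (c I1 * d (I - I1)) else 0)"
      unfolding cf_mult using True
    proof (simp only:, intro sum.cong refl)
      fix I1 J1 assume "I1 \<in> Pow J" "J1 \<in> Pow J"
      then have sub: "I1 \<subseteq> J" "J1 \<subseteq> J" by auto
      have "card J = card I1 + card (J - I1)"
        using sub fin by (auto simp: card_Diff_subset finite_subset card_mono)
      then have ac: "area_const (card J) = area_const (card I1) * area_const (card (J - I1)) *
          (-1) ^ (card I1 * card (J - I1))"
        by (simp only: area_const_add)
      show "wedge_sign I1 J1 (J - I1) (J - J1) * cf (diag n c) I1 J1 * cf (diag n d) (J - I1) (J - J1) =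
          (if J1 = I1 then area_const (card J) * (c I1 * d (J - I1)) else 0)"
        using True sub unfolding ac by (auto simp: cf_diag wedge_sign_def mult_ac)
    qed
    also have "\<dots> = area_const (card I) * set_conv c d I"
      using fin by (simp add: set_conv_def sum_distrib_left)
    finally show ?thesis using conjunct1[OF True] conjunct2[OF True] by (simp add: cf_diag)
  qed
qed

lemma diag_forms: "(\<And>S. c S \<noteq> 0 \<Longrightarrow> card S = k) \<Longrightarrow> cf (diag n c) \<in> forms n k k"
  by (auto simp: forms_def cf_diag split: if_splits)

lemma cj_diag:
  assumes "\<And>S. S \<subseteq> {..<n} \<Longrightarrow> cnj (c S) = c S"
  shows "cj (diag n c) = diag n c"
proof -
  have "(-1 :: complex) ^ (m * m) * (-1) ^ (m * m) = 1" for m :: nat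
    by (simp add: power_mult_distrib[symmetric])
  then show ?thesis
    by (intro ext_eqI) (auto simp: cf_cj cf_diag cnj_area_const assms mult.assoc[symmetric])
qed

text \<open>Encodes the (1,1)-form that combines the areas \<open>V_l\<close> with coefficients
  \<open>g l\<close>; the sum merely extracts the element of a one-element set.\<close>

definition singleton_fun :: "(nat \<Rightarrow> complex) \<Rightarrow> nat set \<Rightarrow> complex" where
  "singleton_fun g S = (\<Sum>l\<in>S. if S = {l} then g l else 0)"

lemma singleton_fun_simps [simp]:
  "singleton_fun g {l} = g l" "(\<And>l. S \<noteq> {l}) \<Longrightarrow> singleton_fun g S = 0"
  by (simp_all add: singleton_fun_def)

lemma area_delta:
  assumes "l < n"
  shows "area n (\<lambda>j. if l = j then 1 else 0) = diag n (\<lambda>S. if S = {l} then 1 else 0)"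
proof -
  have "area n (\<lambda>j. if l = j then 1 else 0) = cst (\<i> / 2) * dl {l} {l}"
    using lin_delta[OF assms, of "\<lambda>j. if l = j then 1 else 0"]
    by (simp add: area_def dl_split if_distrib[of cnj] cong: if_cong)
  also have "\<dots> = diag n (\<lambda>S. if S = {l} then 1 else 0)"
    using assms by (intro ext_eqI) (auto simp: cf_diag cf_dl)
  finally show ?thesis .
qed

lemma diag_singleton_fun:
  "(\<Sum>l<n. cst (g l) * area n (\<lambda>j. if l = j then 1 else 0)) = diag n (singleton_fun g)"
proof (rule ext_eqI)
  fix I J :: "nat set" assume fin: "finite I" "finite J"
  have "cf (\<Sum>l<n. cst (g l) * area n (\<lambda>j. if l = j then 1 else 0)) I J =
      (\<Sum>l<n. g l * (if I = J \<and> I \<subseteq> {..<n} then area_const (card I) * (if I = {l} then 1 else 0) else 0))"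
    unfolding cf_sum by (intro sum.cong refl) (simp add: area_delta cf_diag)
  also have "\<dots> = cf (diag n (singleton_fun g)) I J"
  proof (cases "I = J \<and> (\<exists>l<n. I = {l})")
    case True
    then obtain l where l: "I = {l}" "J = {l}" "l < n" by blast
    have "(\<Sum>m<n. g m * (if I = J \<and> I \<subseteq> {..<n} then area_const (card I) * (if I = {m} then 1 else 0) else 0))
        = (\<Sum>m<n. if m = l then area_const (card I) * g l else 0)"
      using l by (intro sum.cong) auto
    then show ?thesis using l by (simp add: cf_diag)
  next
    case False
    then have z: "g m * (if I = J \<and> I \<subseteq> {..<n} then area_const (card I) * (if I = {m} then 1 else 0) else 0) = 0"
      if "m < n" for m using that by auto
    moreover have "cf (diag n (singleton_fun g)) I J = 0"
      using False by (auto simp: cf_diag singleton_fun_def intro!: sum.neutral)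
    ultimately show ?thesis by (auto intro!: sum.neutral z simp del: mult_eq_0_iff)
  qed
  finally show "cf (\<Sum>l<n. cst (g l) * area n (\<lambda>j. if l = j then 1 else 0)) I J =
    cf (diag n (singleton_fun g)) I J" .
qed

section \<open>Determinants and Lefschetz maps\<close>

lemma bijections_zero: "bijections 0 S = (if S = {} then {\<lambda>_. undefined} else {})"
  by (auto simp: bijections_def bij_betw_def)

lemma sum_Pow_singletons:
  fixes f :: "'a set \<Rightarrow> 'b::comm_monoid_add"
  assumes "finite I" "\<And>A. A \<subseteq> I \<Longrightarrow> card A \<noteq> 1 \<Longrightarrow> f A = 0"
  shows "(\<Sum>A\<in>Pow I. f A) = (\<Sum>i\<in>I. f {i})"
proof -
  have "(\<Sum>A\<in>Pow I. f A) = (\<Sum>A\<in>(\<lambda>i. {i}) ` I. f A)"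
    by (rule sum.mono_neutral_right) (use assms in \<open>auto simp: card_1_singleton_iff image_iff\<close>)
  also have "\<dots> = (\<Sum>i\<in>I. f {i})" by (rule sum.reindex_cong[of "\<lambda>i. {i}"]) auto
  finally show ?thesis .
qed

text \<open>Splits by the value \<open>l\<close> at the last index \<open>k\<close>; what remains is
  a bijection onto \<open>S - {l}\<close>.\<close>

lemma sum_bijections_Suc:
  assumes "finite S"
  shows "(\<Sum>\<sigma>\<in>bijections (Suc k) S. \<Prod>a<Suc k. g a (\<sigma> a)) =
    (\<Sum>l\<in>S. (\<Sum>\<sigma>\<in>bijections k (S - {l}). \<Prod>a<k. g a (\<sigma> a)) * (g k l :: complex))"
proof -
  have "(\<Sum>l\<in>S. (\<Sum>\<sigma>\<in>bijections k (S - {l}). \<Prod>a<k. g a (\<sigma> a)) * g k l) =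
      (\<Sum>(l, \<sigma>)\<in>Sigma S (\<lambda>l. bijections k (S - {l})). (\<Prod>a<k. g a (\<sigma> a)) * g k l)"
    using assms by (subst sum.Sigma[symmetric]) (auto simp: finite_bijections sum_distrib_right)
  also have "\<dots> = (\<Sum>\<sigma>\<in>bijections (Suc k) S. \<Prod>a<Suc k. g a (\<sigma> a))"
  proof (rule sum.reindex_bij_witness[of _ "\<lambda>\<sigma>. (\<sigma> k, restrict \<sigma> {..<k})" "\<lambda>(l, \<sigma>). \<sigma>(k := l)"])
    fix x assume "x \<in> Sigma S (\<lambda>l. bijections k (S - {l}))"
    then obtain l \<sigma> where x: "x = (l, \<sigma>)" "l \<in> S" "\<sigma> \<in> bijections k (S - {l})" by auto
    then have ex: "\<sigma> \<in> extensional {..<k}" and bij: "bij_betw \<sigma> {..<k} (S - {l})"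
      by (auto simp: bijections_def PiE_def)
    have "restrict (\<sigma>(k := l)) {..<k} = \<sigma>"
      by (rule extensionalityI[of _ "{..<k}"]) (use ex in auto)
    then show "((case x of (l, \<sigma>) \<Rightarrow> \<sigma>(k := l)) k, restrict (case x of (l, \<sigma>) \<Rightarrow> \<sigma>(k := l)) {..<k}) = x"
      using x(1) by simp
    have "bij_betw (\<sigma>(k := l)) ({..<k} \<union> {k}) ((S - {l}) \<union> {l})"
    proof (rule bij_betw_combine)
      show "bij_betw (\<sigma>(k := l)) {..<k} (S - {l})"
        using bij by (subst bij_betw_cong[of _ _ \<sigma>]) auto
    qed auto
    moreover have "{..<k} \<union> {k} = {..<Suc k}" "(S - {l}) \<union> {l} = S" using x(2) by auto
    ultimately have "bij_betw (\<sigma>(k := l)) {..<Suc k} S" by simp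
    moreover have "\<sigma>(k := l) \<in> extensional {..<Suc k}"
      using ex by (auto simp: extensional_def)
    ultimately show "(case x of (l, \<sigma>) \<Rightarrow> \<sigma>(k := l)) \<in> bijections (Suc k) S"
      using x(1) by (auto simp: bijections_def PiE_def bij_betw_def)
    have "(\<Prod>a<k. g a ((\<sigma>(k := l)) a)) = (\<Prod>a<k. g a (\<sigma> a))" by (intro prod.cong) auto
    then show "(\<Prod>a<Suc k. g a ((case x of (l, \<sigma>) \<Rightarrow> \<sigma>(k := l)) a)) =
        (case x of (l, \<sigma>) \<Rightarrow> (\<Prod>a<k. g a (\<sigma> a)) * g k l)"
      using x(1) by simp
  next
    fix \<sigma> assume "\<sigma> \<in> bijections (Suc k) S"
    then have ex: "\<sigma> \<in> extensional {..<Suc k}" and bij: "bij_betw \<sigma> {..<Suc k} S"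
      by (auto simp: bijections_def PiE_def)
    show "(case (\<sigma> k, restrict \<sigma> {..<k}) of (l, \<sigma>) \<Rightarrow> \<sigma>(k := l)) = \<sigma>"
      by (rule extensionalityI[of _ "{..<Suc k}"]) (use ex in \<open>auto simp: extensional_def\<close>)
    have kS: "\<sigma> k \<in> S" using bij by (auto simp: bij_betw_def)
    have "bij_betw \<sigma> ({..<Suc k} - {k}) (S - {\<sigma> k})"
      using bij kS by (intro bij_betw_DiffI) (auto simp: bij_betw_def)
    moreover have "{..<Suc k} - {k} = {..<k}" by auto
    ultimately have "bij_betw (restrict \<sigma> {..<k}) {..<k} (S - {\<sigma> k})"
      by (subst bij_betw_cong[of _ _ \<sigma>]) auto
    then have "restrict \<sigma> {..<k} \<in> bijections k (S - {\<sigma> k})"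
      unfolding bijections_def by (simp add: PiE_def bij_betw_imp_funcset)
    then show "(\<sigma> k, restrict \<sigma> {..<k}) \<in> Sigma S (\<lambda>l. bijections k (S - {l}))"
      using kS by simp
  qed
  finally show ?thesis by simp
qed

text \<open>Areas square to zero, so \<open>V_S\<close> arises exactly when every element of
  \<open>S\<close> is contributed by one factor.\<close>

lemma prod_list_diag_singletons:
  "prod_list (map (\<lambda>a. diag n (singleton_fun (g a))) [0..<k]) =
    diag n (\<lambda>S. \<Sum>\<sigma>\<in>bijections k S. \<Prod>a<k. g a (\<sigma> a))"
proof (induction k)
  case 0
  show ?case
    by (rule ext_eqI) (auto simp: cf_diag one_ext.rep_eq unit_form_def bijections_zero)
next
  case (Suc k)
  let ?F = "\<lambda>S. \<Sum>\<sigma>\<in>bijections k S. \<Prod>a<k. g a (\<sigma> a)"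
  have "prod_list (map (\<lambda>a. diag n (singleton_fun (g a))) [0..<Suc k]) =
      diag n (set_conv ?F (singleton_fun (g k)))"
    by (simp add: Suc diag_mult)
  also have "\<dots> = diag n (\<lambda>S. \<Sum>\<sigma>\<in>bijections (Suc k) S. \<Prod>a<Suc k. g a (\<sigma> a))"
  proof (rule diag_cong)
    fix S assume "S \<subseteq> {..<n}"
    then have fin: "finite S" using finite_subset by auto
    have "set_conv ?F (singleton_fun (g k)) S = (\<Sum>A\<in>Pow S. ?F (S - A) * singleton_fun (g k) A)"
      unfolding set_conv_def by (rule sum_Pow_compl[of "\<lambda>A A'. ?F A * singleton_fun (g k) A'"])
    also have "\<dots> = (\<Sum>l\<in>S. ?F (S - {l}) * singleton_fun (g k) {l})"
      by (rule sum_Pow_singletons[OF fin]) (auto simp: card_1_singleton_iff)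
    also have "\<dots> = (\<Sum>\<sigma>\<in>bijections (Suc k) S. \<Prod>a<Suc k. g a (\<sigma> a))"
      unfolding sum_bijections_Suc[OF fin] by simp
    finally show "set_conv ?F (singleton_fun (g k)) S = \<dots>" .
  qed
  finally show ?case .
qed

definition ext_det :: "nat \<Rightarrow> (nat \<Rightarrow> nat \<Rightarrow> ext) \<Rightarrow> ext" where
  "ext_det k N = (\<Sum>\<pi> | \<pi> permutes {..<k}.
    cst (of_int (sign \<pi>)) * prod_list (map (\<lambda>a. N a (\<pi> a)) [0..<k]))"

lemma wedge_list_cf: "wedge_list (map cf xs) = cf (prod_list xs)"
  by (induction xs) (simp_all add: wedge_list_def one_ext.rep_eq times_ext.rep_eq)

lemma det_form_ext_det:
  assumes "M \<in> carrier_mat k k" "\<And>a b. a < k \<Longrightarrow> b < k \<Longrightarrow> M $$ (a, b) = cf (N a b)"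
  shows "det_form M = cf (ext_det k N)"
proof (intro ext)
  fix I J
  have dim: "dim_row M = k" using assms(1) by auto
  have "wedge_list (map (\<lambda>a. M $$ (a, \<pi> a)) [0..<k]) = cf (prod_list (map (\<lambda>a. N a (\<pi> a)) [0..<k]))"
    if "\<pi> permutes {..<k}" for \<pi>
  proof -
    have "map (\<lambda>a. M $$ (a, \<pi> a)) [0..<k] = map cf (map (\<lambda>a. N a (\<pi> a)) [0..<k])"
      using assms(2) permutes_in_image[OF that] by auto
    then show ?thesis by (simp only: wedge_list_cf)
  qed
  then show "det_form M I J = cf (ext_det k N) I J"
    unfolding det_form_def dim ext_det_def cf_sum cf_cst_mult by (intro sum.cong) auto
qed

lemma pull_ext_det: "pull n P (ext_det k N) = ext_det k (\<lambda>a b. pull n P (N a b))"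
  by (simp add: ext_det_def pull.hom_sum pull.hom_mult pull.hom_prod_list comp_def)

lemma cst_mult_diag: "cst c * diag n d = diag n (\<lambda>S. c * d S)"
  by (rule ext_eqI) (auto simp: cf_diag)

lemma diag_sum: "(\<Sum>x\<in>A. diag n (d x)) = diag n (\<lambda>S. \<Sum>x\<in>A. d x S)"
proof (rule ext_eqI)
  have "(\<Sum>x\<in>A. if b then f x else 0) = (if b then sum f A else 0)" for b and f :: "_ \<Rightarrow> complex"
    by simp
  then show "cf (\<Sum>x\<in>A. diag n (d x)) I J = cf (diag n (\<lambda>S. \<Sum>x\<in>A. d x S)) I J" for I J
    by (simp only: cf_sum cf_diag sum_distrib_left)
qed

lemma ext_det_diag:
  "ext_det k (\<lambda>a b. diag n (singleton_fun (\<lambda>l. B l a b))) = diag n (mixed_disc k B)"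
proof -
  have "ext_det k (\<lambda>a b. diag n (singleton_fun (\<lambda>l. B l a b))) =
      diag n (\<lambda>S. \<Sum>\<pi> | \<pi> permutes {..<k}. of_int (sign \<pi>) *
        (\<Sum>\<sigma>\<in>bijections k S. \<Prod>a<k. B (\<sigma> a) a (\<pi> a)))"
    unfolding ext_det_def prod_list_diag_singletons[of n "\<lambda>a l. B l a (_ a)"] cst_mult_diag diag_sum ..
  also have "\<dots> = diag n (mixed_disc k B)"
    unfolding mixed_disc_def sel_det_def sum_distrib_left
    by (intro diag_cong sum.swap)
  finally show ?thesis .
qed

lemma area_cong: "(\<And>i. i < n \<Longrightarrow> v i = w i) \<Longrightarrow> area n v = area n w"
  by (simp add: area_def lin_def conjlin_def)

lemma pull_area_delta:
  assumes "l < n"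
  shows "pull n P (area n (\<lambda>j. if l = j then 1 else 0)) = area n (P l)"
  unfolding pull_area
proof (rule area_cong)
  fix j
  have "(\<Sum>m<n. (if l = m then 1 else 0) * P m j) = (\<Sum>m<n. if l = m then P m j else 0)"
    by (intro sum.cong) auto
  then show "(\<Sum>m<n. (if l = m then 1 else 0) * P m j) = P l j" using assms by simp
qed

lemma ext_det_simultaneously_diagonal:
  "ext_det k (\<lambda>a b. \<Sum>l<n. cst (B l a b) * area n (P l)) = pull n P (diag n (mixed_disc k B))"
proof -
  have "pull n P (diag n (singleton_fun (\<lambda>l. B l a b))) = (\<Sum>l<n. cst (B l a b) * area n (P l))" for a b
    unfolding diag_singleton_fun[symmetric] pull.hom_sum pull.hom_cst_mult
    by (intro sum.cong refl) (simp add: pull_area_delta)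
  then show ?thesis by (simp add: ext_det_diag[symmetric] pull_ext_det)
qed

lemma mixed_disc_card: "mixed_disc k B S \<noteq> 0 \<Longrightarrow> card S = k"
proof -
  assume "mixed_disc k B S \<noteq> 0"
  then obtain \<sigma> where "\<sigma> \<in> bijections k S" unfolding mixed_disc_def by (meson sum.not_neutral_contains_not_neutral)
  then have "bij_betw \<sigma> {..<k} S" by (simp add: bijections_def)
  then show "card S = k" using bij_betw_same_card by fastforce
qed

section \<open>Lefschetz maps, changes of coordinates and conjugation\<close>

definition ext_lefschetz :: "nat \<Rightarrow> nat \<Rightarrow> nat \<Rightarrow> ext \<Rightarrow> bool" where
  "ext_lefschetz n p q W \<longleftrightarrow>
    bij_betw (\<lambda>a. a * W) {a. cf a \<in> forms n p q} {a. cf a \<in> forms n (n - q) (n - p)}"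

lemma bij_betw_cf: "bij_betw cf {a. cf a \<in> forms n p q} (forms n p q)"
  by (rule bij_betw_byWitness[of _ Ext]) (auto simp: cf_inverse cf_Ext_forms)

lemma lefschetz_cf:
  assumes "ext_lefschetz n p q W"
  shows "lefschetz n p q (cf W)"
proof -
  have "bij_betw Ext (forms n p q) {a. cf a \<in> forms n p q}"
    by (rule bij_betw_byWitness[of _ cf]) (auto simp: cf_inverse cf_Ext_forms)
  then have "bij_betw (cf \<circ> ((\<lambda>a. a * W) \<circ> Ext)) (forms n p q) (forms n (n - q) (n - p))"
    using bij_betw_trans[OF bij_betw_trans bij_betw_cf] assms unfolding ext_lefschetz_def by blast
  moreover have "(cf \<circ> ((\<lambda>a. a * W) \<circ> Ext)) \<alpha> = lefschetz_map (cf W) \<alpha>"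
    if "\<alpha> \<in> forms n p q" for \<alpha>
    by (simp add: lefschetz_map_def times_ext.rep_eq cf_Ext_forms[OF that])
  ultimately show ?thesis
    unfolding lefschetz_def using bij_betw_cong by blast
qed

text \<open>Injectivity suffices, as both sides have the same finite dimension.\<close>

lemma ext_lefschetz_of_inj:
  assumes W: "cf W \<in> forms n k k" and n: "p + q + k = n"
    and inj: "\<And>a. cf a \<in> forms n p q \<Longrightarrow> a * W = 0 \<Longrightarrow> a = 0"
  shows "ext_lefschetz n p q W"
proof -
  define X where "X = {(I, J). I \<subseteq> {..<n} \<and> card I = p \<and> J \<subseteq> {..<n} \<and> card J = q}"
  \<comment> \<open>Complementing and exchanging the index sets matches degree \<open>(p, q)\<close>
    with degree \<open>(n - q, n - p)\<close>; this makes the matrix \<open>R\<close> of the map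
    square.\<close>
  define c where "c = (\<lambda>(I, J). ({..<n} - J, {..<n} - I))"
  define N where "N = card X"
  have finX: "finite X"
    by (rule finite_subset[of _ "Pow {..<n} \<times> Pow {..<n}"]) (auto simp: X_def)
  then obtain x where x: "bij_betw x {..<N} X"
    using ex_bij_betw_nat_finite[OF finX] by (auto simp: N_def lessThan_atLeast0)
  have xX: "x i \<in> X" if "i < N" for i using x that by (auto simp: bij_betw_def)
  have target: "cf (a * W) \<in> forms n (n - q) (n - p)" if "cf a \<in> forms n p q" for a
  proof -
    have "n - q = p + k" "n - p = q + k" using n by auto
    then show ?thesis using forms_mult[OF that W] by simp
  qed
  have covers: "\<exists>i<N. (I, J) = c (x i)"
    if "I \<subseteq> {..<n}" "card I = n - q" "J \<subseteq> {..<n}" "card J = n - p" for I J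
  proof -
    have "card ({..<n} - J) = p" "card ({..<n} - I) = q"
      using that n finite_subset[of _ "{..<n}"] by (auto simp: card_Diff_subset)
    then have "({..<n} - J, {..<n} - I) \<in> x ` {..<N}"
      using x that by (simp add: bij_betw_def X_def)
    then obtain i where i: "i < N" "x i = ({..<n} - J, {..<n} - I)" by auto
    moreover have "{..<n} - ({..<n} - I) = I" "{..<n} - ({..<n} - J) = J" using that by auto
    ultimately show ?thesis by (auto simp: c_def)
  qed
  have eq_target: "b = b'"
    if b: "cf b \<in> forms n (n - q) (n - p)" "cf b' \<in> forms n (n - q) (n - p)"
      and eq: "\<And>i. i < N \<Longrightarrow> cf b (fst (c (x i))) (snd (c (x i))) = cf b' (fst (c (x i))) (snd (c (x i)))" for b b'
  proof (rule ext_eqI)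
    fix I J
    show "cf b I J = cf b' I J"
    proof (cases "I \<subseteq> {..<n} \<and> card I = n - q \<and> J \<subseteq> {..<n} \<and> card J = n - p")
      case True
      then obtain i where "i < N" "(I, J) = c (x i)" using covers by blast
      then show ?thesis using eq[of i] by (metis fst_conv snd_conv)
    next
      case False
      then have "cf b I J = 0" "cf b' I J = 0" using formsD[OF b(1)] formsD[OF b(2)] by blast+
      then show ?thesis by simp
    qed
  qed
  define form_of where "form_of v = (\<Sum>i<N. cst (v i) * dl (fst (x i)) (snd (x i)))" for v
  have finx: "finite (fst (x i))" "finite (snd (x i))" if "i < N" for i
    using xX[OF that] finite_subset[of _ "{..<n}"] by (auto simp: X_def)
  have form_of: "cf (form_of v) \<in> forms n p q" for v
    unfolding form_of_def
  proof (intro forms_sum forms_cst_mult)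
    fix i assume "i \<in> {..<N}"
    then show "cf (dl (fst (x i)) (snd (x i))) \<in> forms n p q"
      using xX[of i] finx[of i] by (auto simp: forms_def cf_dl X_def split: if_splits)
  qed
  define R where "R m i = cf (dl (fst (x i)) (snd (x i)) * W) (fst (c (x m))) (snd (c (x m)))" for m i
  have coeff: "cf (form_of v * W) (fst (c (x m))) (snd (c (x m))) = (\<Sum>i<N. R m i * v i)" for v m
    by (simp add: form_of_def sum_distrib_right mult.assoc cf_sum R_def mult.commute)
  have cf_form_of: "cf (form_of v) (fst (x i)) (snd (x i)) = v i" if "i < N" for v i
  proof -
    have "cf (form_of v) (fst (x i)) (snd (x i)) = (\<Sum>j<N. if j = i then v j else 0)"
      unfolding form_of_def cf_sum cf_cst_mult
    proof (intro sum.cong refl)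
      fix j assume j: "j \<in> {..<N}"
      have "fst (x i) = fst (x j) \<and> snd (x i) = snd (x j) \<longleftrightarrow> j = i"
        using x that j by (auto simp: bij_betw_def inj_on_def prod_eq_iff)
      then show "v j * cf (dl (fst (x j)) (snd (x j))) (fst (x i)) (snd (x i)) = (if j = i then v j else 0)"
        using finx[of j] j by (simp add: cf_dl)
    qed
    then show ?thesis using that by simp
  qed
  have "\<exists>S. \<forall>a<N. \<forall>b<N. (\<Sum>m<N. S a m * R m b) = (if a = b then 1 else 0) \<and>
                          (\<Sum>m<N. R a m * S m b) = (if a = b then 1 else 0)"
  proof (rule square_system_inverse)
    fix v a
    assume z: "\<And>m. m < N \<Longrightarrow> (\<Sum>a<N. R m a * v a) = 0" and a: "a < N"
    have "form_of v * W = 0"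
      by (rule eq_target[OF target[OF form_of] forms_zero]) (simp add: coeff z)
    then have "form_of v = 0" by (rule inj[OF form_of])
    then show "v a = 0" using cf_form_of[OF a, of v] by simp
  qed
  then obtain S where S: "\<And>a b. a < N \<Longrightarrow> b < N \<Longrightarrow> (\<Sum>m<N. R a m * S m b) = (if a = b then 1 else 0)"
    by blast
  show ?thesis
    unfolding ext_lefschetz_def bij_betw_def
  proof
    show "inj_on (\<lambda>a. a * W) {a. cf a \<in> forms n p q}"
    proof (rule inj_onI)
      fix a b assume ab: "a \<in> {a. cf a \<in> forms n p q}" "b \<in> {a. cf a \<in> forms n p q}" "a * W = b * W"
      have "cf (a + cst (- 1) * b) \<in> forms n p q" using ab by (intro forms_add forms_cst_mult) auto
      moreover have "(a + cst (- 1) * b) * W = 0"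
        using ab(3) by (simp add: left_diff_distrib cst_minus)
      ultimately have "a + cst (- 1) * b = 0" by (rule inj)
      then show "a = b" by (simp add: cst_minus)
    qed
    show "(\<lambda>a. a * W) ` {a. cf a \<in> forms n p q} = {a. cf a \<in> forms n (n - q) (n - p)}"
    proof (intro equalityI subsetI)
      fix b assume "b \<in> {a. cf a \<in> forms n (n - q) (n - p)}"
      then have b: "cf b \<in> forms n (n - q) (n - p)" by simp
      define \<beta> where "\<beta> i = cf b (fst (c (x i))) (snd (c (x i)))" for i
      define v where "v a = (\<Sum>m<N. S a m * \<beta> m)" for a
      have "(\<Sum>i<N. R m i * v i) = \<beta> m" if m: "m < N" for m
      proof -
        have "(\<Sum>i<N. R m i * v i) = (\<Sum>i<N. \<Sum>j<N. R m i * S i j * \<beta> j)"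
          by (simp add: v_def sum_distrib_left mult.assoc)
        also have "\<dots> = (\<Sum>j<N. \<Sum>i<N. R m i * S i j * \<beta> j)" by (rule sum.swap)
        also have "\<dots> = (\<Sum>j<N. if m = j then \<beta> j else 0)"
          by (intro sum.cong refl) (auto simp: sum_distrib_right[symmetric] S m)
        finally show ?thesis using m by simp
      qed
      then have "form_of v * W = b"
        by (intro eq_target[OF target[OF form_of] b]) (simp add: coeff \<beta>_def)
      then show "b \<in> (\<lambda>a. a * W) ` {a. cf a \<in> forms n p q}" using form_of by blast
    qed (use target in auto)
  qed
qed

lemma bij_betw_pull:
  assumes "inverse_matrices n P Q"
  shows "bij_betw (pull n P) {a. cf a \<in> forms n p q} {a. cf a \<in> forms n p q}"
  by (rule bij_betw_byWitness[of _ "pull n Q"])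
     (use assms pull_pull pull.hom_forms forms_supported inverse_matrices_sym in blast)+

text \<open>Multiplication by \<open>pull n P W\<close> is multiplication by \<open>W\<close>
  conjugated with \<open>pull n P\<close>, which is multiplicative and bijective in every
  degree.\<close>

lemma ext_lefschetz_pull:
  assumes PQ: "inverse_matrices n P Q" and W: "ext_lefschetz n p q W"
  shows "ext_lefschetz n p q (pull n P W)"
proof -
  have "bij_betw (pull n P \<circ> ((\<lambda>a. a * W) \<circ> pull n Q)) {a. cf a \<in> forms n p q}
      {a. cf a \<in> forms n (n - q) (n - p)}"
    using bij_betw_trans[OF bij_betw_trans[OF bij_betw_pull[of n Q P p q]
      W[unfolded ext_lefschetz_def]] bij_betw_pull[OF PQ]] PQ inverse_matrices_sym by blast
  moreover have "(pull n P \<circ> ((\<lambda>a. a * W) \<circ> pull n Q)) a = a * pull n P W"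
    if "a \<in> {a. cf a \<in> forms n p q}" for a
    using that pull_pull[OF PQ] forms_supported by (simp add: pull.hom_mult)
  ultimately show ?thesis
    unfolding ext_lefschetz_def
    by (subst bij_betw_cong[of _ _ "pull n P \<circ> ((\<lambda>a. a * W) \<circ> pull n Q)"]) auto
qed

lemma bij_betw_cj: "bij_betw cj {a. cf a \<in> forms n p q} {a. cf a \<in> forms n q p}"
  by (rule bij_betw_byWitness[of _ cj]) (auto simp: cj_forms)

text \<open>Conjugation exchanges the two degrees and fixes \<open>W\<close>; this reduces the case
  \<open>q \<le> 1\<close> to \<open>p \<le> 1\<close>.\<close>

lemma ext_lefschetz_cj:
  assumes "ext_lefschetz n p q W" "cj W = W"
  shows "ext_lefschetz n q p W"
proof -
  have "bij_betw (cj \<circ> ((\<lambda>a. a * W) \<circ> cj)) {a. cf a \<in> forms n q p}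
      {a. cf a \<in> forms n (n - p) (n - q)}"
    using bij_betw_trans[OF bij_betw_trans[OF bij_betw_cj[of n q p]
      assms(1)[unfolded ext_lefschetz_def]] bij_betw_cj] .
  then show ?thesis
    unfolding ext_lefschetz_def
    by (subst bij_betw_cong[of _ _ "cj \<circ> ((\<lambda>a. a * W) \<circ> cj)"]) (auto simp: cj_mult assms(2))
qed

section \<open>Injectivity for diagonal forms\<close>

lemma wedge_sign_nonzero [simp]: "wedge_sign I J I' J' \<noteq> 0"
  by (simp add: wedge_sign_def)

lemma cf_mult_diag:
  assumes "I \<subseteq> {..<n}" "finite J"
  shows "cf (a * diag n c) I J = (\<Sum>A\<in>Pow I. if I - A \<subseteq> J then
    wedge_sign A (J - (I - A)) (I - A) (I - A) * cf a A (J - (I - A)) *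
      (area_const (card (I - A)) * c (I - A)) else 0)"
  unfolding cf_mult
proof (rule sum.cong[OF refl])
  fix A assume "A \<in> Pow I"
  then have sub: "I - A \<subseteq> {..<n}" using assms(1) by auto
  have "(\<Sum>B\<in>Pow J. wedge_sign A B (I - A) (J - B) * cf a A B * cf (diag n c) (I - A) (J - B)) =
      (\<Sum>B\<in>Pow J. wedge_sign A (J - B) (I - A) B * cf a A (J - B) * cf (diag n c) (I - A) B)"
    by (rule sum_Pow_compl[of "\<lambda>B B'. wedge_sign A B (I - A) B' * cf a A B * cf (diag n c) (I - A) B'"])
  also have "\<dots> = (\<Sum>B\<in>Pow J. if B = I - A then wedge_sign A (J - (I - A)) (I - A) (I - A) *
      cf a A (J - (I - A)) * (area_const (card (I - A)) * c (I - A)) else 0)"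
    using sub by (intro sum.cong refl) (auto simp: cf_diag)
  finally show "(\<Sum>B\<in>Pow J. wedge_sign A B (I - A) (J - B) * cf a A B * cf (diag n c) (I - A) (J - B)) =
      (if I - A \<subseteq> J then wedge_sign A (J - (I - A)) (I - A) (I - A) *
      cf a A (J - (I - A)) * (area_const (card (I - A)) * c (I - A)) else 0)"
    using assms(2) by simp
qed

text \<open>At the complement of \<open>L\<close> and the full set, the product has a single term: a
  nonzero multiple of the coefficient of \<open>a\<close> at \<open>L\<close>.\<close>

lemma diag_injective_0:
  assumes n: "q + k = n" and c: "\<And>S. S \<subseteq> {..<n} \<Longrightarrow> card S = k \<Longrightarrow> c S \<noteq> 0"
    and a: "cf a \<in> forms n 0 q" and 0: "a * diag n c = 0"
  shows "a = 0"
proof (rule ext_eqI, rule ccontr)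
  fix K L :: "nat set" assume "finite K" "cf a K L \<noteq> cf 0 K L"
  then have nz: "cf a K L \<noteq> 0" by simp
  then have KL: "K = {}" "L \<subseteq> {..<n}" "card L = q"
    using formsD[OF a nz] \<open>finite K\<close> by auto
  define I where "I = {..<n} - L"
  have I: "I \<subseteq> {..<n}" "finite I" "card I = k" "{..<n} - I = L"
    using KL n finite_subset[of L "{..<n}"] by (auto simp: I_def card_Diff_subset)
  have "0 = cf (a * diag n c) I {..<n}" by (simp add: 0)
  also have "\<dots> = wedge_sign {} L I I * cf a {} L * (area_const (card I) * c I)"
    unfolding cf_mult_diag[OF I(1) finite_lessThan]
  proof (subst sum_delta_empty[OF I(2)])
    fix A assume "A \<subseteq> I" "A \<noteq> {}"
    then have "card A \<noteq> 0" using finite_subset[OF _ I(2)] by auto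
    then have "cf a A B = 0" for B using formsD[OF a, of A B] by auto
    then show "(if I - A \<subseteq> {..<n} then wedge_sign A ({..<n} - (I - A)) (I - A) (I - A) *
      cf a A ({..<n} - (I - A)) * (area_const (card (I - A)) * c (I - A)) else 0) = 0" by simp
  qed (use I in simp)
  finally show False using nz KL(1) c[OF I(1,3)] by simp
qed

text \<open>Stated for arbitrary coefficients, which separates the weight argument from
  positivity.\<close>

definition reduced_nonsingular :: "nat \<Rightarrow> nat \<Rightarrow> (nat set \<Rightarrow> complex) \<Rightarrow> bool" where
  "reduced_nonsingular n k c \<longleftrightarrow> (\<forall>T y. T \<subseteq> {..<n} \<longrightarrow> card T = k + 2 \<longrightarrow>
     (\<forall>m\<in>T. (\<Sum>i\<in>T - {m}. c (T - {m, i}) * y i) = 0) \<longrightarrow> (\<forall>i\<in>T. y i = 0))"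

text \<open>A torus weight isolates the coefficient at \<open>({m}, L)\<close> if \<open>m\<close>
  is not in \<open>L\<close>. Otherwise \<open>L = {m} \<union> K'\<close>, and the coefficients at
  \<open>({i}, {i} \<union> K')\<close>, with \<open>i\<close> in the complement \<open>T\<close> of
  \<open>K'\<close>, share a weight and solve the system attached to \<open>T\<close>.\<close>

lemma diag_injective_1:
  assumes n: "1 + q + k = n" and c: "\<And>S. S \<subseteq> {..<n} \<Longrightarrow> card S = k \<Longrightarrow> c S \<noteq> 0"
    and red: "reduced_nonsingular n k c"
    and a: "cf a \<in> forms n 1 q" and 0: "a * diag n c = 0"
  shows "a = 0"
proof (rule ext_eqI, rule ccontr)
  fix K L :: "nat set" assume "finite K" "cf a K L \<noteq> cf 0 K L"
  then have nz: "cf a K L \<noteq> 0" by simp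
  then have K: "K \<subseteq> {..<n}" "card K = 1" and L: "L \<subseteq> {..<n}" "card L = q"
    using formsD[OF a nz] by auto
  then obtain m where m: "K = {m}" "m < n" by (auto simp: card_1_singleton_iff)
  have finL: "finite L" using L finite_subset by auto
  have not1: "cf a A B = 0" if "card A \<noteq> 1" for A B using formsD[OF a] that by blast
  let ?F = "\<lambda>I J A. if I - A \<subseteq> J then wedge_sign A (J - (I - A)) (I - A) (I - A) *
      cf a A (J - (I - A)) * (area_const (card (I - A)) * c (I - A)) else 0"
  have F: "(\<Sum>i\<in>I. ?F I J {i}) = 0" if "I \<subseteq> {..<n}" "finite J" for I J
  proof -
    have "0 = cf (a * diag n c) I J" by (simp add: 0)
    also have "\<dots> = (\<Sum>A\<in>Pow I. ?F I J A)" by (rule cf_mult_diag[OF that])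
    also have "\<dots> = (\<Sum>i\<in>I. ?F I J {i})"
      using that finite_subset[of I "{..<n}"] by (intro sum_Pow_singletons) (auto simp: not1)
    finally show ?thesis by simp
  qed
  show False
  proof (cases "m \<in> L")
    case False
    \<comment> \<open>With these targets any other \<open>i\<close> leaves \<open>m\<close> in
      \<open>I - {i}\<close>, which is not contained in \<open>J\<close>; only the term for
      \<open>m\<close> survives.\<close>
    define I where "I = {..<n} - L"
    define J where "J = {..<n} - {m}"
    have I: "I \<subseteq> {..<n}" "m \<in> I" "finite I" using False m by (auto simp: I_def)
    have "card I = Suc k" using L finL n by (simp add: I_def card_Diff_subset)
    then have ck: "card (I - {m}) = k" using I by simp
    have JL: "J - (I - {m}) = L" "I - {m} \<subseteq> J" using False L m by (auto simp: I_def J_def)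
    have "(\<Sum>i\<in>I. ?F I J {i}) = (\<Sum>i\<in>{m}. ?F I J {i})"
    proof (rule sum.mono_neutral_right)
      show "\<forall>i\<in>I - {m}. ?F I J {i} = 0"
      proof
        fix i assume "i \<in> I - {m}"
        then have "m \<in> I - {i}" using I(2) by auto
        then have "\<not> I - {i} \<subseteq> J" by (auto simp: J_def)
        then show "?F I J {i} = 0" by simp
      qed
    qed (use I in auto)
    then have "wedge_sign {m} L (I - {m}) (I - {m}) * cf a {m} L *
        (area_const (card (I - {m})) * c (I - {m})) = 0"
      using F[OF I(1), of J] JL by (simp add: J_def)
    then show False using nz m(1) c[OF _ ck] I(1) by auto
  next
    case True
    define K' where "K' = L - {m}"
    define T where "T = {..<n} - K'"
    have K': "finite K'" "K' \<subseteq> {..<n}" "m \<notin> K'" "insert m K' = L" using finL L True by (auto simp: K'_def)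
    have "Suc (card K') = q" using card_Suc_Diff1[OF finL True] L by (simp add: K'_def)
    then have q: "q = Suc (card K')" by simp
    have T: "T \<subseteq> {..<n}" "finite T" "card T = k + 2" "m \<in> T" "K' \<inter> T = {}"
      using K' q n m by (auto simp: T_def card_Diff_subset)
    \<comment> \<open>The shuffle sign absorbs the dependence of the wedge sign on \<open>i\<close>,
      so the remaining factor \<open>\<kappa>\<close> depends only on the equation
      \<open>r\<close>.\<close>
    define y where "y i = shuffle_sign K' {i} * cf a {i} (insert i K')" for i
    have "(\<Sum>i\<in>T - {r}. c (T - {r, i}) * y i) = 0" if r: "r \<in> T" for r
    proof -
      define I where "I = T - {r}"
      define J where "J = {..<n} - {r}"
      define \<kappa> where "\<kappa> = (-1) ^ (q * k) * shuffle_sign K' T * shuffle_sign K' {r} * area_const k"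
      have "?F I J {i} = \<kappa> * (c (T - {r, i}) * y i)" if i: "i \<in> I" for i
      proof -
        define S where "S = T - {r, i}"
        have S: "I - {i} = S" "S \<subseteq> J" "J - S = insert i K'" "finite S" "i \<notin> S" "i \<notin> K'" "i \<noteq> r"
          using i r K' T by (auto simp: I_def J_def S_def T_def)
        have "card S = k" using card_remove2[OF T(2,3) r, of i] i by (auto simp: S_def I_def)
        have "shuffle_sign K' (S \<union> {r, i}) = shuffle_sign K' S * shuffle_sign K' {r, i}"
          using K'(1) S by (intro shuffle_sign_Un_right) (auto simp: S_def)
        moreover have "shuffle_sign K' ({r} \<union> {i}) = shuffle_sign K' {r} * shuffle_sign K' {i}"
          using K'(1) S by (intro shuffle_sign_Un_right) auto
        moreover have "{r} \<union> {i} = {r, i}" by auto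
        moreover have "S \<union> {r, i} = T" using r i by (auto simp: S_def I_def)
        ultimately have sT: "shuffle_sign K' T = shuffle_sign K' S * (shuffle_sign K' {r} * shuffle_sign K' {i})"
          by (simp only:)
        have sq: "shuffle_sign A B * (shuffle_sign A B * z) = z" for A B z
          by (simp add: mult.assoc[symmetric])
        have sK: "shuffle_sign K' S = shuffle_sign K' T * shuffle_sign K' {r} * shuffle_sign K' {i}"
          unfolding sT by (simp add: mult_ac sq)
        have "shuffle_sign ({i} \<union> K') S = shuffle_sign {i} S * shuffle_sign K' S"
          using K'(1) S by (intro shuffle_sign_Un_left) auto
        then have "wedge_sign {i} (insert i K') S S = (-1) ^ (q * k) * shuffle_sign K' S"
          using S K'(1) q \<open>card S = k\<close> by (simp add: wedge_sign_def mult_ac sq)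
        then have "?F I J {i} = (-1) ^ (q * k) * shuffle_sign K' S * cf a {i} (insert i K') * (area_const k * c S)"
          using S \<open>card S = k\<close> by simp
        also have "\<dots> = \<kappa> * (c S * y i)"
          unfolding sK \<kappa>_def y_def by (simp add: mult_ac)
        finally show ?thesis by (simp add: S_def)
      qed
      then have "(\<Sum>i\<in>I. ?F I J {i}) = \<kappa> * (\<Sum>i\<in>I. c (T - {r, i}) * y i)"
        unfolding sum_distrib_left by (intro sum.cong refl) blast
      moreover have "(\<Sum>i\<in>I. ?F I J {i}) = 0"
        by (rule F) (use T in \<open>auto simp: I_def J_def\<close>)
      moreover have "\<kappa> \<noteq> 0" by (simp add: \<kappa>_def)
      ultimately show ?thesis by (simp add: I_def)
    qed
    then have "y m = 0" using red T unfolding reduced_nonsingular_def by blast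
    then show False using nz m(1) K'(4) by (simp add: y_def)
  qed
qed

text \<open>No \<open>dx_i\<close> has to cross a conjugate differential, so the coefficient matrix
  is of rank one without signs.\<close>

lemma cf_mult_cj:
  assumes g: "cf g \<in> forms n p 0" and fin: "finite U" "finite V"
  shows "cf (g * cj g) U V = cf g U {} * cnj (cf g V {})"
proof -
  have "cf (g * cj g) U V = (\<Sum>J1\<in>Pow V. wedge_sign U J1 {} (V - J1) * cf g U J1 * cf (cj g) {} (V - J1))"
    unfolding cf_mult
  proof (subst sum_delta_full[OF fin(1)])
    fix A assume "A \<subseteq> U" "A \<noteq> U"
    then have "card (U - A) \<noteq> 0" using fin by auto
    then have "cf (cj g) (U - A) B = 0" for B using formsD[OF cj_forms[OF g], of "U - A" B] by auto
    then show "(\<Sum>J1\<in>Pow V. wedge_sign A J1 (U - A) (V - J1) * cf g A J1 * cf (cj g) (U - A) (V - J1)) = 0"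
      by simp
  qed simp
  also have "\<dots> = cf g U {} * cnj (cf g V {})"
  proof (subst sum_delta_empty[OF fin(2)])
    fix A assume "A \<subseteq> V" "A \<noteq> {}"
    then have "card A \<noteq> 0" using finite_subset[OF _ fin(2)] by auto
    then have "cf g U A = 0" using formsD[OF g, of U A] by auto
    then show "wedge_sign U A {} (V - A) * cf g U A * cf (cj g) {} (V - A) = 0" by simp
  qed (simp add: wedge_sign_def cf_cj)
  finally show ?thesis .
qed

text \<open>The constants multiply to \<open>- (1 / 4)\<close>, and moving one differential across a
  conjugate one restores the positive sign.\<close>

lemma area_sum_square:
  "(\<Sum>l\<in>N. area n (Q l)) * (\<Sum>l\<in>N. area n (Q l)) =
    (\<Sum>l\<in>N. \<Sum>m\<in>N. cst (1 / 4) * ((lin n (Q l) * lin n (Q m)) * cj (lin n (Q l) * lin n (Q m))))"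
  unfolding sum_product
proof (intro sum.cong refl)
  fix l m
  let ?e = "\<lambda>l. lin n (Q l)" and ?f = "\<lambda>l. conjlin n (\<lambda>i. cnj (Q l i))"
  have fe: "?f l * ?e m = - (?e m * ?f l)"
    by (rule one_forms_anticommute[OF conjlin_forms lin_forms]) auto
  have "area n (Q l) * area n (Q m) = cst (- (1 / 4)) * (?e l * (?f l * ?e m) * ?f m)"
    unfolding area_def cst_mult_cst_mult by (simp add: mult.assoc)
  also have "\<dots> = cst (1 / 4) * (?e l * ?e m * (?f l * ?f m))"
    unfolding fe by (simp add: cst_minus mult.assoc)
  finally show "area n (Q l) * area n (Q m) = cst (1 / 4) * ((?e l * ?e m) * cj (?e l * ?e m))"
    by (simp add: cj_mult cj_lin)
qed

lemma lin_combination: "(\<Sum>l<n. cst (u l) * lin n (Q l)) = lin n (\<lambda>j. \<Sum>l<n. u l * Q l j)"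
proof -
  have "pull n Q (lin n u) = (\<Sum>l<n. cst (u l) * lin n (Q l))"
    unfolding lin_def[of n u] pull.hom_sum pull.hom_cst_mult
    by (intro sum.cong refl) (simp add: pull.hom_dl)
  then show ?thesis by (simp add: pull_lin)
qed

text \<open>Pairing the equation with the conjugate coefficients of \<open>a\<close> gives a
  weighted sum of the squares of the moduli of \<open>X S l m\<close>, with weights
  \<open>c S\<close>, so every \<open>X\<close> at a \<open>k\<close>-set vanishes. As the
  \<open>g l m\<close> span the (2,0)-forms, this determines all coefficients of
  \<open>a\<close>.\<close>

lemma diag_square_injective:
  assumes n: "k + 2 + q = n"
    and c: "\<And>S. S \<subseteq> {..<n} \<Longrightarrow> card S = k \<Longrightarrow> \<exists>r>0. c S = complex_of_real r"
    and c0: "\<And>S. c S \<noteq> 0 \<Longrightarrow> card S = k"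
    and Q: "inverse_matrices n Q Q'" and \<omega>: "\<omega> = (\<Sum>l<n. area n (Q l))"
    and a: "cf a \<in> forms n 0 q" and 0: "a * (diag n c * (\<omega> * \<omega>)) = 0"
  shows "a = 0"
proof -
  let ?N = "Pow {..<n}"
  define g where "g l m = lin n (Q l) * lin n (Q m)" for l m
  have g: "cf (g l m) \<in> forms n 2 0" for l m
    using forms_mult[OF lin_forms lin_forms, of n "Q l" "Q m"] by (simp add: g_def numeral_2_eq_2)
  \<comment> \<open>The coefficient at \<open>dx_I\<close> of the product of \<open>dx_S\<close>
    with \<open>g l m\<close>.\<close>
  define h where "h S l m I = (if S \<subseteq> I then shuffle_sign S (I - S) * cf (g l m) (I - S) {} else 0)" for S l m I
  define \<Theta> where "\<Theta> = \<omega> * \<omega>"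
  have \<Theta>: "cf \<Theta> U V = (\<Sum>l<n. \<Sum>m<n. 1 / 4 * (cf (g l m) U {} * cnj (cf (g l m) V {})))"
    if "finite U" "finite V" for U V
    unfolding \<Theta>_def \<omega> area_sum_square g_def[symmetric] cf_sum cf_cst_mult cf_mult_cj[OF g that] ..
  define W where "W = diag n c * \<Theta>"
  define \<kappa> where "\<kappa> = area_const k / 4"
  have fin: "I \<in> ?N \<Longrightarrow> finite I" for I using finite_subset by auto
  have W: "cf W I V = (\<Sum>S\<in>?N. \<kappa> * c S * (\<Sum>l<n. \<Sum>m<n. h S l m I * cnj (h S l m V)))"
    if I: "I \<in> ?N" and V: "V \<in> ?N" for I V
  proof -
    have term_eq: "wedge_sign S S (I - S) (V - S) * (area_const (card S) * c S) * cf \<Theta> (I - S) (V - S) =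
        \<kappa> * c S * (\<Sum>l<n. \<Sum>m<n. h S l m I * cnj (h S l m V))" if S: "S \<subseteq> I" "S \<subseteq> V" for S
    proof (cases "c S = 0")
      case False
      then have cS: "card S = k" by (rule c0)
      have "wedge_sign S S (I - S) (V - S) * (cf (g l m) (I - S) {} * cnj (cf (g l m) (V - S) {})) =
          h S l m I * cnj (h S l m V)" for l m
      proof (cases "cf (g l m) (I - S) {} = 0")
        case True
        then show ?thesis by (simp add: h_def)
      next
        case False
        then have "card (I - S) = 2" using formsD[OF g] by blast
        \<comment> \<open>The form \<open>g l m\<close> has even degree 2, so it crosses the
          conjugate differentials of \<open>S\<close> without a sign.\<close>
        moreover have "(-1 :: complex) ^ (j * 2) = 1" for j :: nat by (simp add: mult.commute[of j] power_mult)
        ultimately show ?thesis using S by (simp add: h_def wedge_sign_def)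
      qed
      then have "(\<Sum>l<n. \<Sum>m<n. h S l m I * cnj (h S l m V)) =
          wedge_sign S S (I - S) (V - S) *
          (\<Sum>l<n. \<Sum>m<n. (cf (g l m) (I - S) {} * cnj (cf (g l m) (V - S) {})))"
        by (simp add: sum_distrib_left)
      moreover have "cf \<Theta> (I - S) (V - S) =
          1 / 4 * (\<Sum>l<n. \<Sum>m<n. (cf (g l m) (I - S) {} * cnj (cf (g l m) (V - S) {})))"
        using fin[OF I] fin[OF V] by (subst \<Theta>) (auto simp: sum_distrib_left)
      ultimately show ?thesis by (simp add: \<kappa>_def cS)
    qed simp
    have "cf W I V = (\<Sum>S\<in>Pow I. \<Sum>B\<in>Pow V. if B = S then wedge_sign S S (I - S) (V - S) *
        (area_const (card S) * c S) * cf \<Theta> (I - S) (V - S) else 0)"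
      unfolding W_def cf_mult
      by (intro sum.cong refl) (use I in \<open>auto simp: cf_diag\<close>)
    also have "\<dots> = (\<Sum>S\<in>Pow I. if S \<subseteq> V then wedge_sign S S (I - S) (V - S) *
        (area_const (card S) * c S) * cf \<Theta> (I - S) (V - S) else 0)"
      using fin[OF V] by simp
    also have "\<dots> = (\<Sum>S\<in>?N. \<kappa> * c S * (\<Sum>l<n. \<Sum>m<n. h S l m I * cnj (h S l m V)))"
    proof (rule sum.mono_neutral_cong_left)
      show "\<forall>S\<in>?N - Pow I. \<kappa> * c S * (\<Sum>l<n. \<Sum>m<n. h S l m I * cnj (h S l m V)) = 0"
        by (auto simp: h_def)
      fix S assume S: "S \<in> Pow I"
      show "(if S \<subseteq> V then wedge_sign S S (I - S) (V - S) *
        (area_const (card S) * c S) * cf \<Theta> (I - S) (V - S) else 0) =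
        \<kappa> * c S * (\<Sum>l<n. \<Sum>m<n. h S l m I * cnj (h S l m V))"
      proof (cases "S \<subseteq> V")
        case True
        then show ?thesis using term_eq[of S] S by simp
      qed (simp add: h_def)
    qed (use I in auto)
    finally show ?thesis .
  qed
  have \<omega>_forms: "cf \<omega> \<in> forms n 1 1" unfolding \<omega> by (intro forms_sum area_forms)
  have W_forms: "cf W \<in> forms n (k + 2) (k + 2)"
    using forms_mult[OF diag_forms forms_mult[OF \<omega>_forms \<omega>_forms], of c k] c0
    by (simp add: W_def \<Theta>_def)
  \<comment> \<open>The set \<open>{..<k + 2}\<close> stands for any row index of that size: it
    enters the sign only through its cardinality, so all equations share the same
    \<open>\<zeta>\<close>.\<close>
  define \<zeta> where "\<zeta> V = wedge_sign {} ({..<n} - V) {..<k + 2} V * cf a {} ({..<n} - V)" for V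
  have sys: "(\<Sum>V\<in>?N. \<zeta> V * cf W I V) = 0" if I: "I \<in> ?N" for I
  proof (cases "card I = k + 2")
    case False
    then have "cf W I V = 0" for V using formsD[OF W_forms] by blast
    then show ?thesis by simp
  next
    case True
    have "0 = cf (a * W) I {..<n}" using 0 by (simp add: W_def \<Theta>_def)
    also have "\<dots> = (\<Sum>J1\<in>?N. wedge_sign {} J1 I ({..<n} - J1) * cf a {} J1 * cf W I ({..<n} - J1))"
      unfolding cf_mult
    proof (subst sum_delta_empty[OF fin[OF I]])
      fix A assume "A \<subseteq> I" "A \<noteq> {}"
      then have "card A \<noteq> 0" using finite_subset[OF _ fin[OF I]] by auto
      then have "cf a A B = 0" for B using formsD[OF a, of A B] by auto
      then show "(\<Sum>J1\<in>?N. wedge_sign A J1 (I - A) ({..<n} - J1) * cf a A J1 * cf W (I - A) ({..<n} - J1)) = 0"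
        by simp
    qed simp
    also have "\<dots> = (\<Sum>V\<in>?N. wedge_sign {} ({..<n} - V) I V * cf a {} ({..<n} - V) * cf W I V)"
      by (rule sum_Pow_compl[of "\<lambda>A A'. wedge_sign {} A I A' * cf a {} A * cf W I A'"])
    also have "\<dots> = (\<Sum>V\<in>?N. \<zeta> V * cf W I V)"
      by (intro sum.cong refl) (simp add: \<zeta>_def wedge_sign_def True)
    finally show ?thesis by simp
  qed
  define X where "X S l m = (\<Sum>V\<in>?N. \<zeta> V * cnj (h S l m V))" for S l m
  have "0 = (\<Sum>I\<in>?N. cnj (\<zeta> I) * (\<Sum>V\<in>?N. \<zeta> V * cf W I V))" by (simp add: sys)
  also have "\<dots> = (\<Sum>I\<in>?N. \<Sum>V\<in>?N. \<Sum>S\<in>?N. \<kappa> * c S * (\<Sum>l<n. \<Sum>m<n.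
      cnj (\<zeta> I) * h S l m I * (\<zeta> V * cnj (h S l m V))))"
    unfolding sum_distrib_left
  proof (intro sum.cong refl)
    fix I V assume "I \<in> ?N" "V \<in> ?N"
    then show "cnj (\<zeta> I) * (\<zeta> V * cf W I V) = (\<Sum>S\<in>?N. \<Sum>l<n. \<Sum>m<n. \<kappa> * c S * (
        cnj (\<zeta> I) * h S l m I * (\<zeta> V * cnj (h S l m V))))"
      by (simp add: W sum_distrib_left mult_ac)
  qed
  also have "\<dots> = (\<Sum>I\<in>?N. \<Sum>S\<in>?N. \<Sum>V\<in>?N. \<kappa> * c S * (\<Sum>l<n. \<Sum>m<n.
      cnj (\<zeta> I) * h S l m I * (\<zeta> V * cnj (h S l m V))))"
    by (intro sum.cong refl sum.swap)
  also have "\<dots> = (\<Sum>S\<in>?N. \<Sum>I\<in>?N. \<Sum>V\<in>?N. \<kappa> * c S * (\<Sum>l<n. \<Sum>m<n.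
      cnj (\<zeta> I) * h S l m I * (\<zeta> V * cnj (h S l m V))))"
    by (rule sum.swap)
  also have "\<dots> = (\<Sum>S\<in>?N. \<kappa> * c S * (\<Sum>l<n. \<Sum>m<n. cnj (X S l m) * X S l m))"
  proof (intro sum.cong refl)
    fix S
    have "(\<Sum>I\<in>?N. \<Sum>V\<in>?N. \<Sum>l<n. \<Sum>m<n. cnj (\<zeta> I) * h S l m I * (\<zeta> V * cnj (h S l m V))) =
        (\<Sum>I\<in>?N. \<Sum>l<n. \<Sum>V\<in>?N. \<Sum>m<n. cnj (\<zeta> I) * h S l m I * (\<zeta> V * cnj (h S l m V)))"
      by (intro sum.cong refl sum.swap)
    also have "\<dots> = (\<Sum>l<n. \<Sum>I\<in>?N. \<Sum>V\<in>?N. \<Sum>m<n. cnj (\<zeta> I) * h S l m I * (\<zeta> V * cnj (h S l m V)))"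
      by (rule sum.swap)
    also have "\<dots> = (\<Sum>l<n. \<Sum>I\<in>?N. \<Sum>m<n. \<Sum>V\<in>?N. cnj (\<zeta> I) * h S l m I * (\<zeta> V * cnj (h S l m V)))"
      by (intro sum.cong refl sum.swap)
    also have "\<dots> = (\<Sum>l<n. \<Sum>m<n. \<Sum>I\<in>?N. \<Sum>V\<in>?N. cnj (\<zeta> I) * h S l m I * (\<zeta> V * cnj (h S l m V)))"
      by (intro sum.cong refl sum.swap)
    also have "\<dots> = (\<Sum>l<n. \<Sum>m<n. cnj (X S l m) * X S l m)"
      by (simp add: X_def sum_product)
    finally show "(\<Sum>I\<in>?N. \<Sum>V\<in>?N. \<kappa> * c S * (\<Sum>l<n. \<Sum>m<n. cnj (\<zeta> I) * h S l m I * (\<zeta> V * cnj (h S l m V)))) =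
        \<kappa> * c S * (\<Sum>l<n. \<Sum>m<n. cnj (X S l m) * X S l m)"
      by (simp add: sum_distrib_left[symmetric])
  qed
  also have "\<dots> = \<kappa> * of_real (\<Sum>S\<in>?N. Re (c S) * (\<Sum>l<n. \<Sum>m<n. (cmod (X S l m))\<^sup>2))"
  proof -
    have creal: "c S = of_real (Re (c S))" if "S \<in> ?N" for S
      using c[of S] c0[of S] that by (cases "c S = 0") auto
    have cm: "cnj z * z = of_real ((cmod z)\<^sup>2)" for z
      by (metis complex_norm_square mult.commute)
    have "(\<Sum>S\<in>?N. \<kappa> * c S * (\<Sum>l<n. \<Sum>m<n. cnj (X S l m) * X S l m)) =
        (\<Sum>S\<in>?N. \<kappa> * of_real (Re (c S) * (\<Sum>l<n. \<Sum>m<n. (cmod (X S l m))\<^sup>2)))"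
    proof (intro sum.cong refl)
      fix S assume S: "S \<in> ?N"
      have e: "(\<Sum>l<n. \<Sum>m<n. cnj (X S l m) * X S l m) = of_real (\<Sum>l<n. \<Sum>m<n. (cmod (X S l m))\<^sup>2)"
        by (simp only: cm of_real_sum)
      obtain r where r: "c S = of_real r" using creal[OF S] by blast
      show "\<kappa> * c S * (\<Sum>l<n. \<Sum>m<n. cnj (X S l m) * X S l m) =
          \<kappa> * of_real (Re (c S) * (\<Sum>l<n. \<Sum>m<n. (cmod (X S l m))\<^sup>2))"
        unfolding e r by (simp only: of_real_mult Re_complex_of_real mult.assoc)
    qed
    then show ?thesis by (simp only: of_real_sum sum_distrib_left[symmetric])
  qed
  finally have sum0: "(\<Sum>S\<in>?N. Re (c S) * (\<Sum>l<n. \<Sum>m<n. (cmod (X S l m))\<^sup>2)) = 0"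
    by (simp add: \<kappa>_def del: of_real_sum of_real_mult)
  have cnn: "0 \<le> Re (c S)" if "S \<in> ?N" for S
    using c[of S] c0[of S] that by (cases "c S = 0") auto
  have X0: "X S l m = 0" if S: "S \<subseteq> {..<n}" "card S = k" and lm: "l < n" "m < n" for S l m
  proof -
    have "Re (c S) * (\<Sum>l<n. \<Sum>m<n. (cmod (X S l m))\<^sup>2) = 0"
      using sum0 S by (subst (asm) sum_nonneg_eq_0_iff) (auto intro!: mult_nonneg_nonneg sum_nonneg cnn)
    moreover have "Re (c S) \<noteq> 0" using c[OF S] by auto
    ultimately have "(\<Sum>l<n. \<Sum>m<n. (cmod (X S l m))\<^sup>2) = 0" by simp
    then have "(\<Sum>m<n. (cmod (X S l m))\<^sup>2) = 0"
      using lm by (subst (asm) sum_nonneg_eq_0_iff) (auto intro!: sum_nonneg)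
    then show ?thesis
      using lm by (subst (asm) sum_nonneg_eq_0_iff) auto
  qed
  have \<zeta>0: "\<zeta> V0 = 0" if V0: "V0 \<subseteq> {..<n}" "card V0 = k + 2" for V0
  proof -
    \<comment> \<open>Splits \<open>V0\<close> into a pair \<open>A\<close> and a
      \<open>k\<close>-set \<open>S\<close>. Through \<open>Q'\<close> the 2-form
      \<open>\<delta>\<close> of the pair is a combination of the \<open>g l m\<close>, and its
      product with \<open>dx_S\<close> is a multiple of the single monomial at
      \<open>V0\<close>.\<close>
    have "\<exists>A. A \<subseteq> V0 \<and> card A = 2" using obtain_subset_with_card_n[of 2 V0] V0(2) by auto
    then obtain A where A: "A \<subseteq> V0" "card A = 2" by blast
    then obtain b d where bd: "A = {b, d}" "b \<noteq> d" by (meson card_2_iff)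
    have lt: "b < n" "d < n" using A bd V0 by auto
    define S where "S = V0 - A"
    have finV0: "finite V0" using V0 finite_subset by auto
    have S: "S \<subseteq> {..<n}" "card S = k" "S \<subseteq> V0" "V0 - S = A"
      using V0 A finV0 finite_subset[OF A(1)] by (auto simp: S_def card_Diff_subset)
    define \<delta> where "\<delta> = dl {b} {} * dl {d} {}"
    have Q'Q: "(\<Sum>l<n. Q' i l * Q l j) = (if i = j then 1 else 0)" if "i < n" "j < n" for i j
      using Q that by (simp add: inverse_matrices_def)
    have dlin: "dl {i} {} = (\<Sum>l<n. cst (Q' i l) * lin n (Q l))" if "i < n" for i
      unfolding lin_combination by (rule lin_delta(1)[symmetric, OF that]) (simp add: Q'Q that)
    have \<delta>g: "\<delta> = (\<Sum>l<n. \<Sum>m<n. cst (Q' b l * Q' d m) * g l m)"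
      unfolding \<delta>_def dlin[OF lt(1)] dlin[OF lt(2)] sum_product cst_mult_cst_mult g_def ..
    have \<delta>: "cf \<delta> U {} = (if U = A then wedge_sign {b} {} {d} {} else 0)" for U
      unfolding \<delta>_def bd(1) using bd(2) by (simp add: dl_mult_dl cf_dl insert_commute)
    have "0 = (\<Sum>l<n. \<Sum>m<n. cnj (Q' b l * Q' d m) * X S l m)" by (simp add: X0 S)
    also have "\<dots> = (\<Sum>l<n. \<Sum>m<n. \<Sum>V\<in>?N. \<zeta> V * cnj (Q' b l * Q' d m * h S l m V))"
      by (simp add: X_def sum_distrib_left mult_ac)
    also have "\<dots> = (\<Sum>l<n. \<Sum>V\<in>?N. \<Sum>m<n. \<zeta> V * cnj (Q' b l * Q' d m * h S l m V))"
      by (intro sum.cong refl sum.swap)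
    also have "\<dots> = (\<Sum>V\<in>?N. \<Sum>l<n. \<Sum>m<n. \<zeta> V * cnj (Q' b l * Q' d m * h S l m V))"
      by (rule sum.swap)
    also have "\<dots> = (\<Sum>V\<in>?N. if V = V0 then \<zeta> V0 * (shuffle_sign S A * cnj (wedge_sign {b} {} {d} {})) else 0)"
    proof (intro sum.cong refl)
      fix V assume V: "V \<in> ?N"
      have "(\<Sum>l<n. \<Sum>m<n. Q' b l * Q' d m * h S l m V) =
          (if S \<subseteq> V then shuffle_sign S (V - S) * cf \<delta> (V - S) {} else 0)"
        unfolding \<delta>g cf_sum cf_cst_mult h_def by (simp add: sum_distrib_left mult_ac)
      also have "\<dots> = (if V = V0 then shuffle_sign S A * wedge_sign {b} {} {d} {} else 0)"
      proof -
        have *: "V = V0" if "S \<subseteq> V" "V - S = A" using that S(3,4) by blast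
        show ?thesis
        proof (cases "V = V0")
          case True
          then show ?thesis using S(3,4) by (simp add: \<delta>)
        next
          case False
          then have "\<not> S \<subseteq> V \<or> V - S \<noteq> A" using * by blast
          then show ?thesis using False by (elim disjE) (simp_all add: \<delta>)
        qed
      qed
      finally have e: "(\<Sum>l<n. \<Sum>m<n. Q' b l * Q' d m * h S l m V) = \<dots>" .
      have "(\<Sum>l<n. \<Sum>m<n. \<zeta> V * cnj (Q' b l * Q' d m * h S l m V)) =
          \<zeta> V * cnj (\<Sum>l<n. \<Sum>m<n. Q' b l * Q' d m * h S l m V)"
        by (simp add: sum_distrib_left)
      then show "(\<Sum>l<n. \<Sum>m<n. \<zeta> V * cnj (Q' b l * Q' d m * h S l m V)) =
          (if V = V0 then \<zeta> V0 * (shuffle_sign S A * cnj (wedge_sign {b} {} {d} {})) else 0)"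
        unfolding e by simp
    qed
    also have "\<dots> = \<zeta> V0 * (shuffle_sign S A * cnj (wedge_sign {b} {} {d} {}))"
      using V0 by simp
    finally show ?thesis by simp
  qed
  show "a = 0"
  proof (rule ext_eqI, rule ccontr)
    fix K L :: "nat set" assume "finite K" "cf a K L \<noteq> cf 0 K L"
    then have nz: "cf a K L \<noteq> 0" by simp
    then have KL: "K = {}" "L \<subseteq> {..<n}" "card L = q"
      using formsD[OF a nz] \<open>finite K\<close> by auto
    have "card ({..<n} - L) = k + 2" using KL n finite_subset[of L "{..<n}"] by (simp add: card_Diff_subset)
    then have "\<zeta> ({..<n} - L) = 0" by (intro \<zeta>0) auto
    moreover have "{..<n} - ({..<n} - L) = L" using KL by auto
    ultimately show False using nz KL(1) by (simp add: \<zeta>_def)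
  qed
qed

section \<open>The Hodge-Riemann property\<close>

text \<open>The system is real, so the real and imaginary parts of a solution are solutions
  themselves.\<close>

lemma reduced_nonsingular_mixed_disc:
  assumes "0 < k" and pd: "\<And>l. l < n \<Longrightarrow> pos_def k (B l)"
  shows "reduced_nonsingular n k (mixed_disc k B)"
  unfolding reduced_nonsingular_def
proof (intro allI impI)
  fix T and y :: "nat \<Rightarrow> complex"
  assume T: "T \<subseteq> {..<n}" "card T = k + 2"
    and y: "\<forall>m\<in>T. (\<Sum>i\<in>T - {m}. mixed_disc k B (T - {m, i}) * y i) = 0"
  have fin: "finite T" using T(1) finite_subset by auto
  have pdT: "pos_def k (B l)" if "l \<in> T" for l using pd that T(1) by auto
  have "(\<Sum>i\<in>T. of_real (disc_matrix k B T m i) * y i) = 0" if m: "m \<in> T" for m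
  proof -
    have "(\<Sum>i\<in>T. of_real (disc_matrix k B T m i) * y i) =
        (\<Sum>i\<in>T - {m}. of_real (disc_matrix k B T m i) * y i)"
      by (rule sum.mono_neutral_right) (use fin in \<open>auto simp: disc_matrix_def\<close>)
    also have "\<dots> = (\<Sum>i\<in>T - {m}. mixed_disc k B (T - {m, i}) * y i)"
      by (intro sum.cong refl)
         (use mixed_disc_remove2(1)[where B = B, OF fin T(2) pdT m] in auto)
    finally show ?thesis using y m by simp
  qed
  note sys = this
  have ri: "(\<Sum>i\<in>T. disc_matrix k B T m i * Re (y i)) = 0" "(\<Sum>i\<in>T. disc_matrix k B T m i * Im (y i)) = 0"
    if "m \<in> T" for m
    using arg_cong[OF sys[OF that], of Re] arg_cong[OF sys[OF that], of Im] by simp_all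
  have ns: "\<not> disc_singular k T B" by (rule disc_matrix_nonsingular[OF fin T(2) assms(1) pdT])
  have zero: "\<forall>i\<in>T. f i = 0" if "\<And>m. m \<in> T \<Longrightarrow> (\<Sum>i\<in>T. disc_matrix k B T m i * f i) = 0" for f
  proof (rule ccontr)
    assume "\<not> (\<forall>i\<in>T. f i = 0)"
    then have "disc_singular k T B"
      unfolding disc_singular_def by (intro exI[of _ f]) (use that in auto)
    with ns show False ..
  qed
  show "\<forall>i\<in>T. y i = 0"
    using zero[of "\<lambda>i. Re (y i)", OF ri(1)] zero[of "\<lambda>i. Im (y i)", OF ri(2)]
    by (simp add: complex_eq_iff)
qed

section \<open>Kaehler forms and their coordinates\<close>

lemma cf_area_coeff:
  assumes "a < n" "b < n"
  shows "cf (area n v) {a} {b} = \<i> / 2 * (v a * cnj (v b))"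
proof -
  have "cf (lin n v * conjlin n (\<lambda>i. cnj (v i))) {a} {b} =
      (\<Sum>i<n. \<Sum>j<n. v i * cnj (v j) * cf (dl {i} {} * dl {} {j}) {a} {b})"
    unfolding lin_def conjlin_def sum_product cst_mult_cst_mult cf_sum cf_cst_mult ..
  also have "\<dots> = (\<Sum>i<n. \<Sum>j<n. if j = b then (if i = a then v a * cnj (v b) else 0) else 0)"
    by (intro sum.cong refl) (auto simp: dl_split cf_dl)
  also have "\<dots> = v a * cnj (v b)" using assms by simp
  finally show ?thesis by (simp add: area_def)
qed

lemma herm_coeff_area_sum:
  assumes "a < n" "b < n"
  shows "herm_coeff (cf (\<Sum>l<m. cst (c l) * area n (Q l))) a b = (\<Sum>l<m. c l * (Q l a * cnj (Q l b)))"
proof -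
  have "c * (h * x) / h = c * x" if "h \<noteq> 0" for c h x :: complex using that by simp
  then show ?thesis
    unfolding herm_coeff_def cf_sum cf_cst_mult cf_area_coeff[OF assms] sum_divide_distrib
    by (intro sum.cong refl) (metis complex_i_not_zero divide_eq_0_iff zero_neq_numeral)
qed

lemma kahler_quad_form:
  "kahler n \<eta> \<longleftrightarrow> \<eta> \<in> real_forms n 1 \<and>
    (\<forall>v. (\<exists>a<n. v a \<noteq> 0) \<longrightarrow> 0 < Re (quad_form n (herm_coeff \<eta>) v))"
proof -
  have q: "(\<Sum>i<n. \<Sum>j<n. herm_coeff \<eta> i j * (v $ i) * cnj (v $ j)) = quad_form n (herm_coeff \<eta>) (\<lambda>i. v $ i)" for v
    by (simp add: quad_form_def mult_ac)
  have "(\<forall>v \<in> carrier_vec n. v \<noteq> 0\<^sub>v n \<longrightarrow> 0 < Re (quad_form n (herm_coeff \<eta>) (\<lambda>i. v $ i))) \<longleftrightarrow>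
      (\<forall>v. (\<exists>a<n. v a \<noteq> 0) \<longrightarrow> 0 < Re (quad_form n (herm_coeff \<eta>) v))"
  proof (intro iffI allI ballI impI)
    fix v :: "nat \<Rightarrow> complex"
    assume *: "\<forall>v \<in> carrier_vec n. v \<noteq> 0\<^sub>v n \<longrightarrow> 0 < Re (quad_form n (herm_coeff \<eta>) (\<lambda>i. v $ i))"
      and "\<exists>a<n. v a \<noteq> 0"
    then have "vec n v \<noteq> 0\<^sub>v n" by (metis index_vec index_zero_vec(1))
    then have "0 < Re (quad_form n (herm_coeff \<eta>) (\<lambda>i. vec n v $ i))" using * by simp
    also have "quad_form n (herm_coeff \<eta>) (\<lambda>i. vec n v $ i) = quad_form n (herm_coeff \<eta>) v"
      by (rule quad_form_cong) auto
    finally show "0 < Re (quad_form n (herm_coeff \<eta>) v)" .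
  next
    fix v :: "complex vec"
    assume *: "\<forall>v. (\<exists>a<n. v a \<noteq> 0) \<longrightarrow> 0 < Re (quad_form n (herm_coeff \<eta>) v)"
      and v: "v \<in> carrier_vec n" "v \<noteq> 0\<^sub>v n"
    then have "\<exists>a<n. v $ a \<noteq> 0" by (metis carrier_vecD eq_vecI index_zero_vec)
    then show "0 < Re (quad_form n (herm_coeff \<eta>) (\<lambda>i. v $ i))" using * by blast
  qed
  then show ?thesis unfolding kahler_def q by blast
qed

lemma real_forms_cf: "cf a \<in> real_forms n k \<longleftrightarrow> cf a \<in> forms n k k \<and> cj a = a"
  by (simp add: real_forms_def cj.rep_eq[symmetric] cf_inject)

lemma pos_def_herm_coeff:
  assumes "kahler n \<eta>"
  shows "pos_def n (herm_coeff \<eta>)"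
proof -
  have "\<eta> \<in> real_forms n 1" using assms by (simp add: kahler_def)
  then have "conj_form \<eta> = \<eta>" by (simp add: real_forms_def)
  then have conj: "conj_form \<eta> {j} {i} = \<eta> {j} {i}" for i j by simp
  have "herm_coeff \<eta> j i = cnj (herm_coeff \<eta> i j)" for i j
    unfolding herm_coeff_def conj[of j i, symmetric] by (simp add: conj_form_def)
  then show ?thesis
    using assms unfolding pos_def_def kahler_quad_form by blast
qed

lemma singleton_forms_eqI:
  assumes "\<alpha> \<in> forms n 1 1" "\<beta> \<in> forms n 1 1" "\<And>a b. a < n \<Longrightarrow> b < n \<Longrightarrow> \<alpha> {a} {b} = \<beta> {a} {b}"
  shows "\<alpha> = \<beta>"
proof (intro ext, rule ccontr)
  fix I J assume ne: "\<alpha> I J \<noteq> \<beta> I J"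
  then have "\<alpha> I J \<noteq> 0 \<or> \<beta> I J \<noteq> 0" by auto
  then have "I \<subseteq> {..<n} \<and> card I = 1 \<and> J \<subseteq> {..<n} \<and> card J = 1"
    using formsD[OF assms(1)] formsD[OF assms(2)] by blast
  then obtain a b where "I = {a}" "J = {b}" "a < n" "b < n" by (auto simp: card_1_singleton_iff)
  then show False using assms(3) ne by simp
qed

text \<open>The rows of a Cholesky factor of the associated Hermitian matrix are the differentials
  of suitable coordinates.\<close>

lemma kahler_coordinates:
  assumes "kahler n \<eta>"
  shows "\<exists>Q Q'. inverse_matrices n Q Q' \<and> \<eta> = cf (\<Sum>l<n. area n (Q l))"
proof -
  note pd = pos_def_herm_coeff[OF assms]
  obtain R where R: "\<And>a b. a < n \<Longrightarrow> b < n \<Longrightarrow> herm_coeff \<eta> a b = (\<Sum>m<n. R m a * cnj (R m b))"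
    using cholesky[OF pd] by blast
  obtain S where "\<forall>a<n. \<forall>b<n. (\<Sum>m<n. S a m * R m b) = (if a = b then 1 else 0) \<and>
                          (\<Sum>m<n. R a m * S m b) = (if a = b then 1 else 0)"
    using cholesky_inverse[OF pd R] by blast
  then have "inverse_matrices n R S" by (simp add: inverse_matrices_def)
  moreover have "\<eta> = cf (\<Sum>l<n. area n (R l))"
  proof (rule singleton_forms_eqI)
    show "\<eta> \<in> forms n 1 1" using assms by (simp add: kahler_def real_forms_def)
    show "cf (\<Sum>l<n. area n (R l)) \<in> forms n 1 1" by (intro forms_sum area_forms)
    fix a b assume ab: "a < n" "b < n"
    have "\<eta> {a} {b} = \<i> / 2 * herm_coeff \<eta> a b" by (simp add: herm_coeff_def)
    then show "\<eta> {a} {b} = cf (\<Sum>l<n. area n (R l)) {a} {b}"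
      unfolding R[OF ab] cf_sum cf_area_coeff[OF ab] sum_distrib_left .
  qed
  ultimately show ?thesis by blast
qed

lemma kahler_area_sum:
  assumes "inverse_matrices n Q Q'"
  shows "kahler n (cf (\<Sum>l<n. area n (Q l)))"
  unfolding kahler_quad_form
proof (intro conjI allI impI)
  show "cf (\<Sum>l<n. area n (Q l)) \<in> real_forms n 1"
    unfolding real_forms_cf by (intro conjI forms_sum area_forms) (simp add: cj_sum cj_area)
  fix v :: "nat \<Rightarrow> complex"
  assume "\<exists>a<n. v a \<noteq> 0"
  then obtain a where a: "a < n" "v a \<noteq> 0" by blast
  have h: "herm_coeff (cf (\<Sum>l<n. area n (Q l))) i j = (\<Sum>m<n. Q m i * cnj (Q m j))" if "i < n" "j < n" for i j
    using herm_coeff_area_sum[OF that, where c = "\<lambda>_. 1" and m = n and Q = Q] by simp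
  have "\<exists>m<n. (\<Sum>i<n. Q m i * v i) \<noteq> 0"
  proof (rule ccontr)
    assume *: "\<not> ?thesis"
    have "v a = (\<Sum>i<n. (if a = i then 1 else 0) * v i)" using a(1) by (simp add: if_distrib[of "\<lambda>x. x * _"] cong: if_cong)
    also have "\<dots> = (\<Sum>i<n. (\<Sum>m<n. Q' a m * Q m i) * v i)"
      by (intro sum.cong refl) (use assms a(1) in \<open>simp add: inverse_matrices_def\<close>)
    also have "\<dots> = (\<Sum>i<n. \<Sum>m<n. Q' a m * (Q m i * v i))"
      by (simp add: sum_distrib_right mult.assoc)
    also have "\<dots> = (\<Sum>m<n. \<Sum>i<n. Q' a m * (Q m i * v i))" by (rule sum.swap)
    also have "\<dots> = (\<Sum>m<n. Q' a m * (\<Sum>i<n. Q m i * v i))" by (simp add: sum_distrib_left)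
    also have "\<dots> = 0" using * by simp
    finally show False using a(2) by simp
  qed
  then obtain m where m: "m < n" "(\<Sum>i<n. Q m i * v i) \<noteq> 0" by blast
  have "0 < (\<Sum>m<n. (cmod (\<Sum>i<n. Q m i * v i))\<^sup>2)"
    by (rule sum_pos2[of _ m]) (use m in auto)
  then show "0 < Re (quad_form n (herm_coeff (cf (\<Sum>l<n. area n (Q l)))) v)"
    by (subst quad_form_cholesky[OF h]) auto
qed

lemma kahler_convex:
  assumes "kahler n (cf a)" "kahler n (cf b)" "0 \<le> s" "s \<le> 1"
  shows "kahler n (cf (cst (of_real (1 - s)) * a + cst (of_real s) * b))"
  unfolding kahler_quad_form
proof (intro conjI allI impI)
  show "cf (cst (of_real (1 - s)) * a + cst (of_real s) * b) \<in> real_forms n 1"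
    using assms(1,2) unfolding kahler_def real_forms_cf
    by (simp add: cj_add cj_cst_mult forms_add forms_cst_mult cj_mult)
  fix v :: "nat \<Rightarrow> complex"
  assume v: "\<exists>a<n. v a \<noteq> 0"
  have "quad_form n (herm_coeff (cf (cst (of_real (1 - s)) * a + cst (of_real s) * b))) v =
      of_real (1 - s) * quad_form n (herm_coeff (cf a)) v + of_real s * quad_form n (herm_coeff (cf b)) v"
    unfolding quad_form_def herm_coeff_def sum_distrib_left sum.distrib[symmetric]
    by (intro sum.cong refl) (simp add: algebra_simps add_divide_distrib diff_divide_distrib)
  then have "Re (quad_form n (herm_coeff (cf (cst (of_real (1 - s)) * a + cst (of_real s) * b))) v) =
      (1 - s) * Re (quad_form n (herm_coeff (cf a)) v) + s * Re (quad_form n (herm_coeff (cf b)) v)" by simp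
  moreover have "0 < Re (quad_form n (herm_coeff (cf a)) v)" "0 < Re (quad_form n (herm_coeff (cf b)) v)"
    using assms(1,2) v unfolding kahler_quad_form by blast+
  ultimately show "0 < Re (quad_form n (herm_coeff (cf (cst (of_real (1 - s)) * a + cst (of_real s) * b))) v)"
    using assms(3,4) by (cases "s = 0") (auto intro!: add_nonneg_pos)
qed

subsection \<open>Positive simultaneously diagonal determinants\<close>

text \<open>Describes every point of the path: \<open>det M\<close> with moved slots as well as the
  powers of Kaehler forms.\<close>

definition pos_diag_det :: "nat \<Rightarrow> nat \<Rightarrow> ext \<Rightarrow> bool" where
  "pos_diag_det n k W \<longleftrightarrow> (\<exists>P P' B. inverse_matrices n P P' \<and> (\<forall>l<n. pos_def k (B l)) \<and>
     W = pull n P (diag n (mixed_disc k B)))"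

lemma pos_diag_det_pos:
  assumes "\<And>l. l < n \<Longrightarrow> pos_def k (B l)" "S \<subseteq> {..<n}" "card S = k"
  shows "\<exists>r>0. mixed_disc k B S = complex_of_real r"
  by (rule mixed_disc_pos) (use assms finite_subset[of S "{..<n}"] in auto)

lemma pos_diag_det_real:
  assumes "pos_diag_det n k W"
  shows "cf W \<in> forms n k k" "cj W = W"
proof -
  obtain P P' B where *: "inverse_matrices n P P'" "\<And>l. l < n \<Longrightarrow> pos_def k (B l)"
    "W = pull n P (diag n (mixed_disc k B))" using assms unfolding pos_diag_det_def by blast
  show "cf W \<in> forms n k k"
    unfolding *(3) by (intro pull.hom_forms diag_forms mixed_disc_card)
  have "cnj (mixed_disc k B S) = mixed_disc k B S" if "S \<subseteq> {..<n}" for S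
  proof -
    have "pos_def k (B l)" if "l \<in> S" for l using *(2) that \<open>S \<subseteq> {..<n}\<close> by auto
    then obtain r where "mixed_disc k B S = complex_of_real r" using mixed_disc_nonneg by blast
    then show ?thesis by simp
  qed
  then show "cj W = W" unfolding *(3) by (simp add: cj_pull cj_diag)
qed

lemma pos_diag_det_lefschetz:
  assumes W: "pos_diag_det n k W" and "0 < k" "p + q + k = n" "p \<le> 1"
  shows "ext_lefschetz n p q W"
proof -
  obtain P P' B where *: "inverse_matrices n P P'" "\<And>l. l < n \<Longrightarrow> pos_def k (B l)"
    "W = pull n P (diag n (mixed_disc k B))" using W unfolding pos_diag_det_def by blast
  have nz: "mixed_disc k B S \<noteq> 0" if "S \<subseteq> {..<n}" "card S = k" for S
    using pos_diag_det_pos[where B = B, OF *(2) that] by auto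
  have "ext_lefschetz n p q (diag n (mixed_disc k B))"
  proof (rule ext_lefschetz_of_inj[OF diag_forms[OF mixed_disc_card] assms(3)])
    fix a assume a: "cf a \<in> forms n p q" "a * diag n (mixed_disc k B) = 0"
    consider "p = 0" | "p = 1" using assms(4) by linarith
    then show "a = 0"
    proof cases
      case 1
      then show ?thesis using diag_injective_0[OF _ nz] a assms(3) by auto
    next
      case 2
      then show ?thesis
        using diag_injective_1[OF _ nz reduced_nonsingular_mixed_disc] a assms(2,3) *(2) by auto
    qed
  qed
  then show ?thesis unfolding *(3) by (rule ext_lefschetz_pull[OF *(1)])
qed

lemma inverse_matrices_mult:
  assumes PQ: "inverse_matrices n P P'" and RS: "inverse_matrices n R R'"
  shows "inverse_matrices n (\<lambda>i j. \<Sum>l<n. R i l * P l j) (\<lambda>i j. \<Sum>l<n. P' i l * R' l j)"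
proof -
  have *: "(\<Sum>m<n. (\<Sum>l<n. A a l * C l m) * (\<Sum>r<n. C' m r * A' r b)) = (if a = b then 1 else 0)"
    if A: "\<And>a b. a < n \<Longrightarrow> b < n \<Longrightarrow> (\<Sum>m<n. A a m * A' m b) = (if a = b then 1 else 0)"
      and C: "\<And>a b. a < n \<Longrightarrow> b < n \<Longrightarrow> (\<Sum>m<n. C a m * C' m b) = (if a = b then 1 else 0)"
      and ab: "a < n" "b < n" for A A' C C' :: "nat \<Rightarrow> nat \<Rightarrow> complex" and a b
  proof -
    have "(\<Sum>m<n. (\<Sum>l<n. A a l * C l m) * (\<Sum>r<n. C' m r * A' r b)) =
        (\<Sum>m<n. \<Sum>l<n. \<Sum>r<n. A a l * A' r b * (C l m * C' m r))"
      unfolding sum_product by (intro sum.cong refl) (simp add: mult_ac)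
    also have "\<dots> = (\<Sum>l<n. \<Sum>m<n. \<Sum>r<n. A a l * A' r b * (C l m * C' m r))" by (rule sum.swap)
    also have "\<dots> = (\<Sum>l<n. \<Sum>r<n. \<Sum>m<n. A a l * A' r b * (C l m * C' m r))"
      by (intro sum.cong refl sum.swap)
    also have "\<dots> = (\<Sum>l<n. \<Sum>r<n. if l = r then A a l * A' r b else 0)"
      by (intro sum.cong refl) (simp add: sum_distrib_left[symmetric] C)
    also have "\<dots> = (\<Sum>l<n. A a l * A' l b)" by simp
    finally show ?thesis by (simp add: A ab)
  qed
  show ?thesis
    unfolding inverse_matrices_def
  proof (intro allI impI conjI)
    fix a b assume "a < n" "b < n"
    then show "(\<Sum>m<n. (\<Sum>l<n. R a l * P l m) * (\<Sum>l<n. P' m l * R' l b)) = (if a = b then 1 else 0)"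
      "(\<Sum>m<n. (\<Sum>l<n. P' a l * R' l m) * (\<Sum>l<n. R m l * P l b)) = (if a = b then 1 else 0)"
      using PQ RS by (intro *; simp add: inverse_matrices_def)+
  qed
qed

lemma pos_diag_det_square_lefschetz:
  assumes W: "pos_diag_det n k W" and n: "k + 2 + q = n"
    and Q: "inverse_matrices n Q Q'" and \<omega>: "\<omega> = (\<Sum>l<n. area n (Q l))"
  shows "ext_lefschetz n 0 q (W * (\<omega> * \<omega>))"
proof -
  obtain P P' B where *: "inverse_matrices n P P'" "\<And>l. l < n \<Longrightarrow> pos_def k (B l)"
    "W = pull n P (diag n (mixed_disc k B))" using W unfolding pos_diag_det_def by blast
  have P': "inverse_matrices n P' P" using *(1) inverse_matrices_sym by blast
  \<comment> \<open>In the diagonalizing coordinates the reference form is still a sum of areas,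
    though in general not a diagonal one.\<close>
  define \<omega>' where "\<omega>' = pull n P' \<omega>"
  have \<omega>': "\<omega>' = (\<Sum>l<n. area n (\<lambda>j. \<Sum>m<n. Q l m * P' m j))"
    by (simp add: \<omega>'_def \<omega> pull.hom_sum pull_area)
  have f: "cf \<omega>' \<in> forms n 1 1" "cf \<omega> \<in> forms n 1 1"
    unfolding \<omega>' \<omega> by (intro forms_sum area_forms)+
  have "ext_lefschetz n 0 q (diag n (mixed_disc k B) * (\<omega>' * \<omega>'))"
  proof (rule ext_lefschetz_of_inj)
    show "cf (diag n (mixed_disc k B) * (\<omega>' * \<omega>')) \<in> forms n (k + 2) (k + 2)"
      using forms_mult[OF diag_forms[OF mixed_disc_card] forms_mult[OF f(1) f(1)]] by simp
    show "0 + q + (k + 2) = n" using n by simp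
    show "a = 0" if "cf a \<in> forms n 0 q" "a * (diag n (mixed_disc k B) * (\<omega>' * \<omega>')) = 0" for a
      by (rule diag_square_injective[OF n pos_diag_det_pos[OF *(2)] mixed_disc_card
            inverse_matrices_mult[OF P' Q] \<omega>' that])
  qed
  then have "ext_lefschetz n 0 q (pull n P (diag n (mixed_disc k B) * (\<omega>' * \<omega>')))"
    by (rule ext_lefschetz_pull[OF *(1)])
  moreover have "pull n P \<omega>' = \<omega>"
    unfolding \<omega>'_def by (rule pull_pull[OF *(1) forms_supported[OF f(2)]])
  ultimately show ?thesis by (simp add: *(3) pull.hom_mult)
qed

lemma wedge_power_cf: "wedge_power (cf a) m = cf (a ^ m)"
proof -
  have "wedge_power (cf a) m = cf (prod_list (replicate m a))"
    unfolding wedge_power_def wedge_list_cf[symmetric] by simp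
  also have "prod_list (replicate m a) = a ^ m" by (induction m) simp_all
  finally show ?thesis .
qed

text \<open>Only \<open>r = 0\<close> and \<open>r = 1\<close> occur, and \<open>r = 1\<close>
  leaves a degree with one entry 0; conjugation covers \<open>q < p\<close>.\<close>

lemma pos_diag_det_hodge_riemann_step:
  assumes W: "pos_diag_det n k W" and k: "0 < k" and n: "p + q + k = n" and min: "min p q \<le> 1"
    and \<omega>: "kahler n \<omega>" and r: "r \<le> min p q"
  shows "lefschetz n (p - r) (q - r) (wedge (cf W) (wedge_power \<omega> (2 * r)))"
proof -
  obtain Q Q' where Q: "inverse_matrices n Q Q'" and \<omega>Q: "\<omega> = cf (\<Sum>l<n. area n (Q l))"
    using kahler_coordinates[OF \<omega>] by blast
  define E where "E = (\<Sum>l<n. area n (Q l))"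
  have eq: "wedge (cf W) (wedge_power \<omega> (2 * r)) = cf (W * E ^ (2 * r))"
    unfolding \<omega>Q E_def[symmetric] wedge_power_cf by (simp add: times_ext.rep_eq)
  note re = pos_diag_det_real[OF W]
  have cjE: "cj E = E" by (simp add: E_def cj_sum cj_area)
  consider "r = 0" | "r = 1" "min p q = 1" using r min by linarith
  then have "ext_lefschetz n (p - r) (q - r) (W * E ^ (2 * r))"
  proof cases
    case 1
    have "ext_lefschetz n p q W"
    proof (cases "p \<le> q")
      case True
      then show ?thesis using pos_diag_det_lefschetz[OF W k n] min by simp
    next
      case False
      then have "ext_lefschetz n q p W" using pos_diag_det_lefschetz[OF W k, of q p] n min by simp
      then show ?thesis using re(2) by (rule ext_lefschetz_cj)
    qed
    then show ?thesis using 1 by simp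
  next
    case 2
    have E2: "E ^ (2 * r) = E * E" using 2(1) by (simp add: power2_eq_square)
    show ?thesis
    proof (cases "p \<le> q")
      case True
      then have "p - r = 0" "k + 2 + (q - r) = n" using 2 n by auto
      then show ?thesis unfolding E2 using pos_diag_det_square_lefschetz[OF W _ Q E_def] by simp
    next
      case False
      then have "q - r = 0" "k + 2 + (p - r) = n" using 2 n by auto
      then have "ext_lefschetz n (q - r) (p - r) (W * (E * E))"
        using pos_diag_det_square_lefschetz[OF W _ Q E_def] by simp
      then show ?thesis
        unfolding E2 by (rule ext_lefschetz_cj) (simp add: cj_mult cjE re(2))
    qed
  qed
  then show ?thesis unfolding eq by (rule lefschetz_cf)
qed

lemma ext_det_scalar: "ext_det k (\<lambda>a b. if a = b then E else 0) = E ^ k"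
proof -
  have "prod_list (map (\<lambda>a. if a = \<pi> a then E else 0) [0..<k]) = (if \<pi> = id then E ^ k else 0)"
    if "\<pi> permutes {..<k}" for \<pi>
  proof (cases "\<pi> = id")
    case True
    have "prod_list (map (\<lambda>_. E) [0..<k]) = E ^ k" by (induction k) (simp_all add: power_commutes)
    then show ?thesis using True by simp
  next
    case False
    then obtain a where a: "\<pi> a \<noteq> a" by (auto simp: fun_eq_iff)
    then have "a < k" using permutes_not_in[OF that, of a] by auto
    then have [simp]: "[0..<k] = [0..<a] @ a # [Suc a..<k]"
      by (metis add_0 le_add_diff_inverse less_imp_le_nat upt_add_eq_append upt_conv_Cons zero_le)
    show ?thesis using False a by auto
  qed
  then have "ext_det k (\<lambda>a b. if a = b then E else 0) =
      (\<Sum>\<pi> | \<pi> permutes {..<k}. if \<pi> = id then cst (of_int (sign \<pi>)) * E ^ k else 0)"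
    unfolding ext_det_def by (intro sum.cong refl) auto
  also have "\<dots> = E ^ k"
    by (subst sum.delta) (auto simp: finite_permutations permutes_id)
  finally show ?thesis .
qed

text \<open>With identity slots the matrix of forms is scalar, so its determinant is a power; this
  joins the two halves of the path.\<close>

lemma area_sum_power:
  "(\<Sum>l<n. area n (Q l)) ^ k = pull n Q (diag n (mixed_disc k (\<lambda>_. id_matrix)))"
proof -
  have "(\<lambda>a b. \<Sum>l<n. cst (id_matrix a b) * area n (Q l)) = (\<lambda>a b. if a = b then \<Sum>l<n. area n (Q l) else 0)"
    by (intro ext) (simp add: id_matrix_def)
  then show ?thesis
    using ext_det_simultaneously_diagonal[where k = k and n = n and B = "\<lambda>_. id_matrix" and P = Q]
    by (simp add: ext_det_scalar)
qed

lemma kahler_power_pos_diag_det: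
  assumes "kahler n (cf E)"
  shows "pos_diag_det n k (E ^ k)"
proof -
  obtain Q Q' where "inverse_matrices n Q Q'" "E = (\<Sum>l<n. area n (Q l))"
    using kahler_coordinates[OF assms] by (auto simp: cf_inject)
  then show ?thesis
    unfolding pos_diag_det_def
    by (intro exI[of _ Q] exI[of _ Q'] exI[of _ "\<lambda>_. id_matrix"]) (simp add: area_sum_power pos_def_id_matrix)
qed

section \<open>Continuity of the path and translation of the hypotheses\<close>

lemma continuous_on_mixed_disc_toward_id:
  "continuous_on A (\<lambda>t. mixed_disc k (\<lambda>l. toward_id (2 * t) (B l)) S)"
  unfolding mixed_disc_def sel_det_def toward_id_def by (intro continuous_intros)

lemma continuous_on_cf_mult:
  assumes "\<And>I J. continuous_on A (\<lambda>t. cf (a t) I J)" "\<And>I J. continuous_on A (\<lambda>t. cf (b t) I J)"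
  shows "continuous_on A (\<lambda>t. cf (a t * b t) I J)"
  unfolding cf_mult by (intro continuous_intros assms)

lemma continuous_on_cf_power:
  assumes "\<And>I J. continuous_on A (\<lambda>t. cf (a t) I J)"
  shows "continuous_on A (\<lambda>t. cf (a t ^ k) I J)"
  by (induction k arbitrary: I J) (simp_all add: continuous_on_cf_mult assms)

lemma continuous_on_pull_diag:
  assumes "\<And>S. continuous_on A (\<lambda>t. c t S)"
  shows "continuous_on A (\<lambda>t. cf (pull n P (diag n (c t))) I J)"
proof -
  have "continuous_on A (\<lambda>t. cf (diag n (c t)) K L)" for K L
  proof -
    \<comment> \<open>The conditions on index sets in \<open>cf_diag\<close> do not depend on
      \<open>t\<close>.\<close>
    have gate: "continuous_on A (\<lambda>t. if b then f t else 0)" if "continuous_on A f"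
      for b and f :: "_ \<Rightarrow> complex"
      using that by (cases b) auto
    show ?thesis unfolding cf_diag by (intro gate continuous_intros assms)
  qed
  then show ?thesis
    unfolding pull_def ext_hom_def cf_sum cf_cst_mult by (intro continuous_intros)
qed

text \<open>The Kaehler form attached to \<open>\<theta>\<close> has the coefficients
  \<open>quad_form k (B l) \<theta>\<close> in the diagonalizing coordinates, and a dual vector
  picks out a single one.\<close>

lemma griffiths_positive_pos_def:
  assumes P: "inverse_matrices n P P'" and M: "\<And>a b. a < k \<Longrightarrow> b < k \<Longrightarrow>
      M $$ (a, b) = cf (\<Sum>l<n. cst (B l a b) * area n (P l))"
    and herm: "\<And>l a b. l < n \<Longrightarrow> a < k \<Longrightarrow> b < k \<Longrightarrow> B l b a = cnj (B l a b)"
    and G: "griffiths_positive n k M" and l: "l < n"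
  shows "pos_def k (B l)"
  unfolding pos_def_def
proof (intro conjI allI impI)
  fix \<theta> :: "nat \<Rightarrow> complex"
  assume "\<exists>a<k. \<theta> a \<noteq> 0"
  then have "vec k \<theta> \<noteq> 0\<^sub>v k" by (metis index_vec index_zero_vec(1))
  then have "kahler n (\<lambda>I J. \<Sum>a<k. \<Sum>b<k. (vec k \<theta> $ a) * cnj (vec k \<theta> $ b) * (M $$ (a, b)) I J)"
    using G unfolding griffiths_positive_def by auto
  also have "(\<lambda>I J. \<Sum>a<k. \<Sum>b<k. (vec k \<theta> $ a) * cnj (vec k \<theta> $ b) * (M $$ (a, b)) I J) =
      cf (\<Sum>l<n. cst (quad_form k (B l) \<theta>) * area n (P l))"
  proof (intro ext)
    fix I J
    have "(\<Sum>a<k. \<Sum>b<k. (vec k \<theta> $ a) * cnj (vec k \<theta> $ b) * (M $$ (a, b)) I J) =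
        (\<Sum>a<k. \<Sum>b<k. \<Sum>l<n. \<theta> a * cnj (\<theta> b) * B l a b * cf (area n (P l)) I J)"
      by (intro sum.cong refl) (simp add: M cf_sum sum_distrib_left mult.assoc)
    also have "\<dots> = (\<Sum>a<k. \<Sum>l<n. \<Sum>b<k. \<theta> a * cnj (\<theta> b) * B l a b * cf (area n (P l)) I J)"
      by (intro sum.cong refl sum.swap)
    also have "\<dots> = (\<Sum>l<n. \<Sum>a<k. \<Sum>b<k. \<theta> a * cnj (\<theta> b) * B l a b * cf (area n (P l)) I J)"
      by (rule sum.swap)
    also have "\<dots> = cf (\<Sum>l<n. cst (quad_form k (B l) \<theta>) * area n (P l)) I J"
      by (simp add: cf_sum quad_form_def sum_distrib_right)
    finally show "(\<Sum>a<k. \<Sum>b<k. (vec k \<theta> $ a) * cnj (vec k \<theta> $ b) * (M $$ (a, b)) I J) = \<dots>" .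
  qed
  finally have K: "kahler n (cf (\<Sum>l<n. cst (quad_form k (B l) \<theta>) * area n (P l)))" .
  \<comment> \<open>Column \<open>l\<close> of the inverse matrix: every coordinate differential
    except that of \<open>l\<close> vanishes on it.\<close>
  define v where "v i = P' i l" for i
  have Pv: "(\<Sum>i<n. P m i * v i) = (if m = l then 1 else 0)" if "m < n" for m
    using P that l by (simp add: inverse_matrices_def v_def)
  have "\<exists>a<n. v a \<noteq> 0"
  proof (rule ccontr)
    assume "\<not> ?thesis"
    then have "(\<Sum>i<n. P l i * v i) = 0" by simp
    then show False using Pv[OF l] by simp
  qed
  then have "0 < Re (quad_form n (herm_coeff (cf (\<Sum>l<n. cst (quad_form k (B l) \<theta>) * area n (P l)))) v)"
    using K unfolding kahler_quad_form by blast
  also have "quad_form n (herm_coeff (cf (\<Sum>l<n. cst (quad_form k (B l) \<theta>) * area n (P l)))) v =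
      (\<Sum>i<n. \<Sum>j<n. \<Sum>m<n. quad_form k (B m) \<theta> * ((P m i * v i) * cnj (P m j * v j)))"
    unfolding quad_form_def[of n]
    by (intro sum.cong refl) (simp add: herm_coeff_area_sum sum_distrib_left mult_ac)
  also have "\<dots> = (\<Sum>i<n. \<Sum>m<n. \<Sum>j<n. quad_form k (B m) \<theta> * ((P m i * v i) * cnj (P m j * v j)))"
    by (intro sum.cong refl sum.swap)
  also have "\<dots> = (\<Sum>m<n. \<Sum>i<n. \<Sum>j<n. quad_form k (B m) \<theta> * ((P m i * v i) * cnj (P m j * v j)))"
    by (rule sum.swap)
  also have "\<dots> = (\<Sum>m<n. quad_form k (B m) \<theta> * ((\<Sum>i<n. P m i * v i) * cnj (\<Sum>j<n. P m j * v j)))"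
    by (simp only: cnj_sum sum_product) (simp only: sum_distrib_left)
  also have "\<dots> = (\<Sum>m<n. if m = l then quad_form k (B m) \<theta> else 0)"
    by (intro sum.cong refl) (simp add: Pv)
  also have "\<dots> = quad_form k (B l) \<theta>" using l by simp
  finally show "0 < Re (quad_form k (B l) \<theta>)" .
qed (use herm[OF l] in blast)

lemma invertible_mat_inverse_matrices:
  fixes P :: "complex mat"
  assumes "P \<in> carrier_mat n n" "invertible_mat P"
  shows "\<exists>P'. inverse_matrices n (\<lambda>i j. P $$ (i, j)) P'"
proof -
  obtain R where R: "P * R = 1\<^sub>m (dim_row P)" "R * P = 1\<^sub>m (dim_row R)"
    using assms(2) unfolding invertible_mat_def inverts_mat_def by blast
  have "dim_col R = n" using arg_cong[OF R(1), of dim_col] assms(1) by simp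
  moreover have "dim_row R = n" using arg_cong[OF R(2), of dim_col] assms(1) by simp
  ultimately have Rc: "R \<in> carrier_mat n n" by auto
  have "inverse_matrices n (\<lambda>i j. P $$ (i, j)) (\<lambda>i j. R $$ (i, j))"
    unfolding inverse_matrices_def
  proof (intro allI impI conjI)
    fix a b assume ab: "a < n" "b < n"
    have "(P * R) $$ (a, b) = (\<Sum>m<n. P $$ (a, m) * R $$ (m, b))"
      "(R * P) $$ (a, b) = (\<Sum>m<n. R $$ (a, m) * P $$ (m, b))"
      using ab assms(1) Rc by (auto simp: scalar_prod_def lessThan_atLeast0 intro!: sum.cong)
    then show "(\<Sum>m<n. P $$ (a, m) * R $$ (m, b)) = (if a = b then 1 else 0)"
      "(\<Sum>m<n. R $$ (a, m) * P $$ (m, b)) = (if a = b then 1 else 0)"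
      using R ab assms(1) Rc by auto
  qed
  then show ?thesis by blast
qed

lemma mat_adjoint_fixed_index:
  fixes A :: "complex mat"
  assumes "A \<in> carrier_mat k k" "mat_adjoint A = A" "a < k" "b < k"
  shows "A $$ (b, a) = cnj (A $$ (a, b))"
proof -
  have "mat_adjoint A $$ (b, a) = cnj (A $$ (a, b))"
    using assms(1,3,4) unfolding mat_adjoint_def by (auto simp: mat_of_rows_def conjugate_complex_def)
  then show ?thesis using assms(2) by simp
qed

lemma hodge_riemann_det:
  assumes P: "inverse_matrices n P P'" and pd: "\<And>l. l < n \<Longrightarrow> pos_def k (B l)"
    and k: "0 < k" and n: "p + q + k = n" and min: "min p q \<le> 1" and \<omega>: "kahler n \<omega>"
  shows "hodge_riemann n k p q \<omega> (cf (pull n P (diag n (mixed_disc k B))))"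
proof -
  define E0 where "E0 = (\<Sum>l<n. area n (P l))"
  obtain Q Q' where Q: "inverse_matrices n Q Q'" and \<omega>Q: "\<omega> = cf (\<Sum>l<n. area n (Q l))"
    using kahler_coordinates[OF \<omega>] by blast
  define E1 where "E1 = (\<Sum>l<n. area n (Q l))"
  \<comment> \<open>All slots move to the identity simultaneously while \<open>2 * t\<close> runs
    through the unit interval.\<close>
  define F where "F t = pull n P (diag n (mixed_disc k (\<lambda>l. toward_id (2 * t) (B l))))" for t
  \<comment> \<open>The segment of Kaehler forms from the sum of the diagonalizing areas to the
    reference form, with parameter \<open>2 * t - 1\<close>.\<close>
  define E where "E t = cst (of_real (1 - (2 * t - 1))) * E0 + cst (of_real (2 * t - 1)) * E1" for t
  define W where "W t = (if t \<le> 1 / 2 then F t else E t ^ k)" for t :: real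
  have good: "pos_diag_det n k (W t)" if t: "0 \<le> t" "t \<le> 1" for t
  proof (cases "t \<le> 1 / 2")
    case True
    have "pos_def k (toward_id (2 * t) (B l))" if l: "l < n" for l
      using pos_def_toward_id[OF pd[OF l]] True t by fastforce
    then have "pos_diag_det n k (F t)"
      unfolding pos_diag_det_def F_def using P
      by (intro exI[of _ P] exI[of _ P'] exI[of _ "\<lambda>l. toward_id (2 * t) (B l)"]) simp
    then show ?thesis using True by (simp add: W_def)
  next
    case False
    have "kahler n (cf (E t))"
      unfolding E_def
    proof (rule kahler_convex)
      show "kahler n (cf E0)" unfolding E0_def by (rule kahler_area_sum[OF P])
      show "kahler n (cf E1)" unfolding E1_def by (rule kahler_area_sum[OF Q])
    qed (use False t in auto)
    then show ?thesis using False kahler_power_pos_diag_det by (simp add: W_def)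
  qed
  have "continuous_on {0..1} (\<lambda>t. cf (W t) I J)" for I J
  proof -
    have "continuous_on {0..1} (\<lambda>t. if t \<le> 1 / 2 then cf (F t) I J else cf (E t ^ k) I J)"
    proof (rule continuous_on_cases_le)
      show "continuous_on {t \<in> {0..1}. t \<le> 1 / 2} (\<lambda>t. cf (F t) I J)"
        unfolding F_def by (intro continuous_on_pull_diag continuous_on_mixed_disc_toward_id)
      have "continuous_on {t \<in> {0..1}. 1 / 2 \<le> t} (\<lambda>t. cf (E t) I J)" for I J
        unfolding E_def cf_simps cf_cst_mult by (intro continuous_intros)
      then show "continuous_on {t \<in> {0..1}. 1 / 2 \<le> t} (\<lambda>t. cf (E t ^ k) I J)"
        by (rule continuous_on_cf_power)
      \<comment> \<open>At the joint all slots are the identity and the segment is at its start, so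
        both branches equal \<open>E0 ^ k\<close>.\<close>
      fix t :: real assume t: "t = 1 / 2"
      have "toward_id (2 * t) H = id_matrix" for H by (intro ext) (simp add: toward_id_def t)
      then have "F t = E0 ^ k" by (simp add: F_def E0_def area_sum_power)
      moreover have "E t = E0" by (simp add: E_def t)
      ultimately show "cf (F t) I J = cf (E t ^ k) I J" by simp
    qed (intro continuous_intros)
    then show ?thesis by (simp add: W_def if_distrib[of "\<lambda>a. cf a I J"])
  qed
  then have "continuous_on {0..1} (\<lambda>t. cf (W t))"
    by (intro continuous_on_coordinatewise_then_product)
  moreover have "\<forall>t\<in>{0..1}. cf (W t) \<in> real_forms n k"
    using pos_diag_det_real[OF good] by (simp add: real_forms_cf)
  moreover have "W 0 = pull n P (diag n (mixed_disc k B))"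
  proof -
    have "toward_id (2 * 0) H = H" for H by (intro ext) (simp add: toward_id_def)
    then show ?thesis by (simp add: W_def F_def)
  qed
  moreover have "cf (W 1) = wedge_power \<omega> k"
    by (simp add: W_def E_def \<omega>Q E1_def wedge_power_cf)
  moreover have "\<forall>t\<in>{0..1}. \<forall>r\<le>min p q.
      lefschetz n (p - r) (q - r) (wedge (cf (W t)) (wedge_power \<omega> (2 * r)))"
    using pos_diag_det_hodge_riemann_step[OF good k n min \<omega>] by simp
  ultimately show ?thesis
    unfolding hodge_riemann_def by (intro exI[of _ "\<lambda>t. cf (W t)"]) simp
qed

theorem theorem2:
  fixes n k :: nat and M :: "form mat"
  assumes "n \<ge> 4" and "2 \<le> k" and "k \<le> n - 2"
    and "hermitian_form_matrix n k M"
    and "griffiths_positive n k M"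
    and "simultaneously_diagonalizable n k M"
  shows "lefschetz n 1 (n - k - 1) (det_form M) \<and>
    (\<forall>p q. p + q = n - k \<longrightarrow> min p q \<le> 1 \<longrightarrow>
      (\<forall>\<omega>. kahler n \<omega> \<longrightarrow> hodge_riemann n k p q \<omega> (det_form M)))"
proof -
  obtain P0 B0 where P0: "P0 \<in> carrier_mat n n" "invertible_mat P0"
    and B0: "\<And>l. l < n \<Longrightarrow> B0 l \<in> carrier_mat k k \<and> mat_adjoint (B0 l) = B0 l"
    and M0: "\<And>a b. a < k \<Longrightarrow> b < k \<Longrightarrow>
      M $$ (a, b) = (\<lambda>I J. \<Sum>l<n. B0 l $$ (a, b) * coord_area n P0 l I J)"
    using assms(6) unfolding simultaneously_diagonalizable_def by blast
  define P where "P i j = P0 $$ (i, j)" for i j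
  define B where "B l a b = B0 l $$ (a, b)" for l a b
  obtain P' where P: "inverse_matrices n P P'"
    using invertible_mat_inverse_matrices[OF P0] unfolding P_def by blast
  have M: "M $$ (a, b) = cf (\<Sum>l<n. cst (B l a b) * area n (P l))" if "a < k" "b < k" for a b
  proof -
    have "P l = (\<lambda>i. P0 $$ (l, i))" for l by (simp add: P_def fun_eq_iff)
    then show ?thesis unfolding M0[OF that] by (intro ext) (simp add: cf_sum B_def cf_area)
  qed
  have herm: "B l b a = cnj (B l a b)" if "l < n" "a < k" "b < k" for l a b
    using mat_adjoint_fixed_index[of "B0 l" k a b] B0[OF that(1)] that by (simp add: B_def)
  have pd: "pos_def k (B l)" if "l < n" for l
    by (rule griffiths_positive_pos_def[OF P M herm assms(5) that])
  define W where "W = pull n P (diag n (mixed_disc k B))"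
  have "M \<in> carrier_mat k k" using assms(4) by (simp add: hermitian_form_matrix_def)
  then have det: "det_form M = cf W"
    unfolding W_def ext_det_simultaneously_diagonal[symmetric] by (rule det_form_ext_det[OF _ M])
  have k: "0 < k" "k < n" using assms by auto
  have good: "pos_diag_det n k W" unfolding pos_diag_det_def W_def using P pd by blast
  show ?thesis
  proof (intro conjI allI impI)
    show "lefschetz n 1 (n - k - 1) (det_form M)"
      unfolding det by (intro lefschetz_cf pos_diag_det_lefschetz[OF good]) (use k in auto)
    fix p q \<omega> assume "p + q = n - k" "min p q \<le> 1" "kahler n \<omega>"
    then show "hodge_riemann n k p q \<omega> (det_form M)"
      unfolding det W_def by (intro hodge_riemann_det[OF P pd]) (use k in auto)
  qed
qed

end
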